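(* Let $0<d<n$ be integers, let $\varepsilon>0$ be small enough depending only on $n$ and $d$, let $E\subseteq B(0,1)\subset\mathbb{R}^n$ be one-sided $(\varepsilon,d)$-Reifenberg flat, with a coherent collection of balls and planes for $E$ and the associated maps $f_k$, numbers $\varepsilon_k(\cdot)$, and David--Toro map $f\colon\Sigma_0\to\Sigma=f(\Sigma_0)$. Let $\eta$ be a positive function such that $\eta(r_k)^2$ satisfies the Dini condition, i.e. $\sum_{k=1}^\infty\eta(r_k)^2<\infty$, and assume that there exists $M>0$ such that $$\sum_{k=0}^{\infty}\left(\frac{\varepsilon_k(f_k(z))}{r_k\,\eta(r_k)}\right)^2\le M\qquad\text{for all }z\in\Sigma_0 .$$ Then $f\colon\Sigma_0\to\Sigma$ is invertible and differentiable, and both $f$ and its inverse have Lipschitz directional derivatives (for the inverse: derivatives along directions tangent to $\Sigma$). In particular, $f$ is continuously differentiable. Moreover, the Lipschitz constants depend only on $n$, $d$ and $M$.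
   Context: Notation: $r_k=10^{-k}$; $B(x,r)$ is the ball of centre $x$ and radius $r$; "$d$-plane" means $d$-dimensional affine subspace of $\mathbb{R}^n$. Normalized Hausdorff distance: $d_{x,r}(F,G)=\frac1r\max\{\sup_{y\in F\cap B(x,r)}\operatorname{dist}(y,G),\ \sup_{y\in G\cap B(x,r)}\operatorname{dist}(y,F)\}$ for nonempty $F,G\subseteq\mathbb{R}^n$. One-sided Reifenberg flat: $E\subseteq\mathbb{R}^n$ is one-sided $(\varepsilon,d)$-Reifenberg flat if (1) for every $x\in E$, $0<r\le10$ there is a $d$-plane $P(x,r)$ through $x$ with $\operatorname{dist}(y,P(x,r))\le\varepsilon r$ for $y\in E\cap B(x,r)$; and (2) $d_{x,10^{-k}}(P(x,10^{-k}),P(x,10^{-k+1}))\le\varepsilon$ for all $x\in E$, $k\ge0$, and $d_{x,10^{-k+2}}(P(x,10^{-k}),P(y,10^{-k}))\le\varepsilon$ for all $k\ge0$ and $x,y\in E$ with $|x-y|\le10^{-k+2}$. Coherent collection of balls and planes for $E$: for each $k\ge0$ a maximal collection $\{x_{j,k}\}_{j\in J_k}\subset E$ with $|x_{i,k}-x_{j,k}|\ge r_k$ for $i\ne j$; balls $B_{j,k}=B(x_{j,k},r_k)$, $\lambda B_{j,k}=B(x_{j,k},\lambda r_k)$, $V_k^\lambda=\bigcup_{j\in J_k}\lambda B_{j,k}$; a $d$-plane $\Sigma_0$ with $\operatorname{dist}(x_{j,0},\Sigma_0)\le\varepsilon$ for $j\in J_0$; and $d$-planes $P_{j,k}\ni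 x_{j,k}$ such that $d_{x_{j,k},100r_k}(P_{i,k},P_{j,k})\le\varepsilon$ whenever $i,j\in J_k$, $|x_{i,k}-x_{j,k}|\le100r_k$; $d_{x_{i,0},100}(P_{i,0},\Sigma_0)\le\varepsilon$ for $i\in J_0$; $d_{x_{i,k},20r_k}(P_{i,k},P_{j,k+1})\le\varepsilon$ whenever $i\in J_k$, $j\in J_{k+1}$, $|x_{i,k}-x_{j,k+1}|\le2r_k$. Numbers $\varepsilon_k$: for $y\in V_k^{10}$, $\varepsilon_k(y)=\sup\{d_{x_{i,l},100r_l}(P_{j,k},P_{i,l}) : j\in J_k,\ l\in\{k-1,k\},\ i\in J_l,\ y\in10B_{j,k}\cap11B_{i,l}\}$ (for $k=0$ there is no generation $-1$, so only $l=0$ occurs), and $\varepsilon_k(y)=0$ for $y\in\mathbb{R}^n\setminus V_k^{10}$. David--Toro map: $\theta_{j,k}\ge0$ (compactly supported in $10B_{j,k}$) and $\psi_k$ are smooth functions on $\mathbb{R}^n$ with $\psi_k+\sum_{j\in J_k}\theta_{j,k}\equiv1$, $\psi_k=0$ on $V_k^8$, $|\nabla^m\theta_{j,k}|\le C_mr_k^{-m}$, $|\nabla^m\psi_k|\le C_mr_k^{-m}$. With $\pi_{j,k}$ the orthogonal projection onto $P_{j,k}$, $\sigma_k(y)=\psi_k(y)y+\sum_{j\in J_k}\theta_{j,k}(y)\pi_{j,k}(y)$, $f_0(y)=y$, $f_{k+1}=\sigma_k\circ f_k$. The $f_k$ converge uniformly to a continuous $f\colon\mathbb{R}^n\to\mathbb{R}^n$;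 its restriction to $\Sigma_0$, still denoted $f$, is the David--Toro map.
   Formalization: The Lipschitz constants are allowed to depend, besides n, d and M (and the fixed constants C_m), on an upper bound for the Dini sum of η(r_k)^2; dependence on n, d and M alone fails, since multiplying η by a large constant makes any M admissible. *)

theory Defs
  imports "HOL-Analysis.Analysis"
begin

section \<open>Planes, normalized Hausdorff distance, Reifenberg flatness\<close>

definition rad :: "nat \<Rightarrow> real" where
  "rad k = (1 / 10) ^ k"

definition d_plane :: "nat \<Rightarrow> 'a::euclidean_space set \<Rightarrow> bool" where
  "d_plane d P \<longleftrightarrow> affine P \<and> aff_dim P = int d"

definition directions :: "'a::real_vector set \<Rightarrow> 'a set" where
  "directions P = {a - b | a b. a \<in> P \<and> b \<in> P}"

text \<open>Inserting 0 fixes the convention that a supremum of nonnegative numbers over the empty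
  set is 0 (\<open>Sup {}\<close> is unspecified on the reals); otherwise it changes nothing, as \<open>infdist\<close> is
  nonnegative.\<close>

definition excess :: "'a::metric_space \<Rightarrow> real \<Rightarrow> 'a set \<Rightarrow> 'a set \<Rightarrow> real" where
  "excess x r F G = Sup (insert 0 ((\<lambda>y. infdist y G) ` (F \<inter> ball x r)))"

definition hd_norm :: "'a::metric_space \<Rightarrow> real \<Rightarrow> 'a set \<Rightarrow> 'a set \<Rightarrow> real" where
  "hd_norm x r F G = 1 / r * max (excess x r F G) (excess x r G F)"

definition one_sided_reifenberg_flat :: "real \<Rightarrow> nat \<Rightarrow> 'a::euclidean_space set \<Rightarrow> bool" where
  "one_sided_reifenberg_flat \<epsilon> d E \<longleftrightarrow>
    (\<exists>P :: 'a \<Rightarrow> real \<Rightarrow> 'a set.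
      (\<forall>x\<in>E. \<forall>r. 0 < r \<and> r \<le> 10 \<longrightarrow>
         d_plane d (P x r) \<and> x \<in> P x r \<and>
         (\<forall>y \<in> E \<inter> ball x r. infdist y (P x r) \<le> \<epsilon> * r)) \<and>
      (\<forall>x\<in>E. \<forall>k. hd_norm x (rad k) (P x (rad k)) (P x (10 * rad k)) \<le> \<epsilon>) \<and>
      (\<forall>k. \<forall>x\<in>E. \<forall>y\<in>E. dist x y \<le> 100 * rad k \<longrightarrow>
         hd_norm x (100 * rad k) (P x (rad k)) (P y (rad k)) \<le> \<epsilon>))"


section \<open>Coherent collections of balls and planes\<close>

text \<open>A family is indexed by a set \<open>J k\<close> of natural numbers in generation \<open>k\<close>, with \<open>x k j\<close> for
  $x_{j,k}$ and \<open>P k j\<close> for $P_{j,k}$. For a bounded set a separated family is finite, so natural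
  numbers suffice as indices.\<close>

definition separated :: "real \<Rightarrow> 'a::metric_space set \<Rightarrow> bool" where
  "separated r A \<longleftrightarrow> (\<forall>a\<in>A. \<forall>b\<in>A. a \<noteq> b \<longrightarrow> r \<le> dist a b)"

definition maximal_separated_family ::
    "'a::metric_space set \<Rightarrow> real \<Rightarrow> nat set \<Rightarrow> (nat \<Rightarrow> 'a) \<Rightarrow> bool" where
  "maximal_separated_family E r I c \<longleftrightarrow>
    c ` I \<subseteq> E \<and>
    (\<forall>i\<in>I. \<forall>j\<in>I. i \<noteq> j \<longrightarrow> r \<le> dist (c i) (c j)) \<and>
    (\<forall>A. c ` I \<subseteq> A \<and> A \<subseteq> E \<and> separated r A \<longrightarrow> A = c ` I)"

definition V :: "(nat \<Rightarrow> nat set) \<Rightarrow> (nat \<Rightarrow> nat \<Rightarrow> 'a::metric_space) \<Rightarrow> real \<Rightarrow> nat \<Rightarrow> 'a set" where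
  "V J x t k = (\<Union>j\<in>J k. ball (x k j) (t * rad k))"

definition coherent_collection ::
    "real \<Rightarrow> nat \<Rightarrow> 'a::euclidean_space set \<Rightarrow> (nat \<Rightarrow> nat set) \<Rightarrow> (nat \<Rightarrow> nat \<Rightarrow> 'a) \<Rightarrow>
     (nat \<Rightarrow> nat \<Rightarrow> 'a set) \<Rightarrow> 'a set \<Rightarrow> bool" where
  "coherent_collection \<epsilon> d E J x P \<Sigma>0 \<longleftrightarrow>
    (\<forall>k. maximal_separated_family E (rad k) (J k) (x k)) \<and>
    d_plane d \<Sigma>0 \<and>
    (\<forall>j\<in>J 0. infdist (x 0 j) \<Sigma>0 \<le> \<epsilon>) \<and>
    (\<forall>k. \<forall>j\<in>J k. d_plane d (P k j) \<and> x k j \<in> P k j) \<and>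
    (\<forall>k. \<forall>i\<in>J k. \<forall>j\<in>J k. dist (x k i) (x k j) \<le> 100 * rad k \<longrightarrow>
       hd_norm (x k j) (100 * rad k) (P k i) (P k j) \<le> \<epsilon>) \<and>
    (\<forall>i\<in>J 0. hd_norm (x 0 i) 100 (P 0 i) \<Sigma>0 \<le> \<epsilon>) \<and>
    (\<forall>k. \<forall>i\<in>J k. \<forall>j\<in>J (Suc k). dist (x k i) (x (Suc k) j) \<le> 2 * rad k \<longrightarrow>
       hd_norm (x k i) (20 * rad k) (P k i) (P (Suc k) j) \<le> \<epsilon>)"

text \<open>For \<open>k = 0\<close> truncated subtraction gives \<open>{k - 1, k} = {0}\<close>, so that only \<open>l = 0\<close> occurs.\<close>

definition eps_num ::
    "(nat \<Rightarrow> nat set) \<Rightarrow> (nat \<Rightarrow> nat \<Rightarrow> 'a::metric_space) \<Rightarrow> (nat \<Rightarrow> nat \<Rightarrow> 'a set) \<Rightarrow>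
     nat \<Rightarrow> 'a \<Rightarrow> real" where
  "eps_num J x P k y =
    (if y \<in> V J x 10 k
     then Sup {hd_norm (x l i) (100 * rad l) (P k j) (P l i) | j l i.
            j \<in> J k \<and> l \<in> {k - 1, k} \<and> i \<in> J l \<and>
            y \<in> ball (x k j) (10 * rad k) \<inter> ball (x l i) (11 * rad l)}
     else 0)"


section \<open>Smooth functions and the partition of unity\<close>

text \<open>\<open>nabla [v\<^sub>1, \<dots>, v\<^sub>m] g y\<close> is the \<open>m\<close>-th derivative of \<open>g\<close> at \<open>y\<close>, a multilinear form, applied
  to \<open>v\<^sub>1, \<dots>, v\<^sub>m\<close>; \<open>nabla_bound m g K\<close> bounds its operator norm by \<open>K\<close> at every point.\<close>

primrec nabla ::
    "'a::real_normed_vector list \<Rightarrow> ('a \<Rightarrow> 'b::real_normed_vector) \<Rightarrow> 'a \<Rightarrow> 'b" where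
  "nabla [] g = g"
| "nabla (v # vs) g = (\<lambda>y. frechet_derivative (nabla vs g) (at y) v)"

definition smooth :: "('a::real_normed_vector \<Rightarrow> 'b::real_normed_vector) \<Rightarrow> bool" where
  "smooth g \<longleftrightarrow> (\<forall>vs y. nabla vs g differentiable (at y))"

definition nabla_bound ::
    "nat \<Rightarrow> ('a::real_normed_vector \<Rightarrow> 'b::real_normed_vector) \<Rightarrow> real \<Rightarrow> bool" where
  "nabla_bound m g K \<longleftrightarrow>
    (\<forall>vs y. length vs = m \<and> (\<forall>v\<in>set vs. norm v = 1) \<longrightarrow> norm (nabla vs g y) \<le> K)"

definition DT_partition ::
    "(nat \<Rightarrow> real) \<Rightarrow> (nat \<Rightarrow> nat set) \<Rightarrow> (nat \<Rightarrow> nat \<Rightarrow> 'a::euclidean_space) \<Rightarrow>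
     (nat \<Rightarrow> nat \<Rightarrow> 'a \<Rightarrow> real) \<Rightarrow> (nat \<Rightarrow> 'a \<Rightarrow> real) \<Rightarrow> bool" where
  "DT_partition C J x \<theta> \<psi> \<longleftrightarrow>
    (\<forall>k. \<forall>j\<in>J k.
       smooth (\<theta> k j) \<and> (\<forall>y. 0 \<le> \<theta> k j y) \<and>
       compact (closure {y. \<theta> k j y \<noteq> 0}) \<and>
       closure {y. \<theta> k j y \<noteq> 0} \<subseteq> ball (x k j) (10 * rad k) \<and>
       (\<forall>m. nabla_bound m (\<theta> k j) (C m / rad k ^ m))) \<and>
    (\<forall>k. smooth (\<psi> k) \<and> (\<forall>y \<in> V J x 8 k. \<psi> k y = 0) \<and>
       (\<forall>m. nabla_bound m (\<psi> k) (C m / rad k ^ m))) \<and>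
    (\<forall>k y. \<psi> k y + (\<Sum>j\<in>J k. \<theta> k j y) = 1)"


section \<open>The David--Toro map\<close>

definition orth_proj :: "'a::euclidean_space set \<Rightarrow> 'a \<Rightarrow> 'a" where
  "orth_proj P y = (THE p. p \<in> P \<and> (\<forall>q\<in>P. orthogonal (y - p) (q - p)))"

lemma orth_proj_unique:
  assumes "p \<in> P" "\<forall>q\<in>P. orthogonal (y - p) (q - p)"
  shows "orth_proj P y = p"
  unfolding orth_proj_def
proof (rule the_equality)
  show "p \<in> P \<and> (\<forall>q\<in>P. orthogonal (y - p) (q - p))"
    using assms by blast
  fix p' assume p': "p' \<in> P \<and> (\<forall>q\<in>P. orthogonal (y - p') (q - p'))"
  have "(y - p) \<bullet> (p' - p) = 0" "(y - p') \<bullet> (p - p') = 0"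
    using assms p' by (auto simp: orthogonal_def)
  then have "(p' - p) \<bullet> (p' - p) = 0"
    by (simp add: algebra_simps inner_commute)
  then show "p' = p" by simp
qed

lemma orth_proj_eq_closest_point:
  assumes "affine P" "P \<noteq> {}"
  shows "orth_proj P y = closest_point P y"
proof (rule orth_proj_unique)
  have cl: "closed P" and cv: "convex P"
    using assms affine_closed affine_imp_convex by blast+
  let ?p = "closest_point P y"
  show p: "?p \<in> P" by (simp add: assms(2) cl closest_point_in_set)
  show "\<forall>q\<in>P. orthogonal (y - ?p) (q - ?p)"
  proof
    fix q assume q: "q \<in> P"
    have "2 *\<^sub>R ?p + (-1) *\<^sub>R q \<in> P"
      by (rule mem_affine[OF assms(1) p q]) simp
    then have r: "2 *\<^sub>R ?p - q \<in> P" by simp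
    have "(y - ?p) \<bullet> (q - ?p) \<le> 0" "(y - ?p) \<bullet> ((2 *\<^sub>R ?p - q) - ?p) \<le> 0"
      using closest_point_dot[OF cv cl] q r by blast+
    then show "orthogonal (y - ?p) (q - ?p)"
      unfolding orthogonal_def by (simp add: algebra_simps scaleR_2)
  qed
qed

definition sigma_map ::
    "(nat \<Rightarrow> nat set) \<Rightarrow> (nat \<Rightarrow> nat \<Rightarrow> 'a::euclidean_space set) \<Rightarrow>
     (nat \<Rightarrow> nat \<Rightarrow> 'a \<Rightarrow> real) \<Rightarrow> (nat \<Rightarrow> 'a \<Rightarrow> real) \<Rightarrow> nat \<Rightarrow> 'a \<Rightarrow> 'a" where
  "sigma_map J P \<theta> \<psi> k y =
    \<psi> k y *\<^sub>R y + (\<Sum>j\<in>J k. \<theta> k j y *\<^sub>R orth_proj (P k j) y)"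

primrec DT_iter ::
    "(nat \<Rightarrow> nat set) \<Rightarrow> (nat \<Rightarrow> nat \<Rightarrow> 'a::euclidean_space set) \<Rightarrow>
     (nat \<Rightarrow> nat \<Rightarrow> 'a \<Rightarrow> real) \<Rightarrow> (nat \<Rightarrow> 'a \<Rightarrow> real) \<Rightarrow> nat \<Rightarrow> 'a \<Rightarrow> 'a" where
  "DT_iter J P \<theta> \<psi> 0 = (\<lambda>y. y)"
| "DT_iter J P \<theta> \<psi> (Suc k) = sigma_map J P \<theta> \<psi> k \<circ> DT_iter J P \<theta> \<psi> k"

definition DT_map ::
    "(nat \<Rightarrow> nat set) \<Rightarrow> (nat \<Rightarrow> nat \<Rightarrow> 'a::euclidean_space set) \<Rightarrow>
     (nat \<Rightarrow> nat \<Rightarrow> 'a \<Rightarrow> real) \<Rightarrow> (nat \<Rightarrow> 'a \<Rightarrow> real) \<Rightarrow> 'a \<Rightarrow> 'a" where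
  "DT_map J P \<theta> \<psi> y = lim (\<lambda>k. DT_iter J P \<theta> \<psi> k y)"


section \<open>Derivatives of maps defined on subsets\<close>

text \<open>Derivatives of a map on \<open>S\<close> are taken with \<open>at p within S\<close>. Such a derivative is in general
  determined only on tangent vectors, so \<open>dir_deriv S g p v\<close> is to be used only for \<open>v\<close> tangent
  to \<open>S\<close> at \<open>p\<close>, where it is the derivative of \<open>g \<circ> \<gamma>\<close> for any curve \<open>\<gamma>\<close> in \<open>S\<close> through \<open>p\<close> with
  velocity \<open>v\<close>.\<close>

definition tangent_vectors :: "'a::real_normed_vector set \<Rightarrow> 'a \<Rightarrow> 'a set" where
  "tangent_vectors S p =
    {v. \<exists>\<gamma>. range \<gamma> \<subseteq> S \<and> \<gamma> 0 = p \<and> (\<gamma> has_vector_derivative v) (at (0::real))}"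

definition dir_deriv ::
    "'a::real_normed_vector set \<Rightarrow> ('a \<Rightarrow> 'b::real_normed_vector) \<Rightarrow> 'a \<Rightarrow> 'a \<Rightarrow> 'b" where
  "dir_deriv S g p v = frechet_derivative g (at p within S) v"

definition unit_tangent_bundle :: "'a::real_normed_vector set \<Rightarrow> ('a \<times> 'a) set" where
  "unit_tangent_bundle S = {(p, v). p \<in> S \<and> v \<in> tangent_vectors S p \<and> norm v = 1}"

definition continuously_differentiable_on ::
    "'a::real_normed_vector set \<Rightarrow> ('a \<Rightarrow> 'b::real_normed_vector) \<Rightarrow> bool" where
  "continuously_differentiable_on S g \<longleftrightarrow>
    (\<exists>g' :: 'a \<Rightarrow> 'a \<Rightarrow>\<^sub>L 'b.
      (\<forall>p\<in>S. (g has_derivative blinfun_apply (g' p)) (at p within S)) \<and> continuous_on S g')"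

end

theory Submission
  imports Defs
begin

text \<open>
  The displacement of \<open>\<sigma>\<^sub>k\<close> at \<open>y\<close> is \<open>\<Sum>j. \<theta>\<^sub>j\<^sub>,\<^sub>k(y) (\<pi>\<^sub>j\<^sub>,\<^sub>k(y) - y)\<close>. Along an orbit \<open>f\<^sub>k(z)\<close> that starts on \<open>\<Sigma>0\<close>, the point
  \<open>f\<^sub>k(z)\<close> is close to the planes of generation \<open>k\<close> that act on it, and the images of the directions of \<open>\<Sigma>0\<close> under
  the derivative of \<open>f\<^sub>k\<close> are almost parallel to them; relative to the scale \<open>r\<^sub>k\<close>, both errors are of the order of
  \<open>\<beta>\<^sub>k = \<epsilon>\<^sub>k\<^sub>-\<^sub>1(f\<^sub>k\<^sub>-\<^sub>1(z)) + \<epsilon>\<^sub>k(f\<^sub>k(z))\<close> (lemmas \<open>near\<close> and \<open>tangential\<close>). The reason is that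
  \<open>f\<^sub>k(z)\<close> was produced one step earlier by averaging projections onto almost equal planes.
  So a step changes first derivatives by a factor \<open>1 + O(\<beta>\<^sub>k)\<close> and creates second derivatives of
  size \<open>\<beta>\<^sub>k / r\<^sub>k\<close>, because each derivative of \<open>\<theta>\<close> costs a factor \<open>1 / r\<^sub>k\<close>.

  The hypothesis bounds \<open>\<Sum>k. \<beta>\<^sub>k / r\<^sub>k\<close> uniformly along orbits (\<open>sum_beta_bound\<close>). Therefore the
  second derivatives of all \<open>f\<^sub>k\<close> along \<open>\<Sigma>0\<close> are bounded (\<open>D2f_le\<close>), the first derivatives are
  bounded from above and below and converge geometrically, and the limit \<open>f\<close> has a Lipschitz
  derivative that is injective on the directions of \<open>\<Sigma>0\<close>. Second derivatives are not tangent to the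
  surfaces, and on them the derivative of \<open>\<sigma>\<^sub>k\<close> is under control only where \<open>\<psi>\<^sub>k = 0\<close>. But an orbit
  meets a region with \<open>\<psi>\<^sub>k \<noteq> 0\<close> while it still moves at most once, at its last step.

  Small distances are expanded by \<open>f\<close> up to a constant because of these derivative bounds. For
  larger distances, and in particular for global injectivity, flatness is what helps: chords of
  \<open>f\<^sub>k(\<Sigma>0)\<close> of length at most \<open>r\<^sub>k\<close> are almost parallel to the planes, so a step shrinks
  distances at most by a factor 2 (\<open>dist_step_lower\<close>), while \<open>f\<^sub>k\<close> is within \<open>r\<^sub>k / 2 = 10\<^sup>-\<^sup>k / 2\<close> of \<open>f\<close>.

  An immersion with Lipschitz derivative that expands distances up to a constant has an inverse
  of the same kind (locale \<open>C11_parametrization\<close>). If \<open>p = f(z)\<close> and \<open>v\<close> is the derivative of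
  the inverse at \<open>p\<close> along a tangent vector \<open>w\<close>, then the derivative of \<open>f\<close> at \<open>z\<close> along \<open>v\<close> is
  \<open>w\<close>, and this equation determines how \<open>v\<close> depends on \<open>p\<close> and \<open>w\<close>.
\<close>

section \<open>Overlap of separated families\<close>

text \<open>Rescaled to unit separation, the points lie in a fixed ball, which finitely many balls of
  radius 1/2 cover; each of these contains at most one of the points. So \<open>N\<close> depends on \<open>R\<close>
  and the space only.\<close>

lemma separated_card_bound:
  "\<exists>N. \<forall>(c :: nat \<Rightarrow> 'a::euclidean_space) I y r. 0 < r \<longrightarrow>
     (\<forall>i\<in>I. \<forall>j\<in>I. i \<noteq> j \<longrightarrow> r \<le> dist (c i) (c j)) \<longrightarrow>
     (\<forall>i\<in>I. dist y (c i) \<le> R * r) \<longrightarrow> finite I \<and> card I \<le> (N::nat)"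
proof -
  have "compact (cball (0::'a) R)" by simp
  moreover have "cball (0::'a) R \<subseteq> \<Union>((\<lambda>p. ball p (1/2)) ` UNIV)"
    using centre_in_ball[of _ "1/2"] by fastforce
  ultimately obtain D where D: "finite D" "cball (0::'a) R \<subseteq> \<Union>((\<lambda>p. ball p (1/2)) ` D)"
    using compactE_image[of "cball 0 R" UNIV "\<lambda>p. ball p (1/2)"] by (metis open_ball)
  have "finite I \<and> card I \<le> Suc (card D)"
    if r: "0 < r" and sep: "\<forall>i\<in>I. \<forall>j\<in>I. i \<noteq> j \<longrightarrow> r \<le> dist (c i) (c j)"
      and near: "\<forall>i\<in>I. dist y (c i) \<le> R * r" for c :: "nat \<Rightarrow> 'a" and I y r
  proof -
    let ?s = "\<lambda>i. (1 / r) *\<^sub>R (c i - y)"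
    have "\<exists>p\<in>D. ?s i \<in> ball p (1/2)" if "i \<in> I" for i
    proof -
      have "norm (c i - y) \<le> R * r"
        using near that by (simp add: dist_norm norm_minus_commute)
      moreover have "norm (?s i) = norm (c i - y) / r"
        using r by (simp only: norm_scaleR) simp
      ultimately have "?s i \<in> cball 0 R"
        using r unfolding mem_cball_0 by (simp add: pos_divide_le_eq)
      then show ?thesis using D(2) by blast
    qed
    then obtain p where p: "\<And>i. i \<in> I \<Longrightarrow> p i \<in> D \<and> ?s i \<in> ball (p i) (1/2)" by metis
    have inj: "inj_on p I"
    proof (rule inj_onI, rule ccontr)
      fix i j assume ij: "i \<in> I" "j \<in> I" "p i = p j" "i \<noteq> j"
      have "dist (?s i) (?s j) < 1"
        using p[OF ij(1)] p[OF ij(2)] ij(3) dist_triangle_half_r[of "p i" "?s i" 1 "?s j"] by simp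
      moreover have "dist (?s i) (?s j) = dist (c i) (c j) / r"
        using r by (simp add: dist_norm flip: scaleR_diff_right)
      ultimately show False using sep ij r by force
    qed
    have "p ` I \<subseteq> D" using p by blast
    then show ?thesis
      using inj D(1) by (meson card_inj_on_le finite_imageD finite_subset le_SucI)
  qed
  then show ?thesis by blast
qed


section \<open>Orthogonal projections onto nearby planes\<close>

text \<open>The linear part of the orthogonal projection onto an affine \<open>P\<close>.\<close>

definition dir_proj :: "'a::euclidean_space set \<Rightarrow> 'a \<Rightarrow> 'a" where
  "dir_proj P = orth_proj (directions P)"

lemma orth_proj_in_orthogonal:
  assumes "affine P" "P \<noteq> {}"
  shows orth_proj_in: "orth_proj P y \<in> P"
    and orth_proj_orthogonal: "q \<in> P \<Longrightarrow> (y - orth_proj P y) \<bullet> (q - orth_proj P y) = 0"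
proof -
  have cl: "closed P" and cv: "convex P"
    using assms affine_closed affine_imp_convex by blast+
  show p: "orth_proj P y \<in> P"
    by (simp add: orth_proj_eq_closest_point assms cl closest_point_in_set)
  show "(y - orth_proj P y) \<bullet> (q - orth_proj P y) = 0" if q: "q \<in> P"
  proof -
    have "2 *\<^sub>R orth_proj P y + (-1) *\<^sub>R q \<in> P"
      by (rule mem_affine[OF assms(1) p q]) simp
    then have r: "2 *\<^sub>R orth_proj P y - q \<in> P" by simp
    have "(y - orth_proj P y) \<bullet> (q - orth_proj P y) \<le> 0"
      "(y - orth_proj P y) \<bullet> ((2 *\<^sub>R orth_proj P y - q) - orth_proj P y) \<le> 0"
      using closest_point_dot[OF cv cl] q r assms by (auto simp: orth_proj_eq_closest_point)
    then show ?thesis by (simp add: algebra_simps scaleR_2)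
  qed
qed

lemma diff_in_directions: "a \<in> P \<Longrightarrow> b \<in> P \<Longrightarrow> a - b \<in> directions P"
  by (auto simp: directions_def)

lemma directions_eq_translation:
  assumes "affine P" "p \<in> P"
  shows "directions P = (\<lambda>x. x - p) ` P"
proof
  show "(\<lambda>x. x - p) ` P \<subseteq> directions P" using assms by (auto simp: directions_def)
  show "directions P \<subseteq> (\<lambda>x. x - p) ` P"
  proof
    fix v assume "v \<in> directions P"
    then obtain a b where ab: "a \<in> P" "b \<in> P" "v = a - b" by (auto simp: directions_def)
    have "1 *\<^sub>R a + (-1) *\<^sub>R b + 1 *\<^sub>R p \<in> P"
      using mem_affine_3[OF assms(1) ab(1,2) assms(2), of 1 "-1" 1] by simp
    then have "v + p \<in> P" using ab by simp
    then show "v \<in> (\<lambda>x. x - p) ` P" by (force intro: image_eqI[of _ _ "v + p"])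
  qed
qed

lemma plus_directions:
  assumes "affine P" "p \<in> P" "v \<in> directions P"
  shows "p + v \<in> P"
  using assms by (auto simp: directions_eq_translation)

lemma subspace_directions:
  assumes "affine P" "P \<noteq> {}"
  shows "subspace (directions P)"
proof -
  obtain p where p: "p \<in> P" using assms by blast
  have "directions P = (+) (- p) ` P"
    using directions_eq_translation[OF assms(1) p] by (auto simp: image_iff)
  then have "affine (directions P)" using assms(1) affine_translation by metis
  moreover have "0 \<in> directions P" using diff_in_directions[OF p p] by simp
  ultimately show ?thesis by (simp add: subspace_affine)
qed

context
  fixes P :: "'a::euclidean_space set"
  assumes P: "affine P" "P \<noteq> {}"
begin

lemma directions_affine_nonempty: "affine (directions P)" "directions P \<noteq> {}"
  using subspace_directions[OF P] subspace_imp_affine subspace_0 by auto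

lemma dir_proj_in: "dir_proj P v \<in> directions P"
  unfolding dir_proj_def by (rule orth_proj_in[OF directions_affine_nonempty])

lemma dir_proj_orthogonal:
  assumes "w \<in> directions P"
  shows "(v - dir_proj P v) \<bullet> w = 0"
proof -
  have "w + dir_proj P v \<in> directions P"
    using subspace_directions[OF P] assms dir_proj_in subspace_add by blast
  from orth_proj_orthogonal[OF directions_affine_nonempty this[unfolded dir_proj_def], of v]
  show ?thesis by (simp add: dir_proj_def)
qed

lemma dir_proj_unique:
  assumes "s \<in> directions P" "\<And>w. w \<in> directions P \<Longrightarrow> (v - s) \<bullet> w = 0"
  shows "dir_proj P v = s"
  unfolding dir_proj_def
proof (rule orth_proj_unique[OF assms(1)], intro ballI)
  fix q assume "q \<in> directions P"
  then have "q - s \<in> directions P"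
    using subspace_directions[OF P] assms subspace_diff by blast
  then show "orthogonal (v - s) (q - s)" using assms by (simp add: orthogonal_def)
qed

lemma dir_proj_fix: "w \<in> directions P \<Longrightarrow> dir_proj P w = w"
  by (rule dir_proj_unique) auto

lemma dir_proj_add: "dir_proj P (v + w) = dir_proj P v + dir_proj P w"
proof (rule dir_proj_unique)
  show "dir_proj P v + dir_proj P w \<in> directions P"
    using subspace_directions[OF P] dir_proj_in subspace_add by blast
  fix u assume u: "u \<in> directions P"
  show "(v + w - (dir_proj P v + dir_proj P w)) \<bullet> u = 0"
    using dir_proj_orthogonal[OF u, of v] dir_proj_orthogonal[OF u, of w]
    by (simp add: inner_diff_left inner_add_left)
qed

lemma dir_proj_scale: "dir_proj P (c *\<^sub>R v) = c *\<^sub>R dir_proj P v"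
proof (rule dir_proj_unique)
  show "c *\<^sub>R dir_proj P v \<in> directions P"
    using subspace_directions[OF P] dir_proj_in subspace_scale by blast
  fix u assume u: "u \<in> directions P"
  show "(c *\<^sub>R v - c *\<^sub>R dir_proj P v) \<bullet> u = 0"
    using dir_proj_orthogonal[OF u, of v] by (simp flip: scaleR_diff_right)
qed

lemma norm_dir_proj_Pythagoras: "(norm v)\<^sup>2 = (norm (dir_proj P v))\<^sup>2 + (norm (v - dir_proj P v))\<^sup>2"
proof -
  have "(v - dir_proj P v) \<bullet> dir_proj P v = 0"
    by (rule dir_proj_orthogonal[OF dir_proj_in])
  then show ?thesis
    using norm_add_Pythagorean[of "dir_proj P v" "v - dir_proj P v"]
    by (simp add: orthogonal_def inner_commute)
qed

lemma norm_dir_proj_le: "norm (dir_proj P v) \<le> norm v"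
  by (rule power2_le_imp_le) (use norm_dir_proj_Pythagoras[of v] in auto)

lemma norm_diff_dir_proj_le: "norm (v - dir_proj P v) \<le> norm v"
  by (rule power2_le_imp_le) (use norm_dir_proj_Pythagoras[of v] in auto)

lemma bounded_linear_dir_proj: "bounded_linear (dir_proj P)"
  by (rule bounded_linear_intro[of _ 1]) (auto simp: dir_proj_add dir_proj_scale norm_dir_proj_le)

lemma dir_proj_diff: "dir_proj P (v - w) = dir_proj P v - dir_proj P w"
  using bounded_linear_dir_proj by (simp add: bounded_linear.linear linear_diff)

lemma norm_diff_dir_proj_le_dist:
  assumes "w \<in> directions P"
  shows "norm (v - dir_proj P v) \<le> norm (v - w)"
  using norm_diff_dir_proj_le[of "v - w"] dir_proj_fix[OF assms] by (simp add: dir_proj_diff)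

lemma orth_proj_eq:
  assumes "p \<in> P"
  shows "orth_proj P y = p + dir_proj P (y - p)"
proof (rule orth_proj_unique)
  show "p + dir_proj P (y - p) \<in> P" by (rule plus_directions[OF P(1) assms dir_proj_in])
  then show "\<forall>q\<in>P. orthogonal (y - (p + dir_proj P (y - p))) (q - (p + dir_proj P (y - p)))"
    using dir_proj_orthogonal[of _ "y - p"] diff_in_directions
    by (auto simp: orthogonal_def diff_diff_eq)
qed

lemma orth_proj_diff: "orth_proj P y - orth_proj P x = dir_proj P (y - x)"
proof -
  obtain p where p: "p \<in> P" using P by blast
  have "dir_proj P (y - x) = dir_proj P (y - p) - dir_proj P (x - p)"
    by (simp flip: dir_proj_diff)
  then show ?thesis by (simp add: orth_proj_eq[OF p])
qed

lemma orth_proj_fix: "p \<in> P \<Longrightarrow> orth_proj P p = p"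
  using orth_proj_eq[of p p] dir_proj_fix[of 0] subspace_0[OF subspace_directions[OF P]] by simp

lemma norm_orth_proj_le:
  assumes "q \<in> P"
  shows "norm (orth_proj P y - y) \<le> norm (y - q)"
  using norm_diff_dir_proj_le[of "y - q"]
  by (simp add: orth_proj_eq[OF assms] norm_minus_commute algebra_simps)

lemma norm_orth_proj_le_infdist: "norm (orth_proj P y - y) \<le> infdist y P"
  using infdist_attains_inf[OF affine_closed[OF P(1)] P(2), of y] norm_orth_proj_le
  by (metis dist_norm)

lemma has_derivative_orth_proj: "(orth_proj P has_derivative dir_proj P) (at y within S)"
proof -
  obtain p where p: "p \<in> P" using P by blast
  have "((\<lambda>y. p + dir_proj P (y - p)) has_derivative dir_proj P) (at y within S)"
    by (auto intro!: derivative_eq_intros bounded_linear.has_derivative[OF bounded_linear_dir_proj])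
  moreover have "orth_proj P = (\<lambda>y. p + dir_proj P (y - p))"
    using orth_proj_eq[OF p] by blast
  ultimately show ?thesis by simp
qed

end

lemma infdist_le_excess:
  assumes "G \<noteq> {}" "y \<in> F \<inter> ball x r"
  shows "infdist y G \<le> excess x r F G"
proof -
  obtain g where g: "g \<in> G" using assms by blast
  have "bdd_above ((\<lambda>y. infdist y G) ` (F \<inter> ball x r))"
  proof (rule bdd_aboveI2)
    fix z assume "z \<in> F \<inter> ball x r"
    then have "dist z g \<le> r + dist x g"
      using dist_triangle[of z g x] by (simp add: dist_commute)
    then show "infdist z G \<le> r + dist x g" using infdist_le[OF g, of z] by linarith
  qed
  then show ?thesis
    unfolding excess_def using assms(2) by (intro cSup_upper) auto
qed

lemma hd_norm_commute: "hd_norm x r F G = hd_norm x r G F"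
  by (simp add: hd_norm_def max.commute)

lemma infdist_le_hd_norm:
  assumes "hd_norm x r F G \<le> \<delta>" "0 < r" "G \<noteq> {}" "y \<in> F" "dist x y < r"
  shows "infdist y G \<le> \<delta> * r"
proof -
  have "infdist y G \<le> excess x r F G" using assms by (intro infdist_le_excess) auto
  also have "\<dots> \<le> r * hd_norm x r F G" using assms(2) by (simp add: hd_norm_def)
  also have "\<dots> \<le> r * \<delta>" using assms by simp
  finally show ?thesis by (simp add: mult.commute)
qed

text \<open>Two points of \<open>P\<close> at distance comparable to \<open>r\<close> span a segment of \<open>P\<close> whose direction
  makes an angle of order \<open>\<delta>\<close> with \<open>Q\<close>.\<close>

lemma directions_close:
  assumes P: "affine P" and Q: "affine Q" "Q \<noteq> {}"
    and p: "p \<in> P" "dist x p \<le> r / 2" and r: "0 < r"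
    and hd: "hd_norm x r P Q \<le> \<delta>" and u: "u \<in> directions P"
  shows "norm (u - dir_proj Q u) \<le> 8 * \<delta> * norm u"
proof (cases "u = 0")
  case True
  then show ?thesis
    using dir_proj_fix[OF Q, of 0] subspace_0[OF subspace_directions[OF Q]] by simp
next
  case False
  \<comment> \<open>The factor keeps the second point \<open>p + ?s *\<^sub>R u\<close> inside \<open>ball x r\<close>.\<close>
  let ?s = "r / (4 * norm u)"
  have s: "?s > 0" using False r by simp
  have "?s *\<^sub>R u \<in> directions P"
    using u subspace_directions[OF P] p subspace_scale by blast
  then have q: "p + ?s *\<^sub>R u \<in> P" using plus_directions P p by blast
  have "norm (?s *\<^sub>R u) = r / 4" using False r by simp
  then have "dist x (p + ?s *\<^sub>R u) < r"
    using p r dist_triangle[of x "p + ?s *\<^sub>R u" p] by (simp add: dist_norm)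
  then have 1: "norm (orth_proj Q (p + ?s *\<^sub>R u) - (p + ?s *\<^sub>R u)) \<le> \<delta> * r"
    using infdist_le_hd_norm[OF hd r Q(2) q] norm_orth_proj_le_infdist[OF Q] order_trans by blast
  have "dist x p < r" using p r by simp
  then have 2: "norm (orth_proj Q p - p) \<le> \<delta> * r"
    using infdist_le_hd_norm[OF hd r Q(2) p(1)] norm_orth_proj_le_infdist[OF Q] order_trans by blast
  have "?s *\<^sub>R (u - dir_proj Q u) =
      (orth_proj Q p - p) - (orth_proj Q (p + ?s *\<^sub>R u) - (p + ?s *\<^sub>R u))"
    using orth_proj_diff[OF Q, of "p + ?s *\<^sub>R u" p] dir_proj_scale[OF Q, of ?s u]
    by (simp add: algebra_simps)
  then have "norm (?s *\<^sub>R (u - dir_proj Q u)) \<le> \<delta> * r + \<delta> * r"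
    using 1 2 norm_triangle_ineq4[of "orth_proj Q p - p" "orth_proj Q (p + ?s *\<^sub>R u) - (p + ?s *\<^sub>R u)"]
    by simp
  then have "?s * norm (u - dir_proj Q u) \<le> 2 * (\<delta> * r)"
    using r by simp
  then have "(r * norm (u - dir_proj Q u)) / (4 * norm u) \<le> 2 * (\<delta> * r)"
    using r by simp
  then have "r * norm (u - dir_proj Q u) \<le> r * (8 * \<delta> * norm u)"
    using False by (simp add: pos_divide_le_eq algebra_simps)
  then show ?thesis using r by simp
qed

text \<open>Orthogonal projections are self-adjoint, so an estimate for the part of \<open>directions P\<close> normal
  to \<open>Q\<close> is also one for the part of the normal space of \<open>Q\<close> along \<open>P\<close>. This replaces any
  comparison of dimensions.\<close>

lemma normal_part_close:
  fixes P :: "'a::euclidean_space set"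
  assumes P: "affine P" "P \<noteq> {}" and Q: "affine Q" "Q \<noteq> {}"
    and nonneg: "0 \<le> \<delta>"
    and close: "\<And>u. u \<in> directions P \<Longrightarrow> norm (u - dir_proj Q u) \<le> \<delta> * norm u"
  shows "norm (dir_proj P (v - dir_proj Q v)) \<le> \<delta> * norm v"
proof -
  let ?b = "v - dir_proj Q v" and ?a = "dir_proj P (v - dir_proj Q v)"
  have a: "?a \<in> directions P" by (rule dir_proj_in[OF P])
  have "?a \<bullet> ?a = ?b \<bullet> ?a"
    using dir_proj_orthogonal[OF P a, of ?b] by (simp add: inner_diff_left)
  also have "\<dots> = ?b \<bullet> (?a - dir_proj Q ?a)"
    using dir_proj_orthogonal[OF Q dir_proj_in[OF Q], of v ?a] by (simp add: inner_diff_right)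
  also have "\<dots> \<le> norm ?b * norm (?a - dir_proj Q ?a)" by (rule norm_cauchy_schwarz)
  also have "\<dots> \<le> norm v * (\<delta> * norm ?a)"
    by (intro mult_mono norm_diff_dir_proj_le[OF Q] close[OF a]) auto
  finally have "norm ?a * norm ?a \<le> (\<delta> * norm v) * norm ?a"
    by (simp add: dot_square_norm power2_eq_square algebra_simps)
  then show ?thesis
    using nonneg by (cases "?a = 0") (auto dest: mult_right_le_imp_le)
qed


text \<open>Projections have norm at most 1, so the bound for directions is trivial
  unless \<open>\<delta> \<le> 1/2\<close>, and then \<open>Q\<close> has a point near \<open>x\<close>, so that the roles of \<open>P\<close> and \<open>Q\<close> can
  be exchanged. The difference of the projections splits into
  \<open>dir_proj P (v - dir_proj Q v)\<close> and \<open>dir_proj Q v - dir_proj P (dir_proj Q v)\<close>.\<close>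

lemma planes_close:
  assumes P: "affine P" "x \<in> P" and Q: "affine Q" "Q \<noteq> {}" and r: "0 < r"
    and hd: "hd_norm x r P Q \<le> \<delta>"
  shows dir_proj_close: "norm (dir_proj P v - dir_proj Q v) \<le> 16 * \<delta> * norm v"
    and orth_proj_close: "norm (orth_proj P y - orth_proj Q y) \<le> \<delta> * (r + 16 * norm (y - x))"
proof -
  have P': "P \<noteq> {}" using P by blast
  have x: "norm (orth_proj Q x - x) \<le> \<delta> * r"
    using infdist_le_hd_norm[OF hd r Q(2) P(2)] norm_orth_proj_le_infdist[OF Q, of x] r by auto
  have \<delta>: "0 \<le> \<delta>" using order_trans[OF norm_ge_zero x] r by (simp add: zero_le_mult_iff)
  show dir: "norm (dir_proj P v - dir_proj Q v) \<le> 16 * \<delta> * norm v" for v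
  proof (cases "\<delta> \<le> 1/2")
    case False
    have "norm (dir_proj P v - dir_proj Q v) \<le> norm v + norm v"
      using norm_triangle_ineq4[of "dir_proj P v" "dir_proj Q v"]
        norm_dir_proj_le[OF P(1) P', of v] norm_dir_proj_le[OF Q, of v] by linarith
    also have "\<dots> \<le> 16 * \<delta> * norm v"
      using mult_right_mono[of 2 "16 * \<delta>" "norm v"] False by simp
    finally show ?thesis .
  next
    case True
    have PQ: "norm (u - dir_proj Q u) \<le> 8 * \<delta> * norm u" if "u \<in> directions P" for u
      by (rule directions_close[OF P(1) Q P(2) _ r hd that]) (use r in simp)
    have "norm (orth_proj Q x - x) \<le> r / 2"
      using x True r mult_right_mono[OF True, of r] by linarith
    then have QP: "norm (u - dir_proj P u) \<le> 8 * \<delta> * norm u" if "u \<in> directions Q" for u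
      using directions_close[OF Q(1) P(1) P' orth_proj_in[OF Q] _ r hd[unfolded hd_norm_commute[of x r P]] that, of x]
      by (simp add: dist_norm norm_minus_commute)
    have "norm (dir_proj P (v - dir_proj Q v)) \<le> 8 * \<delta> * norm v"
      by (rule normal_part_close[OF P(1) P' Q _ PQ]) (use \<delta> in auto)
    moreover have "norm (dir_proj Q v - dir_proj P (dir_proj Q v)) \<le> 8 * \<delta> * norm (dir_proj Q v)"
      by (rule QP[OF dir_proj_in[OF Q]])
    moreover have "8 * \<delta> * norm (dir_proj Q v) \<le> 8 * \<delta> * norm v"
      using \<delta> norm_dir_proj_le[OF Q] by (intro mult_left_mono) auto
    moreover have eq: "dir_proj P v - dir_proj Q v =
        dir_proj P (v - dir_proj Q v) - (dir_proj Q v - dir_proj P (dir_proj Q v))"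
      by (simp add: dir_proj_diff[OF P(1) P'])
    ultimately show ?thesis
      unfolding eq using norm_triangle_ineq4[of "dir_proj P (v - dir_proj Q v)"
          "dir_proj Q v - dir_proj P (dir_proj Q v)"] by linarith
  qed
  have eq: "orth_proj P y - orth_proj Q y =
      (dir_proj P (y - x) - dir_proj Q (y - x)) - (orth_proj Q x - x)"
    using orth_proj_diff[OF P(1) P', of y x] orth_proj_diff[OF Q, of y x]
      orth_proj_fix[OF P(1) P' P(2)] by (simp add: algebra_simps)
  have "\<delta> * (r + 16 * norm (y - x)) = 16 * \<delta> * norm (y - x) + \<delta> * r"
    by (simp add: algebra_simps)
  then show "norm (orth_proj P y - orth_proj Q y) \<le> \<delta> * (r + 16 * norm (y - x))"
    unfolding eq using dir[of "y - x"] x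
      norm_triangle_ineq4[of "dir_proj P (y - x) - dir_proj Q (y - x)" "orth_proj Q x - x"]
    by linarith
qed

section \<open>Derivatives of smooth functions\<close>

lemma has_derivative_nabla:
  assumes "smooth g"
  shows "(nabla vs g has_derivative (\<lambda>u. nabla (u # vs) g y)) (at y)"
  using assms by (simp add: smooth_def frechet_derivative_works[symmetric])

lemma has_derivative_smooth:
  assumes "smooth g"
  shows "(g has_derivative (\<lambda>u. nabla [u] g y)) (at y)"
  using has_derivative_nabla[OF assms, of "[]"] by simp

lemma nabla_scale:
  assumes "smooth g"
  shows "nabla (c *\<^sub>R u # vs) g y = c *\<^sub>R nabla (u # vs) g y"
  by (rule linear_scale[OF has_derivative_linear[OF has_derivative_nabla[OF assms]]])

text \<open>Second derivatives are also homogeneous in the inner argument; the bound for unit vectors in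
  \<open>nabla_bound\<close> thus extends to all vectors.\<close>

lemma nabla_scale2:
  assumes "smooth g"
  shows "nabla [u, c *\<^sub>R v] g y = c *\<^sub>R nabla [u, v] g y"
proof -
  have "((\<lambda>y. c *\<^sub>R nabla [v] g y) has_derivative (\<lambda>u. c *\<^sub>R nabla [u, v] g y)) (at y)"
    using has_derivative_scaleR_right[OF has_derivative_nabla[OF assms]] .
  moreover have "(\<lambda>y. c *\<^sub>R nabla [v] g y) = nabla [c *\<^sub>R v] g"
    by (rule ext) (simp only: nabla_scale[OF assms])
  ultimately have "(nabla [c *\<^sub>R v] g has_derivative (\<lambda>u. c *\<^sub>R nabla [u, v] g y)) (at y)"
    by simp
  from has_derivative_unique[OF this has_derivative_nabla[OF assms]] show ?thesis by metis
qed

lemma nabla_bound_0: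
  assumes "nabla_bound 0 g K"
  shows "norm (g y) \<le> K"
  using assms by (simp add: nabla_bound_def)

lemma norm_nabla_1:
  assumes "smooth g" "nabla_bound 1 g K"
  shows "norm (nabla [v] g y) \<le> K * norm v"
proof (cases "v = 0")
  case True
  then show ?thesis using nabla_scale[OF assms(1), of 0 0 "[]" y] by simp
next
  case False
  have "norm (nabla [(1 / norm v) *\<^sub>R v] g y) \<le> K"
    using assms(2)[unfolded nabla_bound_def, rule_format, of "[(1 / norm v) *\<^sub>R v]"] False by simp
  then have "norm (nabla [v] g y) / norm v \<le> K"
    unfolding nabla_scale[OF assms(1)] by simp
  then show ?thesis using False by (simp add: pos_divide_le_eq)
qed

lemma norm_nabla_2:
  assumes "smooth g" "nabla_bound 2 g K"
  shows "norm (nabla [u, v] g y) \<le> K * norm u * norm v"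
proof (cases "u = 0 \<or> v = 0")
  case True
  then show ?thesis
    using nabla_scale[OF assms(1), of 0 0 "[v]" y] nabla_scale2[OF assms(1), of u 0 0 y] by auto
next
  case False
  have "norm (nabla [(1 / norm u) *\<^sub>R u, (1 / norm v) *\<^sub>R v] g y) \<le> K"
    using assms(2)[unfolded nabla_bound_def, rule_format,
        of "[(1 / norm u) *\<^sub>R u, (1 / norm v) *\<^sub>R v]"] False by simp
  then have "norm (nabla [u, v] g y) / norm v / norm u \<le> K"
    unfolding nabla_scale[OF assms(1)] nabla_scale2[OF assms(1)] by simp
  then show ?thesis using False by (simp add: pos_divide_le_eq ac_simps)
qed

lemma norm_diff_le_nabla_1:
  assumes "smooth g" "nabla_bound 1 g K" "0 \<le> K"
  shows "norm (g y - g y') \<le> K * norm (y - y')"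
proof (rule differentiable_bound[OF convex_UNIV, where f' = "\<lambda>y v. nabla [v] g y"])
  show "(g has_derivative (\<lambda>v. nabla [v] g p)) (at p)" for p
    by (rule has_derivative_smooth[OF assms(1)])
  show "onorm (\<lambda>v. nabla [v] g p) \<le> K" for p
    by (rule onorm_bound[OF assms(3)]) (rule norm_nabla_1[OF assms(1,2)])
qed auto

lemma nabla_eq_0:
  assumes "smooth g" "open U" "y \<in> U" "\<And>p. p \<in> U \<Longrightarrow> nabla vs g p = 0"
  shows "nabla (u # vs) g y = 0"
proof -
  have "((\<lambda>_. 0) has_derivative (\<lambda>u. nabla (u # vs) g y)) (at y)"
    using has_derivative_transform_within_open[OF has_derivative_nabla[OF assms(1)] assms(2,3)]
      assms(4) by metis
  from has_derivative_unique[OF this has_derivative_const] show ?thesis by metis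
qed

lemma nabla_eq_0_outside_support:
  assumes "smooth g" "y \<notin> closure {p. g p \<noteq> 0}"
  shows "nabla vs g y = 0"
proof -
  let ?U = "- closure {p. g p \<noteq> 0}"
  have "\<forall>p\<in>?U. nabla vs g p = 0"
  proof (induction vs)
    case Nil
    then show ?case using closure_subset[of "{p. g p \<noteq> 0}"] by auto
  next
    case (Cons u vs)
    then show ?case using nabla_eq_0[OF assms(1), of ?U _ vs u] by blast
  qed
  then show ?thesis using assms(2) by blast
qed

lemma rad_pos: "0 < rad k" and rad_Suc: "rad (Suc k) = rad k / 10" and rad_le_1: "rad k \<le> 1"
  by (auto simp: rad_def power_le_one)

section \<open>The maps attached to a coherent collection\<close>

text \<open>\<open>A\<close> bounds the number of balls \<open>10B\<^sub>j\<^sub>,\<^sub>k\<close> that share a point and the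
  constants \<open>C 0\<close>, \<open>C 1\<close>, \<open>C 2\<close>. The power of \<open>A\<close> in the smallness of \<open>\<epsilon>\<close> is what the
  lower bound for the distances of orbits requires.\<close>

locale david_toro =
  fixes A \<epsilon> :: real and d :: nat and C :: "nat \<Rightarrow> real"
    and E :: "'a::euclidean_space set" and J :: "nat \<Rightarrow> nat set" and x :: "nat \<Rightarrow> nat \<Rightarrow> 'a"
    and P :: "nat \<Rightarrow> nat \<Rightarrow> 'a set" and \<Sigma>0 :: "'a set"
    and \<theta> :: "nat \<Rightarrow> nat \<Rightarrow> 'a \<Rightarrow> real" and \<psi> :: "nat \<Rightarrow> 'a \<Rightarrow> real"
  assumes A: "1 \<le> A" and C_le: "C 0 \<le> A" "C 1 \<le> A" "C 2 \<le> A"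
    and eps_pos: "0 < \<epsilon>" and eps_small: "10 ^ 5 * A ^ 4 * \<epsilon> \<le> 1"
    and finite_J: "finite (J k)"
    and overlap: "real (card {j \<in> J k. y \<in> ball (x k j) (10 * rad k)}) \<le> A"
    and coherent: "coherent_collection \<epsilon> d E J x P \<Sigma>0"
    and partition: "DT_partition C J x \<theta> \<psi>"
begin

lemma S0: "affine \<Sigma>0" "\<Sigma>0 \<noteq> {}"
  using coherent by (auto simp: coherent_collection_def d_plane_def)

lemma plane:
  assumes "j \<in> J k"
  shows "affine (P k j)" "P k j \<noteq> {}" "x k j \<in> P k j"
proof -
  show *: "affine (P k j)" "x k j \<in> P k j"
    using coherent assms by (auto simp: coherent_collection_def d_plane_def)
  show "P k j \<noteq> {}" using *(2) by blast
qed

text \<open>A point of generation \<open>k + 1\<close> at distance at least \<open>rad k\<close> from the net of generation \<open>k\<close> could be added to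
  that net, against its maximality.\<close>

lemma parent:
  assumes "j \<in> J (Suc k)"
  obtains i where "i \<in> J k" "dist (x (Suc k) j) (x k i) < rad k"
proof -
  have max: "maximal_separated_family E (rad k) (J k) (x k)"
    and "maximal_separated_family E (rad (Suc k)) (J (Suc k)) (x (Suc k))"
    using coherent by (auto simp: coherent_collection_def)
  then have E: "x (Suc k) j \<in> E" using assms by (auto simp: maximal_separated_family_def)
  have "\<exists>i\<in>J k. dist (x (Suc k) j) (x k i) < rad k"
  proof (rule ccontr)
    assume "\<not> ?thesis"
    then have far: "\<forall>i\<in>J k. rad k \<le> dist (x (Suc k) j) (x k i)" by force
    let ?B = "insert (x (Suc k) j) (x k ` J k)"
    have sep: "\<forall>i\<in>J k. \<forall>j\<in>J k. i \<noteq> j \<longrightarrow> rad k \<le> dist (x k i) (x k j)"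
      and sub: "x k ` J k \<subseteq> E"
      and mx: "\<And>B. x k ` J k \<subseteq> B \<Longrightarrow> B \<subseteq> E \<Longrightarrow> separated (rad k) B \<Longrightarrow> B = x k ` J k"
      using max by (auto simp: maximal_separated_family_def)
    have "separated (rad k) ?B"
      unfolding separated_def
    proof (intro ballI impI)
      fix a b assume ab: "a \<in> ?B" "b \<in> ?B" "a \<noteq> b"
      consider "a = x (Suc k) j" "b \<in> x k ` J k" | "b = x (Suc k) j" "a \<in> x k ` J k"
        | "a \<in> x k ` J k" "b \<in> x k ` J k"
        using ab by blast
      then show "rad k \<le> dist a b"
        by cases (use far sep ab in \<open>auto simp: dist_commute\<close>)
    qed
    then have "?B = x k ` J k" using mx[of ?B] sub E by blast
    then obtain i where "i \<in> J k" "x (Suc k) j = x k i" by blast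
    then show False using far rad_pos[of k] by force
  qed
  then show ?thesis using that by blast
qed

definition B10 :: "nat \<Rightarrow> nat \<Rightarrow> 'a set" where
  "B10 k j = ball (x k j) (10 * rad k)"

abbreviation "D1 k j y v \<equiv> nabla [v] (\<theta> k j) y"
abbreviation "D2 k j y u v \<equiv> nabla [u, v] (\<theta> k j) y"

lemma smooth_theta: "j \<in> J k \<Longrightarrow> smooth (\<theta> k j)"
  using partition by (simp add: DT_partition_def)

lemma nabla_theta_outside:
  assumes "j \<in> J k" "y \<notin> B10 k j"
  shows "nabla vs (\<theta> k j) y = 0"
proof (rule nabla_eq_0_outside_support)
  show "smooth (\<theta> k j)" by (rule smooth_theta[OF assms(1)])
  have "closure {p. \<theta> k j p \<noteq> 0} \<subseteq> B10 k j"
    using partition assms(1) unfolding DT_partition_def B10_def by blast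
  then show "y \<notin> closure {p. \<theta> k j p \<noteq> 0}" using assms(2) by blast
qed

lemma theta_outside: "j \<in> J k \<Longrightarrow> y \<notin> B10 k j \<Longrightarrow> \<theta> k j y = 0"
  using nabla_theta_outside[of j k y "[]"] by simp

lemma theta_nonneg: "j \<in> J k \<Longrightarrow> 0 \<le> \<theta> k j y"
  using partition by (simp add: DT_partition_def)

lemma nabla_bound_theta: "j \<in> J k \<Longrightarrow> nabla_bound m (\<theta> k j) (C m / rad k ^ m)"
  using partition by (simp add: DT_partition_def)

lemma theta_le: "j \<in> J k \<Longrightarrow> \<theta> k j y \<le> A"
  using nabla_bound_0[of "\<theta> k j" "C 0" y] nabla_bound_theta[of j k 0] C_le by simp

lemma D1_le:
  assumes "j \<in> J k"
  shows "\<bar>D1 k j y v\<bar> \<le> A / rad k * norm v"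
proof -
  have "\<bar>D1 k j y v\<bar> \<le> C 1 / rad k * norm v"
    using norm_nabla_1[OF smooth_theta[OF assms], of "C 1 / rad k"] nabla_bound_theta[OF assms, of 1]
    by simp
  also have "\<dots> \<le> A / rad k * norm v"
    using C_le rad_pos[of k] by (intro mult_right_mono divide_right_mono) auto
  finally show ?thesis .
qed

lemma D2_le:
  assumes "j \<in> J k"
  shows "\<bar>D2 k j y u v\<bar> \<le> A / (rad k)\<^sup>2 * norm u * norm v"
proof -
  have "\<bar>D2 k j y u v\<bar> \<le> C 2 / (rad k)\<^sup>2 * norm u * norm v"
    using norm_nabla_2[OF smooth_theta[OF assms], of "C 2 / (rad k)\<^sup>2"] nabla_bound_theta[OF assms, of 2]
    by simp
  also have "\<dots> \<le> A / (rad k)\<^sup>2 * norm u * norm v"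
    using C_le rad_pos[of k] by (intro mult_right_mono divide_right_mono) auto
  finally show ?thesis .
qed

lemma theta_Lipschitz:
  assumes "j \<in> J k"
  shows "\<bar>\<theta> k j y - \<theta> k j y'\<bar> \<le> A / rad k * norm (y - y')"
proof -
  have "C 1 / rad k \<le> A / rad k"
    using C_le rad_pos[of k] by (intro divide_right_mono) auto
  then have "nabla_bound 1 (\<theta> k j) (A / rad k)"
    using nabla_bound_theta[OF assms, of 1] unfolding nabla_bound_def
    by (metis order_trans power_one_right)
  then show ?thesis
    using norm_diff_le_nabla_1[OF smooth_theta[OF assms], of "A / rad k"] A rad_pos[of k] by simp
qed

lemma sum_theta: "(\<Sum>j\<in>J k. \<theta> k j y) = 1 - \<psi> k y"
  using partition by (simp add: DT_partition_def algebra_simps)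

lemma abs_psi_le: "\<bar>\<psi> k y\<bar> \<le> A"
proof -
  have "nabla_bound 0 (\<psi> k) (C 0)"
    using partition by (simp add: DT_partition_def) (metis div_by_1 power_0)
  then show ?thesis using nabla_bound_0[of "\<psi> k" "C 0" y] C_le by simp
qed

lemma sum_theta_le: "(\<Sum>j\<in>J k. \<theta> k j y) \<le> 2 * A"
  using abs_psi_le[of k y] A by (simp add: sum_theta)

lemma psi_eq_0: "y \<in> V J x 8 k \<Longrightarrow> \<psi> k y = 0"
  using partition by (simp add: DT_partition_def)

lemma sum_theta_eq_1: "y \<in> V J x 8 k \<Longrightarrow> (\<Sum>j\<in>J k. \<theta> k j y) = 1"
  by (simp add: sum_theta psi_eq_0)

lemma open_V: "open (V J x t k)"
  by (auto simp: V_def)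

lemma sum_D1_eq_0:
  assumes "y \<in> V J x 8 k"
  shows "(\<Sum>j\<in>J k. D1 k j y v) = 0"
proof -
  have "((\<lambda>y. \<Sum>j\<in>J k. \<theta> k j y) has_derivative (\<lambda>v. \<Sum>j\<in>J k. D1 k j y v)) (at y)"
    by (intro has_derivative_sum has_derivative_smooth smooth_theta)
  then have "((\<lambda>_. 1) has_derivative (\<lambda>v. \<Sum>j\<in>J k. D1 k j y v)) (at y)"
    by (rule has_derivative_transform_within_open[OF _ open_V assms]) (rule sum_theta_eq_1)
  from has_derivative_unique[OF this has_derivative_const] show ?thesis by metis
qed

text \<open>At each point at most \<open>A\<close> terms of a sum over \<open>J k\<close> are present. The version for two points
  serves differences, the weighted one exploits \<open>\<theta> \<ge> 0\<close>: its constant is \<open>1\<close> on \<open>V J x 8 k\<close>.\<close>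

lemma norm_sum_le:
  fixes h :: "nat \<Rightarrow> 'b::real_normed_vector"
  assumes "\<And>j. j \<in> J k \<Longrightarrow> y \<in> B10 k j \<Longrightarrow> norm (h j) \<le> B"
    and "\<And>j. j \<in> J k \<Longrightarrow> y \<notin> B10 k j \<Longrightarrow> h j = 0" and "0 \<le> B"
  shows "norm (\<Sum>j\<in>J k. h j) \<le> A * B"
proof -
  let ?I = "{j \<in> J k. y \<in> ball (x k j) (10 * rad k)}"
  have "(\<Sum>j\<in>J k. h j) = (\<Sum>j\<in>?I. h j)"
    using assms(2) by (intro sum.mono_neutral_right finite_J) (auto simp: B10_def)
  also have "norm \<dots> \<le> real (card ?I) * B"
    using sum_norm_bound[of ?I h B] assms(1) by (auto simp: B10_def)
  also have "\<dots> \<le> A * B" using overlap assms(3) by (intro mult_right_mono) auto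
  finally show ?thesis .
qed

lemma norm_sum_le_2:
  fixes h :: "nat \<Rightarrow> 'b::real_normed_vector"
  assumes B: "\<And>j. j \<in> J k \<Longrightarrow> y \<in> B10 k j \<or> y' \<in> B10 k j \<Longrightarrow> norm (h j) \<le> B"
    and 0: "\<And>j. j \<in> J k \<Longrightarrow> y \<notin> B10 k j \<Longrightarrow> y' \<notin> B10 k j \<Longrightarrow> h j = 0" and "0 \<le> B"
  shows "norm (\<Sum>j\<in>J k. h j) \<le> 2 * A * B"
proof -
  let ?h1 = "\<lambda>j. if y \<in> B10 k j then h j else 0"
    and ?h2 = "\<lambda>j. if y \<in> B10 k j then 0 else h j"
  have "norm (\<Sum>j\<in>J k. ?h1 j) \<le> A * B"
    by (rule norm_sum_le[of k y]) (use assms in auto)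
  moreover have "norm (\<Sum>j\<in>J k. ?h2 j) \<le> A * B"
    by (rule norm_sum_le[of k y']) (use assms in auto)
  moreover have "(\<Sum>j\<in>J k. h j) = (\<Sum>j\<in>J k. ?h1 j) + (\<Sum>j\<in>J k. ?h2 j)"
    unfolding sum.distrib[symmetric] by (rule sum.cong) auto
  ultimately show ?thesis
    using norm_triangle_ineq[of "\<Sum>j\<in>J k. ?h1 j" "\<Sum>j\<in>J k. ?h2 j"] by simp
qed

lemma norm_theta_sum_le:
  fixes h :: "nat \<Rightarrow> 'b::real_normed_vector"
  assumes "\<And>j. j \<in> J k \<Longrightarrow> y \<in> B10 k j \<Longrightarrow> norm (h j) \<le> B"
  shows "norm (\<Sum>j\<in>J k. \<theta> k j y *\<^sub>R h j) \<le> (\<Sum>j\<in>J k. \<theta> k j y) * B"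
  unfolding sum_distrib_right
proof (rule sum_norm_le)
  fix j assume j: "j \<in> J k"
  show "norm (\<theta> k j y *\<^sub>R h j) \<le> \<theta> k j y * B"
    using assms[OF j] theta_nonneg[OF j, of y] theta_outside[OF j, of y]
    by (cases "y \<in> B10 k j") (auto intro: mult_left_mono)
qed

lemma norm_theta_sum_le_2A:
  fixes h :: "nat \<Rightarrow> 'b::real_normed_vector"
  assumes "\<And>j. j \<in> J k \<Longrightarrow> y \<in> B10 k j \<Longrightarrow> norm (h j) \<le> B" "0 \<le> B"
  shows "norm (\<Sum>j\<in>J k. \<theta> k j y *\<^sub>R h j) \<le> 2 * A * B"
proof -
  have "norm (\<Sum>j\<in>J k. \<theta> k j y *\<^sub>R h j) \<le> (\<Sum>j\<in>J k. \<theta> k j y) * B"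
    by (rule norm_theta_sum_le[OF assms(1)])
  also have "\<dots> \<le> 2 * A * B" by (rule mult_right_mono[OF sum_theta_le assms(2)])
  finally show ?thesis .
qed

abbreviation "\<pi> k j \<equiv> orth_proj (P k j)"
abbreviation "\<pi>' k j \<equiv> dir_proj (P k j)"
abbreviation "\<sigma> k \<equiv> sigma_map J P \<theta> \<psi> k"

text \<open>In this form only those projections occur that act near \<open>y\<close>, and each enters through a
  displacement \<open>\<pi> k j y - y\<close>, which is small if \<open>y\<close> is close to the plane \<open>P k j\<close>.\<close>

lemma sigma_eq: "\<sigma> k y = y + (\<Sum>j\<in>J k. \<theta> k j y *\<^sub>R (\<pi> k j y - y))"
proof -
  have "(\<Sum>j\<in>J k. \<theta> k j y *\<^sub>R y) = (1 - \<psi> k y) *\<^sub>R y"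
    by (simp only: scaleR_sum_left[symmetric] sum_theta)
  then have "\<psi> k y *\<^sub>R y = y - (\<Sum>j\<in>J k. \<theta> k j y *\<^sub>R y)"
    by (simp add: scaleR_diff_left)
  then show ?thesis
    by (simp add: sigma_map_def scaleR_diff_right sum_subtractf)
qed

definition Dsigma :: "nat \<Rightarrow> 'a \<Rightarrow> 'a \<Rightarrow> 'a" where
  "Dsigma k y v = v + (\<Sum>j\<in>J k. D1 k j y v *\<^sub>R (\<pi> k j y - y) + \<theta> k j y *\<^sub>R (\<pi>' k j v - v))"

definition D2sigma :: "nat \<Rightarrow> 'a \<Rightarrow> 'a \<Rightarrow> 'a \<Rightarrow> 'a" where
  "D2sigma k y u v = (\<Sum>j\<in>J k. D2 k j y u v *\<^sub>R (\<pi> k j y - y)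
      + D1 k j y v *\<^sub>R (\<pi>' k j u - u) + D1 k j y u *\<^sub>R (\<pi>' k j v - v))"

lemma has_derivative_sigma: "(\<sigma> k has_derivative Dsigma k y) (at y)"
proof -
  have "((\<lambda>y. \<theta> k j y *\<^sub>R (\<pi> k j y - y)) has_derivative
      (\<lambda>v. D1 k j y v *\<^sub>R (\<pi> k j y - y) + \<theta> k j y *\<^sub>R (\<pi>' k j v - v))) (at y)" if "j \<in> J k" for j
    using has_derivative_scaleR[OF has_derivative_smooth[OF smooth_theta[OF that]]
        has_derivative_diff[OF has_derivative_orth_proj[OF plane(1,2)[OF that]] has_derivative_ident]]
    by (simp add: add.commute)
  then have "((\<lambda>y. y + (\<Sum>j\<in>J k. \<theta> k j y *\<^sub>R (\<pi> k j y - y))) has_derivative Dsigma k y) (at y)"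
    unfolding Dsigma_def[abs_def] by (intro has_derivative_add has_derivative_ident) (rule has_derivative_sum)
  then show ?thesis by (simp add: sigma_eq[abs_def])
qed

lemma has_derivative_Dsigma: "((\<lambda>y. Dsigma k y v) has_derivative (\<lambda>u. D2sigma k y u v)) (at y)"
proof -
  have "((\<lambda>y. D1 k j y v *\<^sub>R (\<pi> k j y - y) + \<theta> k j y *\<^sub>R (\<pi>' k j v - v)) has_derivative
      (\<lambda>u. D2 k j y u v *\<^sub>R (\<pi> k j y - y) + D1 k j y v *\<^sub>R (\<pi>' k j u - u)
         + D1 k j y u *\<^sub>R (\<pi>' k j v - v))) (at y)" if "j \<in> J k" for j
  proof -
    have "((\<lambda>y. D1 k j y v *\<^sub>R (\<pi> k j y - y)) has_derivative
      (\<lambda>u. D2 k j y u v *\<^sub>R (\<pi> k j y - y) + D1 k j y v *\<^sub>R (\<pi>' k j u - u))) (at y)"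
      using has_derivative_scaleR[OF has_derivative_nabla[OF smooth_theta[OF that], of "[v]"]
        has_derivative_diff[OF has_derivative_orth_proj[OF plane(1,2)[OF that]] has_derivative_ident]]
      by (simp add: add.commute)
    then show ?thesis
      by (intro has_derivative_add has_derivative_scaleR_left has_derivative_smooth smooth_theta that)
  qed
  then have "((\<lambda>y. v + (\<Sum>j\<in>J k. D1 k j y v *\<^sub>R (\<pi> k j y - y) + \<theta> k j y *\<^sub>R (\<pi>' k j v - v)))
      has_derivative (\<lambda>u. 0 + D2sigma k y u v)) (at y)"
    unfolding D2sigma_def by (intro has_derivative_add has_derivative_const) (rule has_derivative_sum)
  then show ?thesis by (simp add: Dsigma_def)
qed

abbreviation "f k \<equiv> DT_iter J P \<theta> \<psi> k"

text \<open>\<open>Df k z v\<close> and \<open>D2f k z u v\<close> are the first and second derivatives of \<open>f k\<close> at \<open>z\<close>, as the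
  chain rule computes them along the orbit of \<open>z\<close>. The bounds use this recursive form.\<close>

primrec Df :: "nat \<Rightarrow> 'a \<Rightarrow> 'a \<Rightarrow> 'a" where
  "Df 0 z v = v"
| "Df (Suc k) z v = Dsigma k (f k z) (Df k z v)"

primrec D2f :: "nat \<Rightarrow> 'a \<Rightarrow> 'a \<Rightarrow> 'a \<Rightarrow> 'a" where
  "D2f 0 z u v = 0"
| "D2f (Suc k) z u v = D2sigma k (f k z) (Df k z u) (Df k z v) + Dsigma k (f k z) (D2f k z u v)"

lemma has_derivative_f: "(f k has_derivative Df k z) (at z)"
proof (induction k)
  case 0
  have "Df 0 z = (\<lambda>v. v)" by auto
  then show ?case by simp
next
  case (Suc k)
  have "((\<lambda>z. \<sigma> k (f k z)) has_derivative (\<lambda>v. Dsigma k (f k z) (Df k z v))) (at z)"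
    by (rule has_derivative_compose[OF Suc has_derivative_sigma])
  moreover have "Df (Suc k) z = (\<lambda>v. Dsigma k (f k z) (Df k z v))" by auto
  ultimately show ?case by (simp add: o_def)
qed

lemma Dsigma_add: "Dsigma k y (u + v) = Dsigma k y u + Dsigma k y v"
  using has_derivative_linear[OF has_derivative_sigma] by (rule linear_add)

text \<open>\<open>(y, w) \<mapsto> Dsigma k y w\<close> is differentiable jointly because it is linear in \<open>w\<close>: expand
  \<open>w\<close> in an orthonormal basis.\<close>

lemma has_derivative_Dsigma_joint:
  assumes "(g has_derivative g') (at z)" "(h has_derivative h') (at z)"
  shows "((\<lambda>z. Dsigma k (g z) (h z)) has_derivative
    (\<lambda>u. D2sigma k (g z) (g' u) (h z) + Dsigma k (g z) (h' u))) (at z)"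
proof -
  have lin: "linear (Dsigma k y)" for y by (rule has_derivative_linear[OF has_derivative_sigma])
  have expand: "Dsigma k y w = (\<Sum>b\<in>Basis. (w \<bullet> b) *\<^sub>R Dsigma k y b)" for y w
    by (subst euclidean_representation[of w, symmetric])
      (simp add: linear_sum[OF lin] linear_scale[OF lin])
  have add: "D2sigma k y u (v + w) = D2sigma k y u v + D2sigma k y u w" for y u v w
  proof -
    have "((\<lambda>y. Dsigma k y (v + w)) has_derivative (\<lambda>u. D2sigma k y u v + D2sigma k y u w)) (at y)"
      unfolding Dsigma_add by (intro has_derivative_add has_derivative_Dsigma)
    from has_derivative_unique[OF has_derivative_Dsigma this] show ?thesis by metis
  qed
  have scale: "D2sigma k y u (c *\<^sub>R v) = c *\<^sub>R D2sigma k y u v" for y u v c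
  proof -
    have "((\<lambda>y. Dsigma k y (c *\<^sub>R v)) has_derivative (\<lambda>u. c *\<^sub>R D2sigma k y u v)) (at y)"
      unfolding linear_scale[OF lin] by (intro has_derivative_scaleR_right has_derivative_Dsigma)
    from has_derivative_unique[OF has_derivative_Dsigma this] show ?thesis by metis
  qed
  have lin2: "linear (D2sigma k y u)" for y u by (rule linearI) (simp_all add: add scale)
  have expand2: "D2sigma k y u w = (\<Sum>b\<in>Basis. (w \<bullet> b) *\<^sub>R D2sigma k y u b)" for y u w
    by (subst euclidean_representation[of w, symmetric])
      (simp add: linear_sum[OF lin2] linear_scale[OF lin2])
  have "((\<lambda>z. \<Sum>b\<in>Basis. (h z \<bullet> b) *\<^sub>R Dsigma k (g z) b) has_derivative
     (\<lambda>u. \<Sum>b\<in>Basis. (h z \<bullet> b) *\<^sub>R D2sigma k (g z) (g' u) b + (h' u \<bullet> b) *\<^sub>R Dsigma k (g z) b)) (at z)"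
    by (intro has_derivative_sum has_derivative_scaleR has_derivative_inner_left assms
        has_derivative_compose[OF assms(1) has_derivative_Dsigma])
  then show ?thesis
    by (simp add: sum.distrib flip: expand expand2)
qed

lemma has_derivative_Df: "((\<lambda>z. Df k z v) has_derivative (\<lambda>u. D2f k z u v)) (at z)"
proof (induction k)
  case (Suc k)
  show ?case
    using has_derivative_Dsigma_joint[OF has_derivative_f[of k z] Suc] by simp
qed simp

end

lemma hd_norm_nonneg:
  assumes "x \<in> F" "G \<noteq> {}" "0 < r"
  shows "0 \<le> hd_norm x r F G"
proof -
  have "0 \<le> hd_norm x r F G * r"
    using infdist_le_hd_norm[OF order_refl assms(3,2,1), of x] assms(3) infdist_nonneg[of x G]
    by (simp del: infdist_nonneg)
  then show ?thesis using assms(3) by (simp add: zero_le_mult_iff)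
qed

context david_toro
begin

section \<open>Orbits stay close to the planes\<close>

lemma power_A_eps: "m \<le> 4 \<Longrightarrow> A ^ m * \<epsilon> \<le> 1 / 10 ^ 5"
proof -
  assume "m \<le> 4"
  then have "A ^ m * \<epsilon> \<le> A ^ 4 * \<epsilon>"
    using A eps_pos by (intro mult_right_mono power_increasing) auto
  then show ?thesis using eps_small by simp
qed

lemma eps_le: "\<epsilon> \<le> 1 / 10 ^ 5"
  using power_A_eps[of 0] by simp

lemma hd_same:
  assumes "i \<in> J k" "m \<in> J k" "dist (x k i) (x k m) \<le> 100 * rad k"
  shows "hd_norm (x k i) (100 * rad k) (P k i) (P k m) \<le> \<epsilon>"
  using coherent assms unfolding coherent_collection_def
  by (metis hd_norm_commute dist_commute)

lemma hd_parent:
  assumes "i \<in> J k" "j \<in> J (Suc k)" "dist (x (Suc k) j) (x k i) < rad k"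
  shows "hd_norm (x k i) (20 * rad k) (P k i) (P (Suc k) j) \<le> \<epsilon>"
proof -
  have "dist (x k i) (x (Suc k) j) \<le> 2 * rad k"
    using assms(3) rad_pos[of k] by (simp add: dist_commute)
  then show ?thesis using coherent assms(1,2) unfolding coherent_collection_def by blast
qed

lemma hd_norm_le_eps_num:
  assumes "j \<in> J k" "l \<in> {k - 1, k}" "i \<in> J l" "y \<in> B10 k j" "y \<in> ball (x l i) (11 * rad l)"
  shows "hd_norm (x l i) (100 * rad l) (P l i) (P k j) \<le> eps_num J x P k y"
proof -
  let ?S = "{hd_norm (x l i) (100 * rad l) (P k j) (P l i) | j l i.
            j \<in> J k \<and> l \<in> {k - 1, k} \<and> i \<in> J l \<and>
            y \<in> ball (x k j) (10 * rad k) \<inter> ball (x l i) (11 * rad l)}"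
  have "?S \<subseteq> (\<lambda>(j, l, i). hd_norm (x l i) (100 * rad l) (P k j) (P l i)) `
      (J k \<times> {k - 1, k} \<times> (J (k - 1) \<union> J k))"
    by (auto simp: image_iff) blast+
  moreover have "finite \<dots>" using finite_J by (intro finite_imageI finite_cartesian_product) auto
  ultimately have "finite ?S" by (rule finite_subset)
  then have "bdd_above ?S" by (rule bdd_above_finite)
  moreover have "hd_norm (x l i) (100 * rad l) (P k j) (P l i) \<in> ?S"
    using assms unfolding B10_def by blast
  ultimately have "hd_norm (x l i) (100 * rad l) (P k j) (P l i) \<le> Sup ?S"
    by (rule cSup_upper[rotated])
  moreover have "y \<in> V J x 10 k" using assms by (auto simp: V_def B10_def)
  ultimately show ?thesis by (simp add: eps_num_def hd_norm_commute[of "x l i" _ "P l i"])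
qed

text \<open>The numbers \<open>\<epsilon>\<^sub>k\<close> are summable along orbits, while \<open>\<epsilon>\<close> is small; \<open>e\<close> retains both pieces of
  information. What moves an orbit at step \<open>k\<close> depends on two generations of planes, whence \<open>\<beta>\<close>;
  at step 0 the previous generation is \<open>\<Sigma>0\<close>.\<close>

definition e :: "nat \<Rightarrow> 'a \<Rightarrow> real" where
  "e k y = min \<epsilon> (eps_num J x P k y)"

fun \<beta> :: "'a \<Rightarrow> nat \<Rightarrow> real" where
  "\<beta> z 0 = \<epsilon>"
| "\<beta> z (Suc k) = e k (f k z) + e (Suc k) (f (Suc k) z)"

lemma eps_num_nonneg: "0 \<le> eps_num J x P k y"
proof (cases "y \<in> V J x 10 k")
  case True
  then obtain j where j: "j \<in> J k" "y \<in> B10 k j" by (auto simp: V_def B10_def)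
  have "y \<in> ball (x k j) (11 * rad k)" using j rad_pos[of k] by (auto simp: B10_def)
  then have "hd_norm (x k j) (100 * rad k) (P k j) (P k j) \<le> eps_num J x P k y"
    using hd_norm_le_eps_num[OF j(1) _ j(1,2)] by simp
  then show ?thesis
    using hd_norm_nonneg[OF plane(3)[OF j(1)] plane(2)[OF j(1)], of "100 * rad k"] rad_pos[of k] by simp
qed (simp add: eps_num_def)

lemma e_nonneg: "0 \<le> e k y" and e_le: "e k y \<le> \<epsilon>"
  using eps_num_nonneg eps_pos by (auto simp: e_def)

lemma beta_nonneg: "0 \<le> \<beta> z k" and beta_le: "\<beta> z k \<le> 2 * \<epsilon>"
  using e_nonneg e_le eps_pos add_mono[OF e_le e_le]
  by (cases k; auto simp: add_nonneg_nonneg)+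

lemma power_A_beta:
  assumes "m \<le> 4"
  shows "A ^ m * \<beta> z k \<le> 2 / 10 ^ 5"
proof -
  have "A ^ m * \<beta> z k \<le> A ^ m * (2 * \<epsilon>)"
    using beta_le A by (intro mult_left_mono) auto
  then show ?thesis using power_A_eps[OF assms] by simp
qed

lemma A_beta_le: "A * \<beta> z k \<le> 2 / 10 ^ 5"
  using power_A_beta[of 1] by simp

lemma hd_same_e:
  assumes "i \<in> J k" "m \<in> J k" "y \<in> B10 k i" "y \<in> B10 k m"
  shows "hd_norm (x k i) (100 * rad k) (P k i) (P k m) \<le> e k y"
proof -
  have "dist (x k i) (x k m) \<le> 100 * rad k" "y \<in> ball (x k i) (11 * rad k)"
    using assms(3,4) dist_triangle2[of "x k i" "x k m" y] rad_pos[of k] by (auto simp: B10_def)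
  then show ?thesis
    using hd_same[OF assms(1,2)] hd_norm_le_eps_num[OF assms(2) _ assms(1,4)] by (simp add: e_def)
qed

lemma same_dir:
  assumes "i \<in> J k" "m \<in> J k" "y \<in> B10 k i" "y \<in> B10 k m"
  shows "norm (\<pi>' k m v - \<pi>' k i v) \<le> 16 * e k y * norm v"
  using dir_proj_close[OF plane(1,3)[OF assms(1)] plane(1,2)[OF assms(2)] _ hd_same_e[OF assms], of v]
    rad_pos[of k] by (simp add: norm_minus_commute)

lemma same_point:
  assumes "i \<in> J k" "m \<in> J k" "y \<in> B10 k i" "y \<in> B10 k m" "dist (x k i) y \<le> 3 * rad k"
  shows "norm (\<pi> k m y - \<pi> k i y) \<le> 148 * e k y * rad k"
proof -
  have "norm (\<pi> k i y - \<pi> k m y) \<le> e k y * (100 * rad k + 16 * norm (y - x k i))"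
    using orth_proj_close[OF plane(1,3)[OF assms(1)] plane(1,2)[OF assms(2)] _ hd_same_e[OF assms(1-4)]]
      rad_pos[of k] by simp
  also have "\<dots> \<le> e k y * (100 * rad k + 16 * (3 * rad k))"
    using assms(5) by (intro mult_left_mono e_nonneg) (simp add: dist_norm norm_minus_commute)
  finally show ?thesis by (simp add: norm_minus_commute algebra_simps)
qed

text \<open>The coherence condition controls the scale \<open>20 * rad k\<close> and the numbers \<open>\<epsilon>\<^sub>k\<close> the scale
  \<open>100 * rad k\<close>; whichever attains the minimum \<open>e\<close> is used.\<close>

lemma parent_close:
  assumes i: "i \<in> J k" and j: "j \<in> J (Suc k)" and d: "dist (x (Suc k) j) (x k i) < rad k"
    and y: "y \<in> B10 (Suc k) j"
  shows parent_dir: "norm (\<pi>' (Suc k) j v - \<pi>' k i v) \<le> 16 * e (Suc k) y * norm v"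
    and parent_point: "norm (\<pi> (Suc k) j y - \<pi> k i y) \<le> 132 * e (Suc k) y * rad k"
proof -
  have y2: "dist y (x k i) \<le> 2 * rad k"
    using dist_triangle[of y "x k i" "x (Suc k) j"] d y
    by (simp add: B10_def rad_Suc dist_commute)
  then have ny: "16 * norm (y - x k i) \<le> 32 * rad k" by (simp add: dist_norm)
  have "y \<in> ball (x k i) (11 * rad k)" using y2 rad_pos[of k] by (simp add: dist_commute)
  then have hd2: "hd_norm (x k i) (100 * rad k) (P k i) (P (Suc k) j) \<le> eps_num J x P (Suc k) y"
    using hd_norm_le_eps_num[OF j _ i y] by simp
  note hd1 = hd_parent[OF i j d]
  note close = dir_proj_close[OF plane(1,3)[OF i] plane(1,2)[OF j]]
    orth_proj_close[OF plane(1,3)[OF i] plane(1,2)[OF j]]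
  have r: "0 < rad k" by (rule rad_pos)
  consider "e (Suc k) y = \<epsilon>" | "e (Suc k) y = eps_num J x P (Suc k) y"
    by (metis e_def min_def)
  then have "norm (\<pi>' (Suc k) j v - \<pi>' k i v) \<le> 16 * e (Suc k) y * norm v
    \<and> norm (\<pi> (Suc k) j y - \<pi> k i y) \<le> 132 * e (Suc k) y * rad k"
  proof cases
    case 1
    have "norm (\<pi> (Suc k) j y - \<pi> k i y) \<le> \<epsilon> * (20 * rad k + 16 * norm (y - x k i))"
      using close(2)[OF _ hd1] r by (simp add: norm_minus_commute)
    also have "\<dots> \<le> \<epsilon> * (132 * rad k)"
      using ny r eps_pos by (intro mult_left_mono) auto
    finally show ?thesis using close(1)[OF _ hd1] r 1 by (simp add: norm_minus_commute)
  next
    case 2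
    have "norm (\<pi> (Suc k) j y - \<pi> k i y)
        \<le> eps_num J x P (Suc k) y * (100 * rad k + 16 * norm (y - x k i))"
      using close(2)[OF _ hd2] r by (simp add: norm_minus_commute)
    also have "\<dots> \<le> eps_num J x P (Suc k) y * (132 * rad k)"
      using ny eps_num_nonneg by (intro mult_left_mono) auto
    finally show ?thesis using close(1)[OF _ hd2] r 2 by (simp add: norm_minus_commute)
  qed
  then show "norm (\<pi>' (Suc k) j v - \<pi>' k i v) \<le> 16 * e (Suc k) y * norm v"
    "norm (\<pi> (Suc k) j y - \<pi> k i y) \<le> 132 * e (Suc k) y * rad k" by auto
qed

text \<open>On \<open>V J x 8 k\<close> the weights \<open>\<theta>\<close> have sum 1 and their derivatives have sum 0, so the displacement
  can be measured from any fixed vector. Choosing a projection onto one of the planes, only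
  differences of projections remain, whatever the distance of \<open>y\<close> to the planes.\<close>

lemma sigma_V8:
  assumes "y \<in> V J x 8 k"
  shows "\<sigma> k y - q = (\<Sum>m\<in>J k. \<theta> k m y *\<^sub>R (\<pi> k m y - q))"
proof -
  have "(\<Sum>m\<in>J k. \<theta> k m y *\<^sub>R q) = q"
    using sum_theta_eq_1[OF assms] by (simp flip: scaleR_sum_left)
  then show ?thesis
    by (simp add: sigma_map_def psi_eq_0[OF assms] scaleR_diff_right sum_subtractf)
qed

lemma Dsigma_V8:
  assumes "y \<in> V J x 8 k"
  shows "Dsigma k y v - w = (\<Sum>m\<in>J k. D1 k m y v *\<^sub>R (\<pi> k m y - q)) + (\<Sum>m\<in>J k. \<theta> k m y *\<^sub>R (\<pi>' k m v - w))"
proof -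
  have 1: "(\<Sum>m\<in>J k. \<theta> k m y *\<^sub>R u) = u" for u :: 'a
    using sum_theta_eq_1[OF assms] by (simp flip: scaleR_sum_left)
  have 0: "(\<Sum>m\<in>J k. D1 k m y v *\<^sub>R u) = 0" for u :: 'a
    using sum_D1_eq_0[OF assms, of v] by (simp only: scaleR_sum_left[symmetric]) simp
  show ?thesis
    unfolding Dsigma_def by (simp only: sum.distrib scaleR_diff_right sum_subtractf 0 1) simp
qed

text \<open>An orbit that lies in \<open>10B\<^sub>j\<^sub>,\<^sub>k\<close> is close to \<open>P\<^sub>j\<^sub>,\<^sub>k\<close>, and the image under \<open>Df k z\<close> of a direction
  \<open>v\<close> of \<open>\<Sigma>0\<close> is almost parallel to it. With lengths measured in units of \<open>rad k\<close>, these two invariants make every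
  term of \<open>\<sigma> k y - y\<close>, and of its first and second derivatives along such images, of order \<open>\<beta>\<close>.
  The constants are generous; what matters is that each step reproduces them.\<close>

definition near :: "'a \<Rightarrow> nat \<Rightarrow> bool" where
  "near z k \<longleftrightarrow> (\<forall>j\<in>J k. f k z \<in> B10 k j \<longrightarrow> norm (\<pi> k j (f k z) - f k z) \<le> 2000 * \<beta> z k * rad k)"

definition tangential :: "'a \<Rightarrow> 'a \<Rightarrow> nat \<Rightarrow> bool" where
  "tangential z v k \<longleftrightarrow> (\<forall>j\<in>J k. f k z \<in> B10 k j \<longrightarrow>
     norm (\<pi>' k j (Df k z v) - Df k z v) \<le> 500 * A ^ 2 * \<beta> z k * norm (Df k z v))"

lemma step_le_of_near:
  assumes "near z k"
  shows "norm (f (Suc k) z - f k z) \<le> 4000 * A * \<beta> z k * rad k"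
    and "norm (f (Suc k) z - f k z) \<le> rad k / 4"
proof -
  have "norm (\<Sum>j\<in>J k. \<theta> k j (f k z) *\<^sub>R (\<pi> k j (f k z) - f k z)) \<le> 2 * A * (2000 * \<beta> z k * rad k)"
    using assms beta_nonneg[of z k] rad_pos[of k]
    by (intro norm_theta_sum_le_2A) (auto simp: near_def)
  then show *: "norm (f (Suc k) z - f k z) \<le> 4000 * A * \<beta> z k * rad k"
    by (simp add: sigma_eq)
  have "4000 * A * \<beta> z k \<le> 1 / 4" using A_beta_le[of z k] by simp
  from mult_right_mono[OF this, of "rad k"] * rad_pos[of k]
  show "norm (f (Suc k) z - f k z) \<le> rad k / 4" by linarith
qed

lemma Df_step_le_of_near:
  assumes "near z k" "tangential z v k"
  shows "norm (Df (Suc k) z v - Df k z v) \<le> 3000 * A ^ 3 * \<beta> z k * norm (Df k z v)"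
proof -
  let ?y = "f k z" and ?w = "Df k z v"
  have b: "0 \<le> \<beta> z k * norm ?w" using beta_nonneg by simp
  have "norm (\<Sum>j\<in>J k. D1 k j ?y ?w *\<^sub>R (\<pi> k j ?y - ?y)) \<le> A * (2000 * A * (\<beta> z k * norm ?w))"
  proof (rule norm_sum_le[of _ ?y])
    fix j assume j: "j \<in> J k"
    show "D1 k j ?y ?w *\<^sub>R (\<pi> k j ?y - ?y) = 0" if "?y \<notin> B10 k j"
      unfolding nabla_theta_outside[OF j that] by simp
    assume y: "?y \<in> B10 k j"
    have "norm (D1 k j ?y ?w *\<^sub>R (\<pi> k j ?y - ?y)) \<le> (A / rad k * norm ?w) * (2000 * \<beta> z k * rad k)"
      unfolding norm_scaleR using assms(1) j y D1_le[OF j, of ?w ?y] A rad_pos[of k]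
      by (intro mult_mono) (auto simp: near_def)
    also have "\<dots> = 2000 * A * (\<beta> z k * norm ?w)" using rad_pos[of k] by simp
    finally show "norm (D1 k j ?y ?w *\<^sub>R (\<pi> k j ?y - ?y)) \<le> 2000 * A * (\<beta> z k * norm ?w)" .
  qed (use A b in auto)
  moreover have "norm (\<Sum>j\<in>J k. \<theta> k j ?y *\<^sub>R (\<pi>' k j ?w - ?w)) \<le> 2 * A * (500 * A ^ 2 * \<beta> z k * norm ?w)"
    using assms(2) A b beta_nonneg[of z k] by (intro norm_theta_sum_le_2A) (auto simp: tangential_def)
  moreover have eq: "Df (Suc k) z v - Df k z v
      = (\<Sum>j\<in>J k. D1 k j ?y ?w *\<^sub>R (\<pi> k j ?y - ?y)) + (\<Sum>j\<in>J k. \<theta> k j ?y *\<^sub>R (\<pi>' k j ?w - ?w))"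
    by (simp add: Dsigma_def sum.distrib)
  ultimately have "norm (Df (Suc k) z v - Df k z v)
      \<le> A * (2000 * A * (\<beta> z k * norm ?w)) + 2 * A * (500 * A ^ 2 * \<beta> z k * norm ?w)"
    unfolding eq by (intro norm_triangle_le add_mono)
  also have "\<dots> = 2000 * (A ^ 2 * (\<beta> z k * norm ?w)) + 1000 * (A ^ 3 * (\<beta> z k * norm ?w))"
    by (simp add: power2_eq_square power3_eq_cube)
  also have "\<dots> \<le> 3000 * (A ^ 3 * (\<beta> z k * norm ?w))"
    using mult_right_mono[OF power_increasing[of 2 3 A] b] A by (simp add: ac_simps)
  finally show ?thesis by (simp add: mult.assoc)
qed

text \<open>By maximality of the net of generation \<open>k\<close>, an orbit that enters a ball \<open>10B\<^sub>j\<^sub>,\<^sub>k\<^sub>+\<^sub>1\<close> was at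
  time \<open>k\<close> well inside the region where the projections alone determine \<open>\<sigma>\<^sub>k\<close>.\<close>

lemma ancestor:
  assumes "near z k" "j \<in> J (Suc k)" "f (Suc k) z \<in> B10 (Suc k) j"
  obtains i where "i \<in> J k" "dist (x (Suc k) j) (x k i) < rad k"
    "dist (x k i) (f k z) \<le> 3 * rad k" "f k z \<in> B10 k i" "f k z \<in> V J x 8 k"
proof -
  obtain i where i: "i \<in> J k" "dist (x (Suc k) j) (x k i) < rad k" using parent[OF assms(2)] .
  have "dist (f (Suc k) z) (f k z) \<le> rad k / 4"
    unfolding dist_norm by (rule step_le_of_near(2)[OF assms(1)])
  moreover have "dist (x (Suc k) j) (f (Suc k) z) < rad k"
    using assms(3) by (simp add: B10_def rad_Suc)
  ultimately have "dist (x k i) (f k z) \<le> 3 * rad k"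
    using i(2) dist_triangle[of "x k i" "f k z" "x (Suc k) j"]
      dist_triangle[of "x (Suc k) j" "f k z" "f (Suc k) z"] rad_pos[of k]
    by (simp add: dist_commute)
  moreover from this have "f k z \<in> B10 k i" "f k z \<in> V J x 8 k"
    using rad_pos[of k] i(1) by (auto simp: B10_def V_def intro!: bexI[of _ i])
  ultimately show ?thesis using that i by blast
qed

lemma near_0:
  assumes "z \<in> \<Sigma>0"
  shows "near z 0"
  unfolding near_def
proof (intro ballI impI)
  fix j assume j: "j \<in> J 0" and y: "f 0 z \<in> B10 0 j"
  have hd: "hd_norm (x 0 j) 100 (P 0 j) \<Sigma>0 \<le> \<epsilon>"
    using coherent j by (auto simp: coherent_collection_def)
  have "norm (\<pi> 0 j z - orth_proj \<Sigma>0 z) \<le> \<epsilon> * (100 + 16 * norm (z - x 0 j))"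
    by (rule orth_proj_close[OF plane(1,3)[OF j] S0 _ hd]) simp
  also have "\<dots> \<le> \<epsilon> * (100 + 16 * 10)"
    using y eps_pos by (intro mult_left_mono) (auto simp: B10_def rad_def dist_norm norm_minus_commute)
  finally show "norm (\<pi> 0 j (f 0 z) - f 0 z) \<le> 2000 * \<beta> z 0 * rad 0"
    using eps_pos by (simp add: orth_proj_fix[OF S0 assms] rad_def)
qed

text \<open>The new point is a convex combination of projections of the old one onto planes within
  \<open>e k\<close> of the plane \<open>P k i\<close> of an ancestor, and \<open>P k i\<close> is within \<open>e (Suc k)\<close> of the plane in
  question. The bound at step \<open>k\<close> is used only to locate the ancestor, so the constant
  does not grow.\<close>

lemma near_Suc:
  assumes near: "near z k"
  shows "near z (Suc k)"
  unfolding near_def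
proof (intro ballI impI)
  let ?u = "f k z" and ?y = "f (Suc k) z"
  fix j assume j: "j \<in> J (Suc k)" and y: "?y \<in> B10 (Suc k) j"
  obtain i where i: "i \<in> J k" "dist (x (Suc k) j) (x k i) < rad k"
    "dist (x k i) ?u \<le> 3 * rad k" "?u \<in> B10 k i" "?u \<in> V J x 8 k"
    using ancestor[OF near j y] .
  have "norm (\<Sum>m\<in>J k. \<theta> k m ?u *\<^sub>R (\<pi> k m ?u - \<pi> k i ?u)) \<le> (\<Sum>m\<in>J k. \<theta> k m ?u) * (148 * e k ?u * rad k)"
    using same_point[OF i(1) _ i(4) _ i(3)] by (intro norm_theta_sum_le)
  then have 1: "norm (?y - \<pi> k i ?u) \<le> 148 * e k ?u * rad k"
    using sigma_V8[OF i(5), of "\<pi> k i ?u"] sum_theta_eq_1[OF i(5)] by simp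
  have "norm (\<pi> k i ?y - ?y) \<le> norm (?y - \<pi> k i ?u)"
    by (rule norm_orth_proj_le[OF plane(1,2)[OF i(1)] orth_proj_in[OF plane(1,2)[OF i(1)]]])
  moreover have "norm (\<pi> (Suc k) j ?y - \<pi> k i ?y) \<le> 132 * e (Suc k) ?y * rad k"
    by (rule parent_point[OF i(1) j i(2) y])
  ultimately have "norm (\<pi> (Suc k) j ?y - ?y) \<le> 132 * e (Suc k) ?y * rad k + 148 * e k ?u * rad k"
    using 1 norm_triangle_ineq[of "\<pi> (Suc k) j ?y - \<pi> k i ?y" "\<pi> k i ?y - ?y"] by simp
  also have "\<dots> \<le> 200 * e (Suc k) ?y * rad k + 200 * e k ?u * rad k"
    using e_nonneg rad_pos[of k] by (intro add_mono mult_right_mono) (auto simp: less_imp_le)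
  finally show "norm (\<pi> (Suc k) j ?y - ?y) \<le> 2000 * \<beta> z (Suc k) * rad (Suc k)"
    by (simp add: rad_Suc algebra_simps del: DT_iter.simps)
qed

lemma near: "z \<in> \<Sigma>0 \<Longrightarrow> near z k"
  by (induction k) (simp_all add: near_0 near_Suc)

lemma tangential_0:
  assumes "z \<in> \<Sigma>0" "v \<in> directions \<Sigma>0"
  shows "tangential z v 0"
  unfolding tangential_def
proof (intro ballI impI)
  fix j assume j: "j \<in> J 0"
  have hd: "hd_norm (x 0 j) 100 (P 0 j) \<Sigma>0 \<le> \<epsilon>"
    using coherent j by (auto simp: coherent_collection_def)
  have A2: "16 \<le> 500 * A ^ 2" using one_le_power[OF A, of 2] by linarith
  have "norm (\<pi>' 0 j v - dir_proj \<Sigma>0 v) \<le> 16 * \<epsilon> * norm v"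
    by (rule dir_proj_close[OF plane(1,3)[OF j] S0 _ hd]) simp
  also have "\<dots> \<le> 500 * A ^ 2 * \<epsilon> * norm v"
    using A2 eps_pos by (intro mult_right_mono) auto
  finally show "norm (\<pi>' 0 j (Df 0 z v) - Df 0 z v) \<le> 500 * A ^ 2 * \<beta> z 0 * norm (Df 0 z v)"
    by (simp add: dir_proj_fix[OF S0 assms(2)])
qed

lemma norm_Df_le_2:
  assumes "near z k" "tangential z v k"
  shows "norm (Df k z v) \<le> 2 * norm (Df (Suc k) z v)"
proof -
  have "3000 * A ^ 3 * \<beta> z k \<le> 1 / 2" using power_A_beta[of 3 z k] by simp
  from mult_right_mono[OF this norm_ge_zero]
  have "norm (Df (Suc k) z v - Df k z v) \<le> 1 / 2 * norm (Df k z v)"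
    by (rule order_trans[OF Df_step_le_of_near[OF assms]])
  then show ?thesis
    using norm_triangle_ineq3[of "Df (Suc k) z v" "Df k z v"] by linarith
qed

text \<open>The linearized form of the argument for points: on \<open>V J x 8 k\<close> the derivative of \<open>\<sigma> k\<close> is
  within order \<open>e k\<close> of the projection onto the directions of \<open>P k i\<close>.\<close>

lemma tangential_Suc:
  assumes near: "near z k" and tan: "tangential z v k"
  shows "tangential z v (Suc k)"
  unfolding tangential_def
proof (intro ballI impI)
  let ?u = "f k z" and ?y = "f (Suc k) z" and ?w = "Df k z v" and ?w' = "Df (Suc k) z v"
  fix j assume j: "j \<in> J (Suc k)" and y: "?y \<in> B10 (Suc k) j"
  obtain i where i: "i \<in> J k" "dist (x (Suc k) j) (x k i) < rad k"
    "dist (x k i) ?u \<le> 3 * rad k" "?u \<in> B10 k i" "?u \<in> V J x 8 k"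
    using ancestor[OF near j y] .
  let ?a = "e k ?u" and ?b = "e (Suc k) ?y"
  have a: "0 \<le> ?a" "0 \<le> ?b" by (auto intro: e_nonneg)
  have "norm (\<Sum>m\<in>J k. D1 k m ?u ?w *\<^sub>R (\<pi> k m ?u - \<pi> k i ?u)) \<le> A * (148 * A * (?a * norm ?w))"
  proof (rule norm_sum_le[of _ ?u])
    fix m assume m: "m \<in> J k"
    show "D1 k m ?u ?w *\<^sub>R (\<pi> k m ?u - \<pi> k i ?u) = 0" if "?u \<notin> B10 k m"
      unfolding nabla_theta_outside[OF m that] by simp
    assume u: "?u \<in> B10 k m"
    have "norm (D1 k m ?u ?w *\<^sub>R (\<pi> k m ?u - \<pi> k i ?u)) \<le> (A / rad k * norm ?w) * (148 * ?a * rad k)"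
      unfolding norm_scaleR using same_point[OF i(1) m i(4) u i(3)] D1_le[OF m, of ?w ?u] A rad_pos[of k]
      by (intro mult_mono) auto
    also have "\<dots> = 148 * A * (?a * norm ?w)" using rad_pos[of k] by simp
    finally show "norm (D1 k m ?u ?w *\<^sub>R (\<pi> k m ?u - \<pi> k i ?u)) \<le> 148 * A * (?a * norm ?w)" .
  qed (use A a in auto)
  moreover have "norm (\<Sum>m\<in>J k. \<theta> k m ?u *\<^sub>R (\<pi>' k m ?w - \<pi>' k i ?w))
      \<le> 16 * ?a * norm ?w"
    using norm_theta_sum_le[where k = k and y = ?u and h = "\<lambda>m. \<pi>' k m ?w - \<pi>' k i ?w",
        OF same_dir[OF i(1) _ i(4)]] sum_theta_eq_1[OF i(5)] by simp
  moreover have eq: "?w' - \<pi>' k i ?w = (\<Sum>m\<in>J k. D1 k m ?u ?w *\<^sub>R (\<pi> k m ?u - \<pi> k i ?u))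
      + (\<Sum>m\<in>J k. \<theta> k m ?u *\<^sub>R (\<pi>' k m ?w - \<pi>' k i ?w))"
    using Dsigma_V8[OF i(5)] by simp
  ultimately have "norm (?w' - \<pi>' k i ?w) \<le> A * (148 * A * (?a * norm ?w)) + 16 * ?a * norm ?w"
    unfolding eq by (intro norm_triangle_le add_mono)
  also have "\<dots> \<le> 164 * (A\<^sup>2 * (?a * norm ?w))"
    using mult_right_mono[OF one_le_power[OF A, of 2], of "?a * norm ?w"] a
    by (simp add: power2_eq_square ac_simps)
  also have "\<dots> \<le> 164 * (A\<^sup>2 * (?a * (2 * norm ?w')))"
    using norm_Df_le_2[OF near tan] A a by (intro mult_left_mono) auto
  finally have 1: "norm (?w' - \<pi>' k i ?w) \<le> 328 * A\<^sup>2 * ?a * norm ?w'" by simp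
  have "norm (?w' - \<pi>' k i ?w') \<le> norm (?w' - \<pi>' k i ?w)"
    by (rule norm_diff_dir_proj_le_dist[OF plane(1,2)[OF i(1)] dir_proj_in[OF plane(1,2)[OF i(1)]]])
  moreover have "norm (\<pi>' (Suc k) j ?w' - \<pi>' k i ?w') \<le> 16 * ?b * norm ?w'"
    by (rule parent_dir[OF i(1) j i(2) y])
  ultimately have "norm (\<pi>' (Suc k) j ?w' - ?w') \<le> 16 * ?b * norm ?w' + 328 * A\<^sup>2 * ?a * norm ?w'"
    using 1 norm_triangle_ineq4[of "\<pi>' (Suc k) j ?w' - \<pi>' k i ?w'" "?w' - \<pi>' k i ?w'"] by simp
  also have "\<dots> \<le> (500 * A\<^sup>2) * ?b * norm ?w' + 500 * A\<^sup>2 * ?a * norm ?w'"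
    using a one_le_power[OF A, of 2] by (intro add_mono mult_right_mono) auto
  finally show "norm (\<pi>' (Suc k) j ?w' - ?w') \<le> 500 * A ^ 2 * \<beta> z (Suc k) * norm ?w'"
    by (simp add: algebra_simps del: DT_iter.simps Df.simps)
qed

lemma tangential: "z \<in> \<Sigma>0 \<Longrightarrow> v \<in> directions \<Sigma>0 \<Longrightarrow> tangential z v k"
  by (induction k) (simp_all add: tangential_0 tangential_Suc near)

lemmas f_step_le = step_le_of_near[OF near]
lemmas Df_step_le = Df_step_le_of_near[OF near tangential]

end

section \<open>Geometric convergence and discrete Gronwall inequalities\<close>

lemma geometric_limit:
  fixes X :: "nat \<Rightarrow> 'a::banach"
  assumes step: "\<And>k. norm (X (Suc k) - X k) \<le> c * rad k" and c: "0 \<le> c"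
  shows "X \<longlonglongrightarrow> lim X" and "norm (lim X - X k) \<le> 2 * c * rad k"
proof -
  have le: "norm (X (k + m) - X k) \<le> 2 * c * (rad k - rad (k + m))" for k m
  proof (induction m)
    case (Suc m)
    have "norm (X (k + Suc m) - X k) \<le> c * rad (k + m) + 2 * c * (rad k - rad (k + m))"
      using norm_triangle_ineq[of "X (k + Suc m) - X (k + m)" "X (k + m) - X k"] step[of "k + m"] Suc
      by simp
    also have "\<dots> \<le> 2 * c * (rad k - rad (k + Suc m))"
      using mult_nonneg_nonneg[OF c less_imp_le[OF rad_pos[of "k + m"]]]
      by (simp add: rad_Suc algebra_simps)
    finally show ?case .
  qed simp
  have le': "norm (X (k + m) - X k) \<le> 2 * c * rad k" for k m
    using le[of k m] mult_nonneg_nonneg[OF c less_imp_le[OF rad_pos[of "k + m"]]]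
    by (simp add: algebra_simps)
  have "rad \<longlonglongrightarrow> 0" unfolding rad_def[abs_def] by (rule LIMSEQ_power_zero) simp
  then have lim0: "(\<lambda>k. 2 * c * rad k) \<longlonglongrightarrow> 0" by (rule tendsto_mult_right_zero)
  have "Cauchy X"
  proof (rule CauchyI)
    fix \<delta> :: real assume "0 < \<delta>"
    then obtain M where M: "2 * c * rad M < \<delta> / 2"
      using order_tendstoD(2)[OF lim0, of "\<delta> / 2"] eventually_sequentially by auto
    have "norm (X m - X n) < \<delta>" if "M \<le> m" "M \<le> n" for m n
      using le'[of M "m - M"] le'[of M "n - M"] that M
        norm_triangle_ineq4[of "X m - X M" "X n - X M"] by simp
    then show "\<exists>M. \<forall>m\<ge>M. \<forall>n\<ge>M. norm (X m - X n) < \<delta>" by blast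
  qed
  then show *: "X \<longlonglongrightarrow> lim X" by (simp add: Cauchy_convergent_iff convergent_LIMSEQ_iff)
  have "(\<lambda>m. norm (X (k + m) - X k)) \<longlonglongrightarrow> norm (lim X - X k)"
    using LIMSEQ_ignore_initial_segment[OF *, of k]
    by (intro tendsto_norm tendsto_diff tendsto_const) (simp add: add.commute)
  then show "norm (lim X - X k) \<le> 2 * c * rad k"
    by (rule LIMSEQ_le_const2) (use le' in blast)
qed

lemma Gronwall_exp:
  fixes a b :: "nat \<Rightarrow> real"
  assumes "\<And>k. a (Suc k) \<le> (1 + b k) * a k" "\<And>k. 0 \<le> a k"
  shows "a n \<le> exp (\<Sum>k<n. b k) * a 0"
proof (induction n)
  case (Suc n)
  have "a (Suc n) \<le> exp (b n) * a n"
    using assms(1)[of n] mult_right_mono[OF exp_ge_add_one_self[of "b n"] assms(2)[of n]] by simp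
  also have "\<dots> \<le> exp (b n) * (exp (\<Sum>k<n. b k) * a 0)" using Suc by simp
  finally show ?case by (simp add: exp_add mult_ac)
qed simp

lemma Gronwall_exp_lower:
  fixes a b :: "nat \<Rightarrow> real"
  assumes "\<And>k. a k \<le> (1 + b k) * a (Suc k)" "\<And>k. 0 \<le> a k"
  shows "a 0 \<le> exp (\<Sum>k<n. b k) * a n"
proof (induction n)
  case (Suc n)
  have "a n \<le> exp (b n) * a (Suc n)"
    using assms(1)[of n] mult_right_mono[OF exp_ge_add_one_self[of "b n"] assms(2)[of "Suc n"]] by simp
  then have "exp (\<Sum>k<n. b k) * a n \<le> exp (\<Sum>k<n. b k) * (exp (b n) * a (Suc n))" by simp
  from order_trans[OF Suc this] show ?case by (simp add: exp_add mult_ac)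
qed simp

context david_toro
begin

section \<open>Two orbits approach each other at most geometrically\<close>

text \<open>The factors \<open>\<theta>\<close> are Lipschitz with constant \<open>A / rad k\<close>, which the size \<open>a * rad k\<close> of the other
  factors compensates.\<close>

lemma norm_theta_sum_diff_le:
  fixes h :: "nat \<Rightarrow> 'a \<Rightarrow> 'a"
  assumes a: "\<And>j. j \<in> J k \<Longrightarrow> y \<in> B10 k j \<Longrightarrow> norm (h j y) \<le> a * rad k"
    "\<And>j. j \<in> J k \<Longrightarrow> y' \<in> B10 k j \<Longrightarrow> norm (h j y') \<le> a * rad k"
    and b: "\<And>j. j \<in> J k \<Longrightarrow> y \<in> B10 k j \<or> y' \<in> B10 k j \<Longrightarrow> norm (h j y - h j y') \<le> b * norm (y - y')"
    and nonneg: "0 \<le> a" "0 \<le> b"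
  shows "norm ((\<Sum>j\<in>J k. \<theta> k j y *\<^sub>R h j y) - (\<Sum>j\<in>J k. \<theta> k j y' *\<^sub>R h j y'))
    \<le> 2 * A\<^sup>2 * (a + b) * norm (y - y')"
proof -
  have one: "norm (\<theta> k j p *\<^sub>R h j p - \<theta> k j p' *\<^sub>R h j p') \<le> A * (a + b) * norm (p - p')"
    if j: "j \<in> J k" and h: "norm (h j p) \<le> a * rad k" "norm (h j p - h j p') \<le> b * norm (p - p')" for j p p'
  proof -
    have "norm ((\<theta> k j p - \<theta> k j p') *\<^sub>R h j p) \<le> (A / rad k * norm (p - p')) * (a * rad k)"
      unfolding norm_scaleR using theta_Lipschitz[OF j, of p p'] h A rad_pos[of k]
      by (intro mult_mono) auto
    moreover have "norm (\<theta> k j p' *\<^sub>R (h j p - h j p')) \<le> A * (b * norm (p - p'))"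
      unfolding norm_scaleR using theta_le[OF j, of p'] theta_nonneg[OF j, of p'] h A
      by (intro mult_mono) auto
    moreover have eq: "\<theta> k j p *\<^sub>R h j p - \<theta> k j p' *\<^sub>R h j p'
        = (\<theta> k j p - \<theta> k j p') *\<^sub>R h j p + \<theta> k j p' *\<^sub>R (h j p - h j p')"
      by (simp add: algebra_simps)
    ultimately have "norm (\<theta> k j p *\<^sub>R h j p - \<theta> k j p' *\<^sub>R h j p')
        \<le> (A / rad k * norm (p - p')) * (a * rad k) + A * (b * norm (p - p'))"
      unfolding eq by (intro norm_triangle_le add_mono)
    also have "\<dots> = A * (a + b) * norm (p - p')" using rad_pos[of k] by (simp add: field_simps)
    finally show ?thesis .
  qed
  have "norm (\<Sum>j\<in>J k. \<theta> k j y *\<^sub>R h j y - \<theta> k j y' *\<^sub>R h j y') \<le> 2 * A * (A * (a + b) * norm (y - y'))"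
  proof (rule norm_sum_le_2[of k y y'])
    fix j assume j: "j \<in> J k"
    show "\<theta> k j y *\<^sub>R h j y - \<theta> k j y' *\<^sub>R h j y' = 0" if "y \<notin> B10 k j" "y' \<notin> B10 k j"
      using theta_outside[OF j] that by simp
    assume "y \<in> B10 k j \<or> y' \<in> B10 k j"
    then consider "y \<in> B10 k j" | "y' \<in> B10 k j" by blast
    then show "norm (\<theta> k j y *\<^sub>R h j y - \<theta> k j y' *\<^sub>R h j y') \<le> A * (a + b) * norm (y - y')"
    proof cases
      case 1
      show ?thesis by (rule one[OF j a(1)[OF j 1] b[OF j]]) (use 1 in simp)
    next
      case 2
      have "norm (h j y' - h j y) \<le> b * norm (y' - y)"
        using b[OF j] 2 by (simp add: norm_minus_commute)
      from one[OF j a(2)[OF j 2] this] show ?thesis by (simp add: norm_minus_commute)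
    qed
  qed (use A nonneg in simp)
  also have "2 * A * (A * (a + b) * norm (y - y')) = 2 * A\<^sup>2 * (a + b) * norm (y - y')"
    by (simp add: power2_eq_square)
  finally show ?thesis by (simp only: sum_subtractf)
qed

text \<open>Chords of the surface \<open>f k ` \<Sigma>0\<close> that are shorter than \<open>rad k\<close> are almost parallel to the
  planes of generation \<open>k\<close>. This is what a step of the iteration needs in order not to shrink
  them by more than a factor 2.\<close>

definition chords_tangential :: "nat \<Rightarrow> bool" where
  "chords_tangential k \<longleftrightarrow> (\<forall>z\<in>\<Sigma>0. \<forall>z'\<in>\<Sigma>0. \<forall>j\<in>J k. f k z \<in> B10 k j \<longrightarrow> norm (f k z - f k z') \<le> rad k \<longrightarrow>
     norm (\<pi>' k j (f k z - f k z') - (f k z - f k z')) \<le> 800 * A\<^sup>2 * \<epsilon> * norm (f k z - f k z'))"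

lemma chords_tangential_0: "chords_tangential 0"
  unfolding chords_tangential_def
proof (intro ballI impI)
  fix z z' j assume z: "z \<in> \<Sigma>0" "z' \<in> \<Sigma>0" and j: "j \<in> J 0" and y: "f 0 z \<in> B10 0 j"
  have "norm (\<pi>' 0 j (z - z') - (z - z')) \<le> 500 * A\<^sup>2 * \<epsilon> * norm (z - z')"
    using tangential_0[OF z(1) diff_in_directions[OF z]] j y by (simp add: tangential_def)
  also have "\<dots> \<le> 800 * A\<^sup>2 * \<epsilon> * norm (z - z')"
    using eps_pos by (intro mult_right_mono) auto
  finally show "norm (\<pi>' 0 j (f 0 z - f 0 z') - (f 0 z - f 0 z')) \<le> 800 * A\<^sup>2 * \<epsilon> * norm (f 0 z - f 0 z')"
    by simp
qed

text \<open>A step moves points by at most \<open>rad k / 4\<close>, which settles longer chords. For shorter ones the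
  displacement is Lipschitz with constant at most 1/2, since the chord is almost fixed by the
  linear parts of the projections.\<close>

lemma dist_step_lower:
  assumes ct: "chords_tangential k" and z: "z \<in> \<Sigma>0" "z' \<in> \<Sigma>0"
  shows "norm (f k z - f k z') \<le> 2 * norm (f (Suc k) z - f (Suc k) z')"
proof (cases "norm (f k z - f k z') \<le> rad k")
  case False
  have eq: "f k z - f k z' = (f (Suc k) z - f (Suc k) z') - (f (Suc k) z - f k z) + (f (Suc k) z' - f k z')"
    by simp
  have "norm (f k z - f k z') \<le> norm (f (Suc k) z - f (Suc k) z') + rad k / 4 + rad k / 4"
    unfolding eq by (intro norm_triangle_le norm_triangle_le_diff add_mono f_step_le(2) z order_refl)
  then show ?thesis using False by linarith
next
  case True
  let ?y = "f k z" and ?y' = "f k z'"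
  let ?h = "\<lambda>j p. \<pi> k j p - p"
  have n: "norm (\<pi> k j (f k p) - f k p) \<le> (4000 * \<epsilon>) * rad k"
    if "p \<in> \<Sigma>0" "j \<in> J k" "f k p \<in> B10 k j" for p j
  proof -
    have "norm (\<pi> k j (f k p) - f k p) \<le> 2000 * \<beta> p k * rad k"
      using near[OF that(1), of k] that by (simp add: near_def)
    also have "\<dots> \<le> 4000 * \<epsilon> * rad k"
      using beta_le[of p k] rad_pos[of k] by (intro mult_right_mono) auto
    finally show ?thesis .
  qed
  have "norm ((\<Sum>j\<in>J k. \<theta> k j ?y *\<^sub>R ?h j ?y) - (\<Sum>j\<in>J k. \<theta> k j ?y' *\<^sub>R ?h j ?y'))
    \<le> 2 * A\<^sup>2 * (4000 * \<epsilon> + 800 * A\<^sup>2 * \<epsilon>) * norm (?y - ?y')"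
  proof (rule norm_theta_sum_diff_le)
    fix j assume j: "j \<in> J k" "?y \<in> B10 k j \<or> ?y' \<in> B10 k j"
    have eq: "?h j ?y - ?h j ?y' = \<pi>' k j (?y - ?y') - (?y - ?y')"
      using orth_proj_diff[OF plane(1,2)[OF j(1)], of ?y ?y'] by (simp add: algebra_simps)
    have eq': "norm (\<pi>' k j (?y - ?y') - (?y - ?y')) = norm (\<pi>' k j (?y' - ?y) - (?y' - ?y))"
      unfolding dir_proj_diff[OF plane(1,2)[OF j(1)]]
      by (subst norm_minus_cancel[symmetric]) (simp add: algebra_simps)
    from j(2) show "norm (?h j ?y - ?h j ?y') \<le> 800 * A\<^sup>2 * \<epsilon> * norm (?y - ?y')"
    proof
      assume "?y \<in> B10 k j"
      then show ?thesis unfolding eq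
        using ct z j(1) True by (simp add: chords_tangential_def)
    next
      assume "?y' \<in> B10 k j"
      moreover have "norm (?y' - ?y) \<le> rad k" using True by (subst norm_minus_commute)
      ultimately show ?thesis unfolding eq eq'
        using ct z j(1) norm_minus_commute[of ?y ?y'] by (simp add: chords_tangential_def)
    qed
  qed (use n z eps_pos in auto)
  also have "2 * A\<^sup>2 * (4000 * \<epsilon> + 800 * A\<^sup>2 * \<epsilon>) = 8000 * (A ^ 2 * \<epsilon>) + 1600 * (A ^ 4 * \<epsilon>)"
    by (simp add: algebra_simps flip: power_add)
  also have "\<dots> * norm (?y - ?y') \<le> 1 / 2 * norm (?y - ?y')"
    using power_A_eps[of 2] power_A_eps[of 4] by (intro mult_right_mono) auto
  finally have "norm ((f (Suc k) z - f (Suc k) z') - (?y - ?y')) \<le> 1 / 2 * norm (?y - ?y')"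
    by (simp add: sigma_eq algebra_simps)
  then show ?thesis
    using norm_triangle_ineq3[of "f (Suc k) z - f (Suc k) z'" "?y - ?y'"] by linarith
qed

text \<open>At both preceding points \<open>\<sigma> k\<close> is a convex combination of projections close to one
  \<open>\<pi> k i\<close>, so the new chord is almost the projection of the old
  one, and by the lower bound for the present step the old chord is at most twice as long
  as the new one.\<close>

lemma chords_tangential_Suc:
  assumes ct: "chords_tangential k"
  shows "chords_tangential (Suc k)"
  unfolding chords_tangential_def
proof (intro ballI impI)
  fix z z' j assume z: "z \<in> \<Sigma>0" "z' \<in> \<Sigma>0" and j: "j \<in> J (Suc k)"
    and y: "f (Suc k) z \<in> B10 (Suc k) j" and close: "norm (f (Suc k) z - f (Suc k) z') \<le> rad (Suc k)"
  let ?u = "f k z" and ?u' = "f k z'" and ?d = "f (Suc k) z - f (Suc k) z'"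
  obtain i where i: "i \<in> J k" "dist (x (Suc k) j) (x k i) < rad k"
    "dist (x k i) ?u \<le> 3 * rad k" "?u \<in> B10 k i" "?u \<in> V J x 8 k"
    using ancestor[OF near[OF z(1)] j y] .
  have eq: "?u - ?u' = ?d - (f (Suc k) z - ?u) + (f (Suc k) z' - ?u')" by simp
  have "norm (?u - ?u') \<le> rad (Suc k) + rad k / 4 + rad k / 4"
    unfolding eq by (intro norm_triangle_le norm_triangle_le_diff add_mono f_step_le(2) z close)
  then have "dist ?u ?u' \<le> rad k" using rad_pos[of k] by (simp add: dist_norm rad_Suc)
  then have d4: "dist (x k i) ?u \<le> 4 * rad k" "dist (x k i) ?u' \<le> 4 * rad k"
    using i(3) dist_triangle[of "x k i" ?u' ?u] rad_pos[of k] by auto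
  then have V': "?u' \<in> V J x 8 k"
    using i(1) rad_pos[of k] by (auto simp: V_def intro!: bexI[of _ i])
  have hd: "hd_norm (x k i) (100 * rad k) (P k i) (P k m) \<le> \<epsilon>"
    if m: "m \<in> J k" "q \<in> B10 k m" "dist (x k i) q \<le> 4 * rad k" for m q
  proof (rule hd_same[OF i(1) m(1)])
    show "dist (x k i) (x k m) \<le> 100 * rad k"
      using m(2,3) dist_triangle[of "x k i" "x k m" q] rad_pos[of k]
      by (simp add: B10_def dist_commute)
  qed
  have pt: "norm (\<pi> k m q - \<pi> k i q) \<le> 164 * \<epsilon> * rad k"
    if m: "m \<in> J k" "q \<in> B10 k m" "dist (x k i) q \<le> 4 * rad k" for m q
  proof -
    have "norm (\<pi> k m q - \<pi> k i q) \<le> \<epsilon> * (100 * rad k + 16 * norm (q - x k i))"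
      using orth_proj_close[OF plane(1,3)[OF i(1)] plane(1,2)[OF m(1)] _ hd[OF m]] rad_pos[of k]
      by (simp add: norm_minus_commute)
    also have "\<dots> \<le> \<epsilon> * (100 * rad k + 16 * (4 * rad k))"
      using m(3) eps_pos by (intro mult_left_mono) (auto simp: dist_norm norm_minus_commute)
    finally show ?thesis by simp
  qed
  let ?h = "\<lambda>m p. \<pi> k m p - \<pi> k i p"
  have "norm ((\<Sum>m\<in>J k. \<theta> k m ?u *\<^sub>R ?h m ?u) - (\<Sum>m\<in>J k. \<theta> k m ?u' *\<^sub>R ?h m ?u'))
    \<le> 2 * A\<^sup>2 * (164 * \<epsilon> + 16 * \<epsilon>) * norm (?u - ?u')"
  proof (rule norm_theta_sum_diff_le)
    fix m assume m: "m \<in> J k" "?u \<in> B10 k m \<or> ?u' \<in> B10 k m"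
    have eq: "?h m ?u - ?h m ?u' = \<pi>' k m (?u - ?u') - \<pi>' k i (?u - ?u')"
      using orth_proj_diff[OF plane(1,2)[OF m(1)], of ?u ?u']
        orth_proj_diff[OF plane(1,2)[OF i(1)], of ?u ?u'] by (simp add: algebra_simps)
    have "hd_norm (x k i) (100 * rad k) (P k i) (P k m) \<le> \<epsilon>"
      using m hd d4 by blast
    from dir_proj_close[OF plane(1,3)[OF i(1)] plane(1,2)[OF m(1)] _ this, of "?u - ?u'"] rad_pos[of k]
    show "norm (?h m ?u - ?h m ?u') \<le> 16 * \<epsilon> * norm (?u - ?u')"
      unfolding eq by (subst norm_minus_commute) simp
  qed (use pt d4 eps_pos in auto)
  also have "(\<Sum>m\<in>J k. \<theta> k m ?u *\<^sub>R ?h m ?u) - (\<Sum>m\<in>J k. \<theta> k m ?u' *\<^sub>R ?h m ?u') = ?d - \<pi>' k i (?u - ?u')"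
    using sigma_V8[OF i(5), of "\<pi> k i ?u"] sigma_V8[OF V', of "\<pi> k i ?u'"]
      orth_proj_diff[OF plane(1,2)[OF i(1)], of ?u ?u'] by (simp add: algebra_simps)
  also have "2 * A\<^sup>2 * (164 * \<epsilon> + 16 * \<epsilon>) * norm (?u - ?u') \<le> 2 * A\<^sup>2 * (164 * \<epsilon> + 16 * \<epsilon>) * (2 * norm ?d)"
    using eps_pos by (intro mult_left_mono dist_step_lower[OF ct z]) auto
  finally have "norm (?d - \<pi>' k i (?u - ?u')) \<le> 720 * A\<^sup>2 * \<epsilon> * norm ?d" by simp
  then have "norm (?d - \<pi>' k i ?d) \<le> 720 * A\<^sup>2 * \<epsilon> * norm ?d"
    using norm_diff_dir_proj_le_dist[OF plane(1,2)[OF i(1)] dir_proj_in[OF plane(1,2)[OF i(1)]]]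
      order_trans by blast
  moreover have "norm (\<pi>' (Suc k) j ?d - \<pi>' k i ?d) \<le> 16 * \<epsilon> * norm ?d"
    using dir_proj_close[OF plane(1,3)[OF i(1)] plane(1,2)[OF j] _ hd_parent[OF i(1) j i(2)], of ?d] rad_pos[of k]
    by (simp add: norm_minus_commute)
  ultimately have "norm (\<pi>' (Suc k) j ?d - ?d) \<le> 16 * \<epsilon> * norm ?d + 720 * A\<^sup>2 * \<epsilon> * norm ?d"
    using norm_triangle_ineq4[of "\<pi>' (Suc k) j ?d - \<pi>' k i ?d" "?d - \<pi>' k i ?d"] by simp
  also have "\<dots> \<le> 80 * A\<^sup>2 * \<epsilon> * norm ?d + 720 * A\<^sup>2 * \<epsilon> * norm ?d"
    using eps_pos one_le_power[OF A, of 2] by (intro add_mono mult_right_mono) auto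
  also have "\<dots> = 800 * A\<^sup>2 * \<epsilon> * norm ?d" by (simp del: DT_iter.simps)
  finally show "norm (\<pi>' (Suc k) j ?d - ?d) \<le> 800 * A\<^sup>2 * \<epsilon> * norm ?d" .
qed

lemma chords_tangential: "chords_tangential k"
  by (induction k) (simp_all add: chords_tangential_0 chords_tangential_Suc)

lemma dist_iter_lower:
  assumes "z \<in> \<Sigma>0" "z' \<in> \<Sigma>0"
  shows "norm (z - z') \<le> 2 ^ k * norm (f k z - f k z')"
proof (induction k)
  case (Suc k)
  have "2 ^ k * norm (f k z - f k z') \<le> 2 ^ k * (2 * norm (f (Suc k) z - f (Suc k) z'))"
    by (intro mult_left_mono dist_step_lower chords_tangential assms) simp
  from order_trans[OF Suc this] show ?case by (simp add: mult_ac del: DT_iter.simps)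
qed simp

abbreviation "F \<equiv> DT_map J P \<theta> \<psi>"

lemma F_limit:
  assumes "z \<in> \<Sigma>0"
  shows "(\<lambda>k. f k z) \<longlonglongrightarrow> F z" and "norm (F z - f k z) \<le> rad k / 2"
proof -
  have step: "norm (f (Suc k) z - f k z) \<le> 1 / 4 * rad k" for k
    using f_step_le(2)[OF assms, of k] by simp
  show "(\<lambda>k. f k z) \<longlonglongrightarrow> F z" "norm (F z - f k z) \<le> rad k / 2"
    using geometric_limit[of "\<lambda>k. f k z" "1 / 4", OF step] by (simp_all add: DT_map_def)
qed

text \<open>The iterates approach \<open>F\<close> faster, with ratio 1/10, than chords can shrink, with ratio 1/2; for
  distinct points the left-hand side is thus positive for large \<open>k\<close>.\<close>

lemma F_dist_lower:
  assumes "z \<in> \<Sigma>0" "z' \<in> \<Sigma>0"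
  shows "norm (z - z') / 2 ^ k - rad k \<le> norm (F z - F z')"
proof -
  have eq: "f k z - f k z' = (F z - F z') - (F z - f k z) + (F z' - f k z')" by simp
  have "norm (f k z - f k z') \<le> norm (F z - F z') + rad k / 2 + rad k / 2"
    unfolding eq by (intro norm_triangle_le norm_triangle_le_diff add_mono F_limit(2) assms order_refl)
  moreover have "norm (z - z') / 2 ^ k \<le> norm (f k z - f k z')"
    using dist_iter_lower[OF assms, of k] by (simp add: pos_divide_le_eq mult.commute)
  ultimately show ?thesis by linarith
qed

end

section \<open>Limits and inverses of C11 parametrizations\<close>

lemma has_derivative_limit:
  fixes g :: "nat \<Rightarrow> 'a::real_normed_vector \<Rightarrow> 'b::banach"
  assumes der: "\<And>k z. (g k has_derivative g' k z) (at z)"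
    and step: "\<And>k z v. norm (g' (Suc k) z v - g' k z v) \<le> c * rad k * norm v" and c: "0 \<le> c"
    and lim: "\<And>z. (\<lambda>k. g k z) \<longlonglongrightarrow> G z"
  shows "(\<lambda>k. g' k z v) \<longlonglongrightarrow> lim (\<lambda>k. g' k z v)"
    and "(G has_derivative (\<lambda>v. lim (\<lambda>k. g' k z v))) (at z)"
proof -
  have conv: "(\<lambda>k. g' k z v) \<longlonglongrightarrow> lim (\<lambda>k. g' k z v)"
    "norm (lim (\<lambda>k. g' k z v) - g' n z v) \<le> 2 * (c * norm v) * rad n" for z v n
    using geometric_limit[of "\<lambda>k. g' k z v" "c * norm v"] step[of _ z v] c by (simp_all add: mult_ac)
  show "(\<lambda>k. g' k z v) \<longlonglongrightarrow> lim (\<lambda>k. g' k z v)" by (rule conv)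
  have "\<exists>H. \<forall>z\<in>UNIV. (\<lambda>n. g n z) \<longlonglongrightarrow> H z \<and> (H has_derivative (\<lambda>v. lim (\<lambda>k. g' k z v))) (at z)"
  proof (rule has_derivative_sequence[OF convex_UNIV])
    show "(g n has_derivative g' n z) (at z)" for n z by (rule der)
    show "(\<lambda>n. g n z) \<longlonglongrightarrow> G z" by (rule lim)
    fix \<delta> :: real assume "0 < \<delta>"
    have "rad \<longlonglongrightarrow> 0" unfolding rad_def[abs_def] by (rule LIMSEQ_power_zero) simp
    then have "(\<lambda>n. 2 * c * rad n) \<longlonglongrightarrow> 0" by (rule tendsto_mult_right_zero)
    from order_tendstoD(2)[OF this \<open>0 < \<delta>\<close>]
    show "\<forall>\<^sub>F n in sequentially. \<forall>z\<in>UNIV. \<forall>v. norm (g' n z v - lim (\<lambda>k. g' k z v)) \<le> \<delta> * norm v"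
    proof eventually_elim
      case (elim n)
      have "norm (g' n z v - lim (\<lambda>k. g' k z v)) \<le> \<delta> * norm v" for z v
      proof -
        have "norm (g' n z v - lim (\<lambda>k. g' k z v)) \<le> (2 * c * rad n) * norm v"
          using conv(2)[of z v n] by (simp add: norm_minus_commute mult_ac)
        also have "\<dots> \<le> \<delta> * norm v" using elim by (intro mult_right_mono) auto
        finally show ?thesis .
      qed
      then show ?case by blast
    qed
  qed auto
  then obtain H where H: "\<And>z. (\<lambda>n. g n z) \<longlonglongrightarrow> H z"
    "\<And>z. (H has_derivative (\<lambda>v. lim (\<lambda>k. g' k z v))) (at z)" by auto
  have "H = G" using LIMSEQ_unique[OF H(1) lim] by blast
  then show "(G has_derivative (\<lambda>v. lim (\<lambda>k. g' k z v))) (at z)" using H(2) by simp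
qed

lemma has_vector_derivative_along_curve:
  assumes F: "(F has_derivative F') (at p within S)"
    and \<gamma>: "range \<gamma> \<subseteq> S" "\<gamma> 0 = p" "(\<gamma> has_vector_derivative v) (at (0::real))"
  shows "((F \<circ> \<gamma>) has_vector_derivative F' v) (at 0)"
proof -
  have lin: "linear F'" by (rule has_derivative_linear[OF F])
  have "(F has_derivative F') (at (\<gamma> 0) within range \<gamma>)"
    using has_derivative_subset[OF F \<gamma>(1)] \<gamma>(2) by simp
  from has_derivative_in_compose[OF \<gamma>(3)[unfolded has_vector_derivative_def] this]
  show ?thesis by (simp add: has_vector_derivative_def o_def linear_scale[OF lin])
qed

text \<open>By the chain rule along a curve, any two derivatives within a set agree on its tangent vectors;
  on these, \<open>dir_deriv\<close> can therefore be computed from any derivative.\<close>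

lemma derivative_on_tangent_unique:
  assumes "(F has_derivative F1) (at p within S)" "(F has_derivative F2) (at p within S)"
    and "v \<in> tangent_vectors S p"
  shows "F1 v = F2 v"
proof -
  obtain \<gamma> :: "real \<Rightarrow> 'a" where "range \<gamma> \<subseteq> S" "\<gamma> 0 = p" "(\<gamma> has_vector_derivative v) (at 0)"
    using assms(3) by (auto simp: tangent_vectors_def)
  from has_vector_derivative_along_curve[OF assms(1) this]
    has_vector_derivative_along_curve[OF assms(2) this]
  show ?thesis by (rule vector_derivative_unique_at)
qed

lemma dir_deriv_eq:
  assumes "(F has_derivative F') (at p within S)" "v \<in> tangent_vectors S p"
  shows "dir_deriv S F p v = F' v"
proof -
  have "(F has_derivative frechet_derivative F (at p within S)) (at p within S)"
    using assms(1) differentiableI frechet_derivative_works by blast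
  then show ?thesis
    unfolding dir_deriv_def using assms by (rule derivative_on_tangent_unique)
qed

lemma directions_tangent:
  assumes "affine S" "p \<in> S" "v \<in> directions S"
  shows "v \<in> tangent_vectors S p"
  unfolding tangent_vectors_def
proof (intro CollectI exI[of _ "\<lambda>t. p + t *\<^sub>R v"] conjI)
  have "S \<noteq> {}" using assms by blast
  then show "range (\<lambda>t. p + t *\<^sub>R v) \<subseteq> S"
    using plus_directions[OF assms(1,2)] subspace_scale[OF subspace_directions[OF assms(1)]] assms(3)
    by blast
  show "((\<lambda>t. p + t *\<^sub>R v) has_vector_derivative v) (at 0)"
    by (auto intro!: derivative_eq_intros)
qed simp

text \<open>Of the two lower bounds, the infinitesimal one makes each derivative injective along \<open>S\<close> and
  bounds the derivative of the inverse by \<open>1 / c\<close>; the one for chords makes the inverse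
  exist and be Lipschitz.\<close>

locale C11_parametrization =
  fixes S :: "'a::euclidean_space set" and F :: "'a \<Rightarrow> 'a" and F' :: "'a \<Rightarrow> 'a \<Rightarrow> 'a" and \<Lambda> c :: real
  assumes S: "affine S" "S \<noteq> {}"
    and der: "z \<in> S \<Longrightarrow> (F has_derivative F' z) (at z within S)"
    and Lipschitz: "z \<in> S \<Longrightarrow> z' \<in> S \<Longrightarrow> norm (F' z v - F' z' v) \<le> \<Lambda> * norm (z - z') * norm v"
    and immersion: "z \<in> S \<Longrightarrow> v \<in> directions S \<Longrightarrow> c * norm v \<le> norm (F' z v)"
    and expansion: "z \<in> S \<Longrightarrow> z' \<in> S \<Longrightarrow> c * norm (z - z') \<le> norm (F z - F z')"
    and c: "0 < c" and \<Lambda>: "0 \<le> \<Lambda>"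
begin

lemma inj: "inj_on F S"
proof (rule inj_onI)
  fix z z' assume "z \<in> S" "z' \<in> S" "F z = F z'"
  with expansion[of z z'] c show "z = z'" by (simp add: mult_le_0_iff)
qed

abbreviation "g \<equiv> inv_into S F"

lemma g_F: "z \<in> S \<Longrightarrow> g (F z) = z"
  using inj by (rule inv_into_f_f)

lemma differentiable_on: "F differentiable_on S"
  using der by (auto simp: differentiable_on_def differentiable_def)

lemma dir_deriv_F: "z \<in> S \<Longrightarrow> v \<in> directions S \<Longrightarrow> dir_deriv S F z v = F' z v"
  by (rule dir_deriv_eq[OF der directions_tangent[OF S(1)]])

lemma Lipschitz_dir_deriv:
  assumes "v \<in> directions S" "norm v = 1" "\<Lambda> \<le> L"
  shows "L-lipschitz_on S (\<lambda>z. dir_deriv S F z v)"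
proof (rule lipschitz_onI)
  fix z z' assume z: "z \<in> S" "z' \<in> S"
  have "norm (F' z v - F' z' v) \<le> \<Lambda> * norm (z - z')"
    using Lipschitz[OF z, of v] assms(2) by simp
  also have "\<dots> \<le> L * norm (z - z')" using assms(3) by (rule mult_right_mono) simp
  finally show "dist (dir_deriv S F z v) (dir_deriv S F z' v) \<le> L * dist z z'"
    using dir_deriv_F z assms(1) by (simp add: dist_norm)
qed (use assms \<Lambda> in simp)

lemma continuously_differentiable: "continuously_differentiable_on S F"
  unfolding continuously_differentiable_on_def
proof (intro exI[of _ "\<lambda>z. Blinfun (F' z)"] conjI ballI)
  have bl: "bounded_linear (F' z)" if "z \<in> S" for z
    using der[OF that] by (rule has_derivative_bounded_linear)
  show "(F has_derivative blinfun_apply (Blinfun (F' z))) (at z within S)" if "z \<in> S" for z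
    using der[OF that] bl[OF that] by (simp add: bounded_linear_Blinfun_apply)
  have "\<Lambda>-lipschitz_on S (\<lambda>z. Blinfun (F' z))"
  proof (rule lipschitz_onI[OF _ \<Lambda>])
    fix z z' assume z: "z \<in> S" "z' \<in> S"
    show "dist (Blinfun (F' z)) (Blinfun (F' z')) \<le> \<Lambda> * dist z z'"
      unfolding dist_norm
    proof (rule norm_blinfun_bound)
      fix v
      show "norm (blinfun_apply (Blinfun (F' z) - Blinfun (F' z')) v) \<le> \<Lambda> * norm (z - z') * norm v"
        using Lipschitz[OF z] bl z by (simp add: blinfun.diff_left bounded_linear_Blinfun_apply)
    qed (use \<Lambda> in simp)
  qed
  then show "continuous_on S (\<lambda>z. Blinfun (F' z))" by (rule lipschitz_on_continuous_on)
qed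

text \<open>Any linear left inverse of \<open>F' z\<close> on \<open>directions S\<close> is a derivative of the inverse map: apply
  it to the expansion of \<open>F\<close> at \<open>z\<close>, whose error is small compared with \<open>norm (z' - z)\<close> and
  hence, by expansion, with \<open>norm (F z' - F z)\<close>.\<close>

lemma has_derivative_inverse:
  assumes z: "z \<in> S"
  shows "\<exists>T. (g has_derivative T) (at (F z) within F ` S)"
proof -
  have lin: "linear (F' z)" by (rule has_derivative_linear[OF der[OF z]])
  have sub: "subspace (directions S)" by (rule subspace_directions[OF S])
  have "inj_on (F' z) (directions S)"
  proof (subst linear_inj_on_iff_eq_0[OF lin sub], intro ballI impI)
    fix v assume "v \<in> directions S" "F' z v = 0"
    then show "v = 0" using immersion[OF z, of v] c by (simp add: mult_le_0_iff)
  qed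
  from linear_exists_left_inverse_on[OF lin sub this]
  obtain T where T: "linear T" "\<And>v. v \<in> directions S \<Longrightarrow> T (F' z v) = v" by blast
  then have blT: "bounded_linear T" by (simp add: linear_conv_bounded_linear)
  obtain K where K: "K > 0" "\<And>w. norm (T w) \<le> norm w * K"
    using bounded_linear.pos_bounded[OF blT] by blast
  have "(g has_derivative T) (at (F z) within F ` S)"
    unfolding has_derivative_within_alt
  proof (intro conjI blT allI impI)
    fix \<delta> :: real assume \<delta>: "0 < \<delta>"
    let ?\<delta>' = "\<delta> * c / K"
    have "?\<delta>' > 0" using \<delta> c K by simp
    then obtain r where r: "r > 0"
      "\<And>z'. z' \<in> S \<Longrightarrow> norm (z' - z) < r \<Longrightarrow> norm (F z' - F z - F' z (z' - z)) \<le> ?\<delta>' * norm (z' - z)"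
      using der[OF z] unfolding has_derivative_within_alt by blast
    have "norm (g q - g (F z) - T (q - F z)) \<le> \<delta> * norm (q - F z)"
      if q: "q \<in> F ` S" "norm (q - F z) < c * r" for q
    proof -
      obtain z' where z': "z' \<in> S" "q = F z'" using q by blast
      have ex: "c * norm (z' - z) \<le> norm (q - F z)" using expansion[OF z'(1) z] z'(2) by simp
      then have "c * norm (z' - z) < c * r" using q(2) by linarith
      then have small: "norm (z' - z) < r" using c by simp
      have "g q - g (F z) - T (q - F z) = - T (q - F z - F' z (z' - z))"
        using z z' T by (simp add: g_F diff_in_directions linear_diff[OF T(1), of "F z' - F z"])
      also have "norm \<dots> \<le> norm (q - F z - F' z (z' - z)) * K"
        using K(2) by simp
      also have "\<dots> \<le> ?\<delta>' * norm (z' - z) * K"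
        using r(2)[OF z'(1) small] K(1) z'(2) by (intro mult_right_mono) auto
      also have "\<dots> = \<delta> * (c * norm (z' - z))" using K(1) by simp
      also have "\<dots> \<le> \<delta> * norm (q - F z)" using ex \<delta> by (intro mult_left_mono) auto
      finally show ?thesis .
    qed
    then show "\<exists>r'>0. \<forall>q\<in>F ` S. norm (q - F z) < r' \<longrightarrow>
        norm (g q - g (F z) - T (q - F z)) \<le> \<delta> * norm (q - F z)"
      using c r(1) by (intro exI[of _ "c * r"]) auto
  qed
  then show ?thesis by blast
qed

lemma differentiable_on_inverse: "g differentiable_on F ` S"
  using has_derivative_inverse by (auto simp: differentiable_on_def differentiable_def)

text \<open>A curve in \<open>F ` S\<close> with velocity \<open>w\<close> is mapped by \<open>g\<close> to a curve in \<open>S\<close>. It is fixed by the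
  projection onto \<open>S\<close>, so that its velocity lies in \<open>directions S\<close>, and \<open>F\<close> maps it back.\<close>

lemma dir_deriv_inverse:
  assumes z: "z \<in> S" and w: "w \<in> tangent_vectors (F ` S) (F z)"
  shows "dir_deriv (F ` S) g (F z) w \<in> directions S" "F' z (dir_deriv (F ` S) g (F z) w) = w"
proof -
  obtain \<gamma> :: "real \<Rightarrow> 'a" where \<gamma>: "range \<gamma> \<subseteq> F ` S" "\<gamma> 0 = F z" "(\<gamma> has_vector_derivative w) (at 0)"
    using w by (auto simp: tangent_vectors_def)
  obtain T where T: "(g has_derivative T) (at (F z) within F ` S)"
    using has_derivative_inverse[OF z] by blast
  define v where "v = T w"
  have v: "dir_deriv (F ` S) g (F z) w = v" unfolding v_def by (rule dir_deriv_eq[OF T w])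
  have dv: "((g \<circ> \<gamma>) has_vector_derivative v) (at 0)"
    unfolding v_def by (rule has_vector_derivative_along_curve[OF T \<gamma>])
  have ran: "(g \<circ> \<gamma>) t \<in> S" for t
    using \<gamma>(1) inv_into_into[of "\<gamma> t" F S] by auto
  have "((orth_proj S \<circ> (g \<circ> \<gamma>)) has_vector_derivative dir_proj S v) (at 0)"
    by (rule has_vector_derivative_along_curve[OF has_derivative_orth_proj[OF S] _ refl dv]) auto
  moreover have "orth_proj S \<circ> (g \<circ> \<gamma>) = g \<circ> \<gamma>"
    using orth_proj_fix[OF S ran] by auto
  ultimately have "dir_proj S v = v"
    using vector_derivative_unique_at dv by metis
  then show "dir_deriv (F ` S) g (F z) w \<in> directions S"
    using dir_proj_in[OF S, of v] v by simp
  have "((F \<circ> (g \<circ> \<gamma>)) has_vector_derivative F' z v) (at 0)"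
    by (rule has_vector_derivative_along_curve[OF der[OF z] _ _ dv]) (use ran \<gamma>(2) z g_F in auto)
  moreover have "F \<circ> (g \<circ> \<gamma>) = \<gamma>"
    using \<gamma>(1) by (auto simp: f_inv_into_f image_subset_iff)
  ultimately show "F' z (dir_deriv (F ` S) g (F z) w) = w"
    using vector_derivative_unique_at \<gamma>(3) v by metis
qed

text \<open>Let \<open>v\<close>, \<open>v'\<close> be the derivatives in question. Then \<open>F' z (v - v') = (w - w') + (F' z' v' - F' z v')\<close>, where
  \<open>norm v' \<le> 1 / c\<close>, and immersion bounds \<open>v - v'\<close> by this.\<close>

lemma Lipschitz_dir_deriv_inverse:
  assumes L: "(1 + \<Lambda> / c\<^sup>2) / c \<le> L"
  shows "L-lipschitz_on (unit_tangent_bundle (F ` S)) (\<lambda>(p, w). dir_deriv (F ` S) g p w)"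
proof (rule lipschitz_onI)
  show "0 \<le> L" using L \<Lambda> c by (meson add_nonneg_nonneg divide_nonneg_nonneg less_imp_le order_trans zero_le_one zero_le_power2)
  fix a a' assume a: "a \<in> unit_tangent_bundle (F ` S)" "a' \<in> unit_tangent_bundle (F ` S)"
  obtain z w where z: "a = (F z, w)" "z \<in> S" "w \<in> tangent_vectors (F ` S) (F z)"
    using a(1) by (auto simp: unit_tangent_bundle_def)
  obtain z' w' where z': "a' = (F z', w')" "z' \<in> S" "w' \<in> tangent_vectors (F ` S) (F z')" "norm w' = 1"
    using a(2) by (auto simp: unit_tangent_bundle_def)
  let ?v = "dir_deriv (F ` S) g (F z) w" and ?v' = "dir_deriv (F ` S) g (F z') w'"
  note v = dir_deriv_inverse[OF z(2,3)] and v' = dir_deriv_inverse[OF z'(2,3)]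
  have dw: "norm (w - w') \<le> dist a a'" and dz: "norm (F z - F z') \<le> dist a a'"
    using dist_fst_le[of a a'] dist_snd_le[of a a'] z(1) z'(1) by (simp_all add: dist_norm)
  have lin: "linear (F' z)" by (rule has_derivative_linear[OF der[OF z(2)]])
  have "c * norm ?v' \<le> 1" using immersion[OF z'(2) v'(1)] v'(2) z'(4) by simp
  then have nv: "norm ?v' \<le> 1 / c" using c by (simp add: pos_le_divide_eq mult.commute)
  have nz: "norm (z - z') \<le> dist a a' / c"
    using expansion[OF z(2) z'(2)] dz c by (simp add: pos_le_divide_eq mult.commute)
  have "?v - ?v' \<in> directions S"
    using subspace_directions[OF S] v(1) v'(1) by (rule subspace_diff)
  then have "c * norm (?v - ?v') \<le> norm (F' z (?v - ?v'))" by (rule immersion[OF z(2)])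
  also have "F' z (?v - ?v') = (w - w') + (F' z' ?v' - F' z ?v')"
    by (simp add: linear_diff[OF lin] v(2) v'(2))
  also have "norm \<dots> \<le> dist a a' + \<Lambda> * norm (z' - z) * norm ?v'"
    by (intro norm_triangle_le add_mono dw Lipschitz z(2) z'(2))
  also have "\<Lambda> * norm (z' - z) * norm ?v' \<le> \<Lambda> * (dist a a' / c) * (1 / c)"
    using nz nv \<Lambda> c by (intro mult_mono mult_left_mono) (auto simp: norm_minus_commute)
  finally have "norm (?v - ?v') \<le> (1 + \<Lambda> / c\<^sup>2) / c * dist a a'"
    using c by (simp add: field_simps power2_eq_square)
  also have "\<dots> \<le> L * dist a a'" using L by (rule mult_right_mono) simp
  finally show "dist ((\<lambda>(p, w). dir_deriv (F ` S) g p w) a) ((\<lambda>(p, w). dir_deriv (F ` S) g p w) a') \<le> L * dist a a'"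
    by (simp add: z(1) z'(1) dist_norm)
qed

end

section \<open>Derivatives along orbits when the distances of planes are summable\<close>

text \<open>The constants of the regularity estimates as functions of \<open>A\<close> and a bound \<open>B\<close> for
  \<open>\<Sum>k. \<beta> z k / rad k\<close>. They do not mention the collection, which makes the final Lipschitz constant
  uniform. \<open>Lipschitz_const\<close> solves the recursion for second derivatives, its factor
  \<open>4 * A\<close> being the cost of the one step at which an orbit leaves the moving region. On balls of
  radius \<open>local_radius\<close> the linear part of \<open>F\<close> dominates the quadratic error; \<open>expansion_const\<close> covers
  both short and long distances.\<close>

definition upper_const :: "real \<Rightarrow> real \<Rightarrow> real" where
  "upper_const A B = exp (3000 * A ^ 3 * B)"

definition immersion_const :: "real \<Rightarrow> real \<Rightarrow> real" where
  "immersion_const A B = exp (- (6000 * A ^ 3 * B))"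

definition Lipschitz_const :: "real \<Rightarrow> real \<Rightarrow> real" where
  "Lipschitz_const A B = 4 * A * (exp (2000 * A\<^sup>2 * B) * (3000 * A ^ 4 * (upper_const A B)\<^sup>2 * B))"

definition local_radius :: "real \<Rightarrow> real \<Rightarrow> real" where
  "local_radius A B = immersion_const A B / (2 * (Lipschitz_const A B + 1))"

definition expansion_const :: "real \<Rightarrow> real \<Rightarrow> real" where
  "expansion_const A B = min (immersion_const A B / 2)
     (1 / 2 ^ Suc (SOME k. 2 \<le> 5 ^ k * local_radius A B))"

locale david_toro_summable = david_toro +
  fixes B :: real
  assumes sum_beta_le: "z \<in> \<Sigma>0 \<Longrightarrow> (\<Sum>k<n. \<beta> z k / rad k) \<le> B"
begin

lemma B_nonneg: "0 \<le> B"
  using sum_beta_le[of _ 0] S0(2) by auto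

lemma beta_le_rad:
  assumes "z \<in> \<Sigma>0"
  shows "\<beta> z k \<le> B * rad k"
proof -
  have "\<beta> z k / rad k \<le> (\<Sum>k<Suc k. \<beta> z k / rad k)"
    using beta_nonneg rad_pos by (intro member_le_sum) (auto simp: less_imp_le)
  also have "\<dots> \<le> B" by (rule sum_beta_le[OF assms])
  finally show ?thesis using rad_pos[of k] by (simp add: pos_divide_le_eq)
qed

lemma beta_le_div_rad: "\<beta> z k \<le> \<beta> z k / rad k"
  using mult_left_mono[OF rad_le_1[of k] beta_nonneg[of z k]] rad_pos[of k]
  by (simp add: pos_le_divide_eq)

lemma sum_const_beta_le:
  assumes "z \<in> \<Sigma>0" "0 \<le> K"
  shows "(\<Sum>k<n. K * \<beta> z k) \<le> K * B"
proof -
  have "(\<Sum>k<n. K * \<beta> z k) \<le> K * (\<Sum>k<n. \<beta> z k / rad k)"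
    unfolding sum_distrib_left by (intro sum_mono mult_left_mono beta_le_div_rad assms)
  also have "\<dots> \<le> K * B" by (intro mult_left_mono sum_beta_le assms)
  finally show ?thesis .
qed

text \<open>A step changes \<open>Df k z v\<close> by a relative amount of order \<open>\<beta> z k\<close>, which is summable.\<close>

lemma Df_upper:
  assumes z: "z \<in> \<Sigma>0" and v: "v \<in> directions \<Sigma>0"
  shows "norm (Df k z v) \<le> upper_const A B * norm v"
proof -
  have "norm (Df k z v) \<le> exp (\<Sum>k<k. 3000 * A ^ 3 * \<beta> z k) * norm (Df 0 z v)"
  proof (rule Gronwall_exp)
    show "norm (Df (Suc k) z v) \<le> (1 + 3000 * A ^ 3 * \<beta> z k) * norm (Df k z v)" for k
      using Df_step_le[OF z z v, of k] norm_triangle_ineq2[of "Df (Suc k) z v" "Df k z v"]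
      by (simp add: distrib_right del: Df.simps)
  qed simp
  also have "\<dots> \<le> upper_const A B * norm v"
    unfolding upper_const_def using sum_const_beta_le[OF z, of "3000 * A ^ 3" k] A
    by (intro mult_mono) auto
  finally show ?thesis .
qed

lemma Df_lower:
  assumes z: "z \<in> \<Sigma>0" and v: "v \<in> directions \<Sigma>0"
  shows "immersion_const A B * norm v \<le> norm (Df k z v)"
proof -
  have "norm (Df 0 z v) \<le> exp (\<Sum>k<k. 6000 * A ^ 3 * \<beta> z k) * norm (Df k z v)"
  proof (rule Gronwall_exp_lower)
    fix k
    let ?b = "3000 * A ^ 3 * \<beta> z k"
    have "0 \<le> ?b" "?b \<le> 1 / 2"
      using beta_nonneg[of z k] A power_A_beta[of 3 z k] by auto
    then have "?b * ?b \<le> ?b * (1 / 2)" by (intro mult_left_mono)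
    then have b: "1 \<le> (1 + 2 * ?b) * (1 - ?b)" by (simp add: algebra_simps)
    have 1: "(1 - ?b) * norm (Df k z v) \<le> norm (Df (Suc k) z v)"
      using Df_step_le[OF z z v, of k] norm_triangle_ineq2[of "Df k z v" "Df (Suc k) z v"]
      by (simp add: left_diff_distrib norm_minus_commute del: Df.simps)
    have "norm (Df k z v) \<le> (1 + 2 * ?b) * (1 - ?b) * norm (Df k z v)"
      using mult_right_mono[OF b norm_ge_zero] by simp
    also have "\<dots> \<le> (1 + 2 * ?b) * norm (Df (Suc k) z v)"
      unfolding mult.assoc[of "1 + 2 * ?b"] using \<open>0 \<le> ?b\<close> by (intro mult_left_mono 1) simp
    finally show "norm (Df k z v) \<le> (1 + 6000 * A ^ 3 * \<beta> z k) * norm (Df (Suc k) z v)"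
      by (simp add: mult.assoc del: Df.simps)
  qed simp
  also have "\<dots> \<le> exp (6000 * A ^ 3 * B) * norm (Df k z v)"
    using sum_const_beta_le[OF z, of "6000 * A ^ 3" k] A by (intro mult_right_mono) auto
  finally have "immersion_const A B * norm v
      \<le> immersion_const A B * (exp (6000 * A ^ 3 * B) * norm (Df k z v))"
    by (intro mult_left_mono) (auto simp: immersion_const_def)
  also have "\<dots> = norm (Df k z v)"
    by (simp add: immersion_const_def flip: mult.assoc exp_add)
  finally show ?thesis .
qed

lemma Df_step_le_rad:
  assumes z: "z \<in> \<Sigma>0" and v: "v \<in> directions \<Sigma>0"
  shows "norm (Df (Suc k) z v - Df k z v) \<le> 3000 * A ^ 3 * B * upper_const A B * rad k * norm v"
proof -
  have "norm (Df (Suc k) z v - Df k z v) \<le> 3000 * A ^ 3 * \<beta> z k * norm (Df k z v)"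
    by (rule Df_step_le[OF z z v])
  also have "\<dots> \<le> 3000 * A ^ 3 * (B * rad k) * (upper_const A B * norm v)"
    using A B_nonneg rad_pos[of k] beta_nonneg[of z k]
    by (intro mult_mono beta_le_rad Df_upper z v) (auto simp: less_imp_le)
  finally show ?thesis by (simp add: mult_ac)
qed

lemma D2sigma_le:
  assumes z: "z \<in> \<Sigma>0" and u: "u \<in> directions \<Sigma>0" and v: "v \<in> directions \<Sigma>0"
  shows "norm (D2sigma k (f k z) (Df k z u) (Df k z v))
    \<le> 3000 * A ^ 4 * (upper_const A B)\<^sup>2 * (\<beta> z k / rad k) * (norm u * norm v)"
proof -
  let ?y = "f k z" and ?w = "Df k z u" and ?w' = "Df k z v"
  let ?b = "\<beta> z k / rad k"
  have r: "0 < rad k" by (rule rad_pos)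
  have b: "0 \<le> ?b * (norm ?w * norm ?w')" using beta_nonneg[of z k] r by simp
  have "norm (D2sigma k ?y ?w ?w') \<le> A * (3000 * A ^ 3 * (?b * (norm ?w * norm ?w')))"
    unfolding D2sigma_def
  proof (rule norm_sum_le[of _ ?y])
    fix j assume j: "j \<in> J k"
    show "D2 k j ?y ?w ?w' *\<^sub>R (\<pi> k j ?y - ?y) + D1 k j ?y ?w' *\<^sub>R (\<pi>' k j ?w - ?w)
        + D1 k j ?y ?w *\<^sub>R (\<pi>' k j ?w' - ?w') = 0" if "?y \<notin> B10 k j"
      unfolding nabla_theta_outside[OF j that] by simp
    assume y: "?y \<in> B10 k j"
    have pt: "norm (\<pi> k j ?y - ?y) \<le> 2000 * \<beta> z k * rad k"
      using near[OF z, of k] j y by (simp add: near_def)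
    have tan: "norm (\<pi>' k j (Df k z s) - Df k z s) \<le> 500 * A ^ 2 * \<beta> z k * norm (Df k z s)"
      if "s \<in> directions \<Sigma>0" for s
      using tangential[OF z that, of k] j y by (simp add: tangential_def)
    have "norm (D2 k j ?y ?w ?w' *\<^sub>R (\<pi> k j ?y - ?y))
        \<le> (A / (rad k)\<^sup>2 * norm ?w * norm ?w') * (2000 * \<beta> z k * rad k)"
      unfolding norm_scaleR using pt A r by (intro mult_mono) (auto intro: D2_le[OF j, simplified])
    also have "\<dots> = 2000 * A * (?b * (norm ?w * norm ?w'))"
      using r by (simp add: power2_eq_square)
    finally have 1: "norm (D2 k j ?y ?w ?w' *\<^sub>R (\<pi> k j ?y - ?y)) \<le> 2000 * A * (?b * (norm ?w * norm ?w'))" .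
    have "norm (D1 k j ?y ?w' *\<^sub>R (\<pi>' k j ?w - ?w)) \<le> (A / rad k * norm ?w') * (500 * A ^ 2 * \<beta> z k * norm ?w)"
      unfolding norm_scaleR by (intro mult_mono tan u D1_le j) (use A r in auto)
    also have "\<dots> = 500 * A ^ 3 * (?b * (norm ?w * norm ?w'))"
      by (simp add: power2_eq_square power3_eq_cube)
    finally have 2: "norm (D1 k j ?y ?w' *\<^sub>R (\<pi>' k j ?w - ?w)) \<le> 500 * A ^ 3 * (?b * (norm ?w * norm ?w'))" .
    have "norm (D1 k j ?y ?w *\<^sub>R (\<pi>' k j ?w' - ?w')) \<le> (A / rad k * norm ?w) * (500 * A ^ 2 * \<beta> z k * norm ?w')"
      unfolding norm_scaleR by (intro mult_mono tan v D1_le j) (use A r in auto)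
    also have "\<dots> = 500 * A ^ 3 * (?b * (norm ?w * norm ?w'))"
      by (simp add: power2_eq_square power3_eq_cube)
    finally have 3: "norm (D1 k j ?y ?w *\<^sub>R (\<pi>' k j ?w' - ?w')) \<le> 500 * A ^ 3 * (?b * (norm ?w * norm ?w'))" .
    have "A * (?b * (norm ?w * norm ?w')) \<le> A ^ 3 * (?b * (norm ?w * norm ?w'))"
      using A b self_le_power[of A 3] by (intro mult_right_mono) auto
    then show "norm (D2 k j ?y ?w ?w' *\<^sub>R (\<pi> k j ?y - ?y) + D1 k j ?y ?w' *\<^sub>R (\<pi>' k j ?w - ?w)
        + D1 k j ?y ?w *\<^sub>R (\<pi>' k j ?w' - ?w')) \<le> 3000 * A ^ 3 * (?b * (norm ?w * norm ?w'))"
      using norm_triangle_mono[OF norm_triangle_mono[OF 1 2] 3] by linarith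
  qed (rule mult_nonneg_nonneg[OF _ b], use A in simp)
  also have "\<dots> \<le> A * (3000 * A ^ 3 * (?b * ((upper_const A B * norm u) * (upper_const A B * norm v))))"
    using A beta_nonneg[of z k] r
    by (intro mult_left_mono mult_mono Df_upper z u v) (auto simp: upper_const_def)
  also have "\<dots> = 3000 * A ^ 4 * (upper_const A B)\<^sup>2 * ?b * (norm u * norm v)"
    by (simp add: power2_eq_square power4_eq_xxxx power3_eq_cube)
  finally show ?thesis .
qed

lemma B10_subset_V10: "j \<in> J k \<Longrightarrow> B10 k j \<subseteq> V J x 10 k"
  by (auto simp: V_def B10_def)

lemma V10_B10: "y \<in> V J x 10 k \<Longrightarrow> \<exists>j\<in>J k. y \<in> B10 k j"
  by (auto simp: V_def B10_def)

lemma V8_subset_V10: "V J x 8 k \<subseteq> V J x 10 k"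
  using rad_pos[of k] by (force simp: V_def)

lemma norm_D1_sum_le:
  assumes z: "z \<in> \<Sigma>0"
  shows "norm (\<Sum>j\<in>J k. D1 k j (f k z) q *\<^sub>R (\<pi> k j (f k z) - f k z)) \<le> 2000 * A\<^sup>2 * \<beta> z k * norm q"
proof -
  let ?y = "f k z"
  have r: "0 < rad k" by (rule rad_pos)
  have "norm (\<Sum>j\<in>J k. D1 k j ?y q *\<^sub>R (\<pi> k j ?y - ?y)) \<le> A * (2000 * A * (\<beta> z k * norm q))"
  proof (rule norm_sum_le[of _ ?y])
    fix j assume j: "j \<in> J k"
    show "D1 k j ?y q *\<^sub>R (\<pi> k j ?y - ?y) = 0" if "?y \<notin> B10 k j"
      unfolding nabla_theta_outside[OF j that] by simp
    assume y: "?y \<in> B10 k j"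
    have pt: "norm (\<pi> k j ?y - ?y) \<le> 2000 * \<beta> z k * rad k"
      using near[OF z, of k] j y by (simp add: near_def)
    have "norm (D1 k j ?y q *\<^sub>R (\<pi> k j ?y - ?y)) \<le> (A / rad k * norm q) * (2000 * \<beta> z k * rad k)"
      unfolding norm_scaleR by (intro mult_mono pt D1_le j) (use A r in auto)
    also have "\<dots> = 2000 * A * (\<beta> z k * norm q)" using r by simp
    finally show "norm (D1 k j ?y q *\<^sub>R (\<pi> k j ?y - ?y)) \<le> 2000 * A * (\<beta> z k * norm q)" .
  qed (use A beta_nonneg[of z k] in simp)
  then show ?thesis by (simp add: power2_eq_square mult_ac)
qed

text \<open>For vectors not tangent to the iterated surface, such as second derivatives, \<open>Dsigma\<close> is not close
  to the identity. Outside \<open>V J x 8 k\<close>, where \<open>\<psi>\<close> may be negative or of size \<open>A\<close>, there is only this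
  crude bound; on \<open>V J x 8 k\<close> it is up to order \<open>\<beta>\<close> a convex combination of projections, of norm
  at most 1.\<close>

lemma Dsigma_le:
  assumes z: "z \<in> \<Sigma>0"
  shows "norm (Dsigma k (f k z) q) \<le> 4 * A * norm q"
proof -
  let ?y = "f k z"
  have "norm (\<Sum>j\<in>J k. \<theta> k j ?y *\<^sub>R (\<pi>' k j q - q)) \<le> 2 * A * norm q"
    using norm_diff_dir_proj_le[OF plane(1,2)]
    by (intro norm_theta_sum_le_2A) (auto simp: norm_minus_commute)
  moreover have "2000 * A\<^sup>2 * \<beta> z k * norm q \<le> 1 * norm q"
    using power_A_beta[of 2 z k] by (intro mult_right_mono) auto
  then have "norm (\<Sum>j\<in>J k. D1 k j ?y q *\<^sub>R (\<pi> k j ?y - ?y)) \<le> 1 * norm q"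
    by (rule order_trans[OF norm_D1_sum_le[OF z]])
  moreover have eq: "Dsigma k ?y q = q + ((\<Sum>j\<in>J k. D1 k j ?y q *\<^sub>R (\<pi> k j ?y - ?y))
      + (\<Sum>j\<in>J k. \<theta> k j ?y *\<^sub>R (\<pi>' k j q - q)))"
    by (simp add: Dsigma_def sum.distrib)
  ultimately have "norm (Dsigma k ?y q) \<le> norm q + (1 * norm q + 2 * A * norm q)"
    unfolding eq by (intro norm_triangle_le add_mono order_refl)
  also have "\<dots> \<le> 4 * A * norm q"
    using mult_right_mono[OF A, of "norm q"] by simp
  finally show ?thesis .
qed

lemma Dsigma_le_V8:
  assumes z: "z \<in> \<Sigma>0" and V8: "f k z \<in> V J x 8 k"
  shows "norm (Dsigma k (f k z) q) \<le> (1 + 2000 * A\<^sup>2 * \<beta> z k) * norm q"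
proof -
  let ?y = "f k z"
  have "norm (\<Sum>j\<in>J k. \<theta> k j ?y *\<^sub>R (\<pi>' k j q - 0)) \<le> (\<Sum>j\<in>J k. \<theta> k j ?y) * norm q"
    using norm_dir_proj_le[OF plane(1,2)] by (intro norm_theta_sum_le) simp
  then have 1: "norm (\<Sum>j\<in>J k. \<theta> k j ?y *\<^sub>R (\<pi>' k j q - 0)) \<le> norm q"
    by (simp add: sum_theta_eq_1[OF V8])
  have "norm (Dsigma k ?y q - 0) \<le> 2000 * A\<^sup>2 * \<beta> z k * norm q + norm q"
    unfolding Dsigma_V8[OF V8, of q 0 ?y] by (rule norm_triangle_mono[OF norm_D1_sum_le[OF z] 1])
  then show ?thesis by (simp add: distrib_right)
qed

lemma outside_V10:
  assumes "y \<notin> V J x 10 k"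
  shows "\<sigma> k y = y" "Dsigma k y v = v" "D2sigma k y u v = 0"
proof -
  have out: "y \<notin> B10 k j" if "j \<in> J k" for j using assms B10_subset_V10[OF that] by blast
  show "\<sigma> k y = y" by (simp add: sigma_eq theta_outside out)
  have "(\<Sum>j\<in>J k. D1 k j y v *\<^sub>R (\<pi> k j y - y) + \<theta> k j y *\<^sub>R (\<pi>' k j v - v)) = 0"
    using nabla_theta_outside[OF _ out] theta_outside[OF _ out]
    by (intro sum.neutral) (simp del: nabla.simps)
  then show "Dsigma k y v = v" by (simp add: Dsigma_def)
  show "D2sigma k y u v = 0"
    unfolding D2sigma_def using nabla_theta_outside[OF _ out]
    by (intro sum.neutral) (simp del: nabla.simps)
qed

lemma V8_of_V10_Suc:
  assumes "z \<in> \<Sigma>0" "f (Suc k) z \<in> V J x 10 (Suc k)"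
  shows "f k z \<in> V J x 8 k"
  using ancestor[OF near[OF assms(1)]] V10_B10[OF assms(2)] by metis

text \<open>The recursion is \<open>D2f (Suc k) = D2sigma + Dsigma (D2f k)\<close> with a first term of order \<open>\<beta> z k / rad k\<close>, and \<open>Dsigma\<close>
  has norm \<open>1 + O(\<beta>)\<close> as long as \<open>f k z \<in> V J x 8 k\<close>. When this fails, the next iterate
  is outside \<open>V J x 10 (Suc k)\<close>, and so are all later ones: from then on the orbit and its derivatives are constant, and the
  crude bound for \<open>Dsigma\<close> is used at most once. Hence the two-part induction hypothesis.\<close>

lemma D2f_le:
  assumes z: "z \<in> \<Sigma>0" and u: "u \<in> directions \<Sigma>0" and v: "v \<in> directions \<Sigma>0"
  shows "norm (D2f k z u v) \<le> Lipschitz_const A B * (norm u * norm v)"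
proof -
  define S where "S k = (\<Sum>i<k. \<beta> z i / rad i)" for k
  define c where "c = 3000 * A ^ 4 * (upper_const A B)\<^sup>2 * (norm u * norm v)"
  define G where "G k = exp (2000 * A\<^sup>2 * S k) * (c * S k)" for k
  have c: "0 \<le> c" using A by (simp add: c_def)
  have b: "0 \<le> \<beta> z i / rad i" for i using beta_nonneg[of z i] rad_pos[of i] by simp
  have S: "0 \<le> S k" "S k \<le> B" for k
    unfolding S_def using b sum_beta_le[OF z] by (auto intro: sum_nonneg)
  have S_Suc: "S (Suc k) = S k + \<beta> z k / rad k" for k by (simp add: S_def)
  have G_nonneg: "0 \<le> G k" for k using c S by (simp add: G_def)
  have G_Suc: "(1 + 2000 * A\<^sup>2 * \<beta> z k) * G k + c * (\<beta> z k / rad k) \<le> G (Suc k)" for k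
  proof -
    let ?t = "2000 * A\<^sup>2 * (\<beta> z k / rad k)"
    have "1 + 2000 * A\<^sup>2 * \<beta> z k \<le> 1 + ?t"
      using A by (intro add_left_mono mult_left_mono beta_le_div_rad) auto
    also have "\<dots> \<le> exp ?t" by (rule exp_ge_add_one_self)
    finally have "(1 + 2000 * A\<^sup>2 * \<beta> z k) * G k \<le> exp ?t * G k"
      using G_nonneg by (rule mult_right_mono)
    also have "\<dots> = exp (2000 * A\<^sup>2 * S (Suc k)) * (c * S k)"
      by (simp add: G_def S_Suc distrib_left exp_add)
    finally have 1: "(1 + 2000 * A\<^sup>2 * \<beta> z k) * G k \<le> exp (2000 * A\<^sup>2 * S (Suc k)) * (c * S k)" .
    have "1 \<le> exp (2000 * A\<^sup>2 * S (Suc k))" using S by simp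
    from mult_right_mono[OF this mult_nonneg_nonneg[OF c b[of k]]]
    have "c * (\<beta> z k / rad k) \<le> exp (2000 * A\<^sup>2 * S (Suc k)) * (c * (\<beta> z k / rad k))" by simp
    with 1 show ?thesis by (simp add: G_def S_Suc algebra_simps)
  qed
  have G_mono: "G k \<le> G (Suc k)" for k
  proof -
    have "1 * G k \<le> (1 + 2000 * A\<^sup>2 * \<beta> z k) * G k"
      using beta_nonneg G_nonneg by (intro mult_right_mono) auto
    moreover have "0 \<le> c * (\<beta> z k / rad k)" using c b[of k] by (rule mult_nonneg_nonneg)
    ultimately show ?thesis using G_Suc[of k] by simp
  qed
  have D2s: "norm (D2sigma k (f k z) (Df k z u) (Df k z v)) \<le> c * (\<beta> z k / rad k)" for k
    using D2sigma_le[OF z u v, of k] by (simp add: c_def mult_ac)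
  have A4: "1 \<le> 4 * A" using A by simp
  have "(f k z \<in> V J x 10 k \<longrightarrow> norm (D2f k z u v) \<le> G k) \<and> norm (D2f k z u v) \<le> 4 * A * G k" for k
  proof (induction k)
    case 0
    then show ?case using G_nonneg[of 0] A by simp
  next
    case (Suc k)
    show ?case
    proof (cases "f k z \<in> V J x 8 k")
      case True
      have "norm (D2f (Suc k) z u v) \<le> c * (\<beta> z k / rad k) + (1 + 2000 * A\<^sup>2 * \<beta> z k) * norm (D2f k z u v)"
        unfolding D2f.simps by (rule norm_triangle_mono[OF D2s Dsigma_le_V8[OF z True]])
      also have "\<dots> \<le> c * (\<beta> z k / rad k) + (1 + 2000 * A\<^sup>2 * \<beta> z k) * G k"
        using Suc True V8_subset_V10[of k] beta_nonneg[of z k]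
        by (intro add_left_mono mult_left_mono) auto
      also have "\<dots> \<le> G (Suc k)" using G_Suc[of k] by simp
      finally have *: "norm (D2f (Suc k) z u v) \<le> G (Suc k)" .
      also have "\<dots> \<le> 4 * A * G (Suc k)"
        using mult_right_mono[OF A4 G_nonneg] by simp
      finally show ?thesis using * by blast
    next
      case V8: False
      then have "f (Suc k) z \<notin> V J x 10 (Suc k)" using V8_of_V10_Suc[OF z] by blast
      moreover have "norm (D2f (Suc k) z u v) \<le> 4 * A * G (Suc k)"
      proof (cases "f k z \<in> V J x 10 k")
        case False
        then have "norm (D2f (Suc k) z u v) \<le> 4 * A * G k"
          using Suc by (simp add: outside_V10)
        also have "\<dots> \<le> 4 * A * G (Suc k)" using A by (intro mult_left_mono G_mono) simp
        finally show ?thesis .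
      next
        case True
        have "norm (D2f (Suc k) z u v) \<le> c * (\<beta> z k / rad k) + 4 * A * norm (D2f k z u v)"
          unfolding D2f.simps by (rule norm_triangle_mono[OF D2s Dsigma_le[OF z]])
        also have "\<dots> \<le> 4 * A * (c * (\<beta> z k / rad k)) + 4 * A * ((1 + 2000 * A\<^sup>2 * \<beta> z k) * G k)"
        proof (intro add_mono mult_left_mono)
          show "c * (\<beta> z k / rad k) \<le> 4 * A * (c * (\<beta> z k / rad k))"
            using mult_right_mono[OF A4 mult_nonneg_nonneg[OF c b[of k]]] by simp
          have "1 * G k \<le> (1 + 2000 * A\<^sup>2 * \<beta> z k) * G k"
            using beta_nonneg G_nonneg by (intro mult_right_mono) auto
          then show "norm (D2f k z u v) \<le> (1 + 2000 * A\<^sup>2 * \<beta> z k) * G k"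
            using Suc True by simp
        qed (use A in auto)
        also have "\<dots> \<le> 4 * A * G (Suc k)"
          unfolding distrib_left[symmetric] using G_Suc[of k] A by (intro mult_left_mono) auto
        finally show ?thesis .
      qed
      ultimately show ?thesis by blast
    qed
  qed
  then have "norm (D2f k z u v) \<le> 4 * A * G k" by blast
  also have "\<dots> \<le> 4 * A * (exp (2000 * A\<^sup>2 * B) * (c * B))"
    unfolding G_def using A c S[of k] B_nonneg by (intro mult_left_mono mult_mono) auto
  also have "\<dots> = Lipschitz_const A B * (norm u * norm v)"
    by (simp add: Lipschitz_const_def c_def)
  finally show ?thesis .
qed

lemma consts_pos: "0 < upper_const A B" "0 < immersion_const A B" "0 \<le> Lipschitz_const A B"
  "0 < local_radius A B" "0 < expansion_const A B"
proof -
  show 1: "0 < upper_const A B" "0 < immersion_const A B" "0 \<le> Lipschitz_const A B"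
    using A B_nonneg by (auto simp: upper_const_def immersion_const_def Lipschitz_const_def)
  then show "0 < local_radius A B" by (simp add: local_radius_def)
  show "0 < expansion_const A B" using 1 by (simp add: expansion_const_def)
qed

section \<open>Regularity of the limit map\<close>

definition DF :: "'a \<Rightarrow> 'a \<Rightarrow> 'a" where
  "DF z v = lim (\<lambda>k. Df k (orth_proj \<Sigma>0 z) (dir_proj \<Sigma>0 v))"

text \<open>Composition with the projection onto \<open>\<Sigma>0\<close> makes the bounds, which hold along \<open>\<Sigma>0\<close> only, valid
  in all directions.\<close>

lemma DF_limit_and_derivative:
  shows DF_limit: "(\<lambda>k. Df k (orth_proj \<Sigma>0 z) (dir_proj \<Sigma>0 v)) \<longlonglongrightarrow> DF z v"
    and has_derivative_F_proj: "((\<lambda>z. F (orth_proj \<Sigma>0 z)) has_derivative DF z) (at z)"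
proof -
  note in_S = orth_proj_in[OF S0] and in_d = dir_proj_in[OF S0]
  have der: "((\<lambda>z. f k (orth_proj \<Sigma>0 z)) has_derivative (\<lambda>v. Df k (orth_proj \<Sigma>0 z) (dir_proj \<Sigma>0 v))) (at z)" for k z
    by (rule has_derivative_compose[OF has_derivative_orth_proj[OF S0] has_derivative_f])
  have step: "norm (Df (Suc k) (orth_proj \<Sigma>0 z) (dir_proj \<Sigma>0 v) - Df k (orth_proj \<Sigma>0 z) (dir_proj \<Sigma>0 v))
      \<le> (3000 * A ^ 3 * B * upper_const A B) * rad k * norm v" for k z v
  proof -
    have "norm (Df (Suc k) (orth_proj \<Sigma>0 z) (dir_proj \<Sigma>0 v) - Df k (orth_proj \<Sigma>0 z) (dir_proj \<Sigma>0 v))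
      \<le> (3000 * A ^ 3 * B * upper_const A B) * rad k * norm (dir_proj \<Sigma>0 v)"
      by (rule Df_step_le_rad[OF in_S in_d])
    also have "\<dots> \<le> (3000 * A ^ 3 * B * upper_const A B) * rad k * norm v"
      using A B_nonneg consts_pos rad_pos[of k] by (intro mult_left_mono norm_dir_proj_le[OF S0]) auto
    finally show ?thesis .
  qed
  have c: "0 \<le> 3000 * A ^ 3 * B * upper_const A B" using A B_nonneg consts_pos by simp
  note * = has_derivative_limit[of "\<lambda>k z. f k (orth_proj \<Sigma>0 z)",
      OF der step c F_limit(1)[OF in_S]]
  show "(\<lambda>k. Df k (orth_proj \<Sigma>0 z) (dir_proj \<Sigma>0 v)) \<longlonglongrightarrow> DF z v"
    unfolding DF_def by (rule *(1))
  show "((\<lambda>z. F (orth_proj \<Sigma>0 z)) has_derivative DF z) (at z)"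
    unfolding DF_def by (rule *(2))
qed

lemma DF_Lipschitz: "norm (DF z v - DF z' v) \<le> Lipschitz_const A B * norm (z - z') * norm v"
proof -
  let ?p = "orth_proj \<Sigma>0" and ?d = "dir_proj \<Sigma>0" and ?L = "Lipschitz_const A B"
  have "norm (Df k (?p z) (?d v) - Df k (?p z') (?d v)) \<le> (?L * norm v) * norm (z - z')" for k
  proof (rule differentiable_bound[OF convex_UNIV, where f' = "\<lambda>z u. D2f k (?p z) (?d u) (?d v)"])
    show "((\<lambda>z. Df k (?p z) (?d v)) has_derivative (\<lambda>u. D2f k (?p z) (?d u) (?d v))) (at z)" for z
      by (rule has_derivative_compose[OF has_derivative_orth_proj[OF S0] has_derivative_Df])
    show "onorm (\<lambda>u. D2f k (?p z) (?d u) (?d v)) \<le> ?L * norm v" for z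
    proof (rule onorm_bound)
      fix u
      have "norm (D2f k (?p z) (?d u) (?d v)) \<le> ?L * (norm (?d u) * norm (?d v))"
        by (intro D2f_le orth_proj_in dir_proj_in S0)
      also have "\<dots> \<le> ?L * (norm u * norm v)"
        using consts_pos by (intro mult_left_mono mult_mono norm_dir_proj_le S0) auto
      finally show "norm (D2f k (?p z) (?d u) (?d v)) \<le> ?L * norm v * norm u"
        by (simp add: mult_ac)
    qed (use consts_pos in simp)
  qed auto
  then have "norm (DF z v - DF z' v) \<le> (?L * norm v) * norm (z - z')"
    by (intro LIMSEQ_le_const2[OF tendsto_norm[OF tendsto_diff[OF DF_limit DF_limit]]]) blast
  then show ?thesis by (simp add: mult_ac)
qed

lemma DF_immersion:
  assumes "z \<in> \<Sigma>0" "v \<in> directions \<Sigma>0"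
  shows "immersion_const A B * norm v \<le> norm (DF z v)"
proof (rule LIMSEQ_le_const[OF tendsto_norm[OF DF_limit]])
  show "\<exists>N. \<forall>n\<ge>N. immersion_const A B * norm v \<le> norm (Df n (orth_proj \<Sigma>0 z) (dir_proj \<Sigma>0 v))"
    using Df_lower[OF assms] by (simp add: orth_proj_fix[OF S0] dir_proj_fix[OF S0] assms)
qed

text \<open>At distances up to \<open>local_radius\<close>, \<open>F\<close> differs from its linear part at \<open>z\<close> by at most half of the
  immersion bound. At larger distances, \<open>F_dist_lower\<close> with one fixed \<open>k\<close> suffices.\<close>

lemma F_expansion:
  assumes z: "z \<in> \<Sigma>0" and z': "z' \<in> \<Sigma>0"
  shows "expansion_const A B * norm (z - z') \<le> norm (F z - F z')"
proof (cases "norm (z - z') \<le> local_radius A B")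
  case True
  let ?L = "Lipschitz_const A B" and ?m = "immersion_const A B"
  let ?R = "\<lambda>p. F (orth_proj \<Sigma>0 p) - DF z p"
  have blz: "bounded_linear (DF z)" by (rule has_derivative_bounded_linear[OF has_derivative_F_proj])
  have "norm (?R z - ?R z') \<le> (?L * norm (z - z')) * norm (z - z')"
  proof (rule differentiable_bound[of "closed_segment z z'" _ "\<lambda>p v. DF p v - DF z v"])
    fix p assume p: "p \<in> closed_segment z z'"
    show "(?R has_derivative (\<lambda>v. DF p v - DF z v)) (at p within closed_segment z z')"
      by (intro has_derivative_diff has_derivative_at_withinI[OF has_derivative_F_proj]
          bounded_linear_imp_has_derivative blz)
    show "onorm (\<lambda>v. DF p v - DF z v) \<le> ?L * norm (z - z')"
    proof (rule onorm_bound)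
      fix v
      have "norm (DF p v - DF z v) \<le> ?L * norm (p - z) * norm v" by (rule DF_Lipschitz)
      also have "\<dots> \<le> ?L * norm (z - z') * norm v"
        using segment_bound(1)[OF p] consts_pos
        by (intro mult_right_mono mult_left_mono) (auto simp: norm_minus_commute)
      finally show "norm (DF p v - DF z v) \<le> ?L * norm (z - z') * norm v" .
    qed (use consts_pos in simp)
  qed auto
  also have "?R z - ?R z' = (F z - F z') - DF z (z - z')"
    by (simp add: orth_proj_fix[OF S0] z z' linear_diff[OF bounded_linear.linear[OF blz]])
  also have "?L * norm (z - z') * norm (z - z') \<le> ?m / 2 * norm (z - z')"
  proof (rule mult_right_mono)
    have "?L * norm (z - z') \<le> (?L + 1) * local_radius A B"
      using True consts_pos by (intro mult_mono) auto
    also have "\<dots> = ?m / 2"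
    proof -
      have "l * (m / (2 * l)) = m / 2" if "0 < l" for l m :: real using that by simp
      from this[of "?L + 1"] show ?thesis using consts_pos by (simp only: local_radius_def)
    qed
    finally show "?L * norm (z - z') \<le> ?m / 2" .
  qed simp
  finally have "norm ((F z - F z') - DF z (z - z')) \<le> ?m / 2 * norm (z - z')" .
  moreover have "?m * norm (z - z') \<le> norm (DF z (z - z'))"
    by (rule DF_immersion[OF z diff_in_directions[OF z z']])
  ultimately have "?m / 2 * norm (z - z') \<le> norm (F z - F z')"
    using norm_triangle_ineq2[of "DF z (z - z')" "F z - F z'"] by (simp add: norm_minus_commute)
  moreover have "expansion_const A B * norm (z - z') \<le> ?m / 2 * norm (z - z')"
    by (intro mult_right_mono) (auto simp: expansion_const_def)
  ultimately show ?thesis by linarith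
next
  case False
  define k where "k = (SOME k. 2 \<le> 5 ^ k * local_radius A B)"
  have "\<exists>k. 2 / local_radius A B < 5 ^ k" by (rule real_arch_pow) simp
  then have "\<exists>k. 2 \<le> 5 ^ k * local_radius A B"
    using consts_pos by (auto simp: pos_divide_less_eq intro: less_imp_le)
  then have k: "2 \<le> 5 ^ k * local_radius A B" unfolding k_def by (rule someI_ex)
  have "expansion_const A B * norm (z - z') \<le> 1 / 2 ^ Suc k * norm (z - z')"
    by (intro mult_right_mono) (auto simp: expansion_const_def k_def)
  also have "\<dots> \<le> norm (z - z') / 2 ^ k - rad k"
  proof -
    note k
    also have "5 ^ k * local_radius A B \<le> 5 ^ k * norm (z - z')"
      using False by (intro mult_left_mono) auto
    finally have "2 \<le> 5 ^ k * norm (z - z')" .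
    then have "2 / (5 ^ k * 2 ^ Suc k) \<le> 5 ^ k * norm (z - z') / (5 ^ k * 2 ^ Suc k)"
      by (intro divide_right_mono) auto
    moreover have "2 / (5 ^ k * 2 ^ Suc k) = rad k"
      by (simp add: rad_def power_one_over flip: power_mult_distrib)
    ultimately show ?thesis by simp
  qed
  also have "\<dots> \<le> norm (F z - F z')" by (rule F_dist_lower[OF z z'])
  finally show ?thesis .
qed

lemma C11_F: "C11_parametrization \<Sigma>0 F DF (Lipschitz_const A B) (expansion_const A B)"
proof
  show "affine \<Sigma>0" "\<Sigma>0 \<noteq> {}" by (rule S0)+
  show "(F has_derivative DF z) (at z within \<Sigma>0)" if "z \<in> \<Sigma>0" for z
    by (rule has_derivative_transform[OF that _ has_derivative_at_withinI[OF has_derivative_F_proj]])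
      (simp add: orth_proj_fix[OF S0])
  show "norm (DF z v - DF z' v) \<le> Lipschitz_const A B * norm (z - z') * norm v" for z z' v
    by (rule DF_Lipschitz)
  show "expansion_const A B * norm v \<le> norm (DF z v)" if "z \<in> \<Sigma>0" "v \<in> directions \<Sigma>0" for z v
  proof -
    have "expansion_const A B \<le> immersion_const A B"
      using consts_pos by (simp add: expansion_const_def)
    from mult_right_mono[OF this norm_ge_zero] DF_immersion[OF that] show ?thesis
      by (rule order_trans)
  qed
  show "expansion_const A B * norm (z - z') \<le> norm (F z - F z')" if "z \<in> \<Sigma>0" "z' \<in> \<Sigma>0" for z z'
    by (rule F_expansion[OF that])
  show "0 < expansion_const A B" "0 \<le> Lipschitz_const A B" by (rule consts_pos)+
qed

end

section \<open>Summing the hypothesis along an orbit\<close>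

text \<open>By \<open>a * b \<le> a\<^sup>2 / 2 + b\<^sup>2 / 2\<close> the two square-summability hypotheses make \<open>e k / rad k\<close> summable. The
  value \<open>\<eta> (rad 0)\<close> is not under control, but the term \<open>k = 0\<close> is at most \<open>\<epsilon>\<close>. A shift of generation
  costs a factor 10, as \<open>rad (Suc k) = rad k / 10\<close>.\<close>

lemma (in david_toro) sum_beta_bound:
  fixes \<eta> :: "real \<Rightarrow> real"
  assumes pos: "\<And>t. 0 < t \<Longrightarrow> 0 < \<eta> t"
    and eta: "summable (\<lambda>k. (\<eta> (rad (Suc k)))\<^sup>2)" "(\<Sum>k. (\<eta> (rad (Suc k)))\<^sup>2) \<le> S"
    and orbit: "summable (\<lambda>k. (eps_num J x P k (f k z) / (rad k * \<eta> (rad k)))\<^sup>2)"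
      "(\<Sum>k. (eps_num J x P k (f k z) / (rad k * \<eta> (rad k)))\<^sup>2) \<le> M"
  shows "(\<Sum>k<n. \<beta> z k / rad k) \<le> 12 + 6 * (M + S)"
proof -
  define a where "a k = e k (f k z) / rad k" for k
  define q where "q k = eps_num J x P k (f k z) / (rad k * \<eta> (rad k))" for k
  have a_nonneg: "0 \<le> a k" for k using e_nonneg rad_pos[of k] by (simp add: a_def)
  have "(\<Sum>k<n. (\<eta> (rad (Suc k)))\<^sup>2) \<le> (\<Sum>k. (\<eta> (rad (Suc k)))\<^sup>2)" for n
    by (rule sum_le_suminf[OF eta(1)]) auto
  then have S: "(\<Sum>k<n. (\<eta> (rad (Suc k)))\<^sup>2) \<le> S" for n using eta(2) by (rule order_trans)
  have "(\<Sum>k<n. (q k)\<^sup>2) \<le> (\<Sum>k. (q k)\<^sup>2)" for n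
    unfolding q_def by (rule sum_le_suminf[OF orbit(1)]) auto
  then have M: "(\<Sum>k<n. (q k)\<^sup>2) \<le> M" for n using orbit(2) unfolding q_def by (rule order_trans)
  have term_le: "a k \<le> (q k)\<^sup>2 / 2 + (\<eta> (rad k))\<^sup>2 / 2" for k
  proof -
    have "a k \<le> eps_num J x P k (f k z) / rad k"
      unfolding a_def e_def using rad_pos[of k] by (intro divide_right_mono) auto
    also have "\<dots> = q k * \<eta> (rad k)" using pos[OF rad_pos[of k]] by (simp add: q_def)
    also have "\<dots> \<le> (q k)\<^sup>2 / 2 + (\<eta> (rad k))\<^sup>2 / 2"
      using sum_squares_bound[of "q k" "\<eta> (rad k)"] by simp
    finally show ?thesis .
  qed
  have sum_a: "(\<Sum>k<n. a k) \<le> 1 + (M / 2 + S / 2)" for n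
  proof -
    have "(\<Sum>k<n. a k) \<le> (\<Sum>k<Suc n. a k)" using a_nonneg by simp
    also have "\<dots> = a 0 + (\<Sum>k<n. a (Suc k))" by (rule sum.lessThan_Suc_shift)
    also have "(\<Sum>k<n. a (Suc k)) \<le> (\<Sum>k<n. (q (Suc k))\<^sup>2 / 2 + (\<eta> (rad (Suc k)))\<^sup>2 / 2)"
      by (intro sum_mono term_le)
    also have "\<dots> = (\<Sum>k<n. (q (Suc k))\<^sup>2) / 2 + (\<Sum>k<n. (\<eta> (rad (Suc k)))\<^sup>2) / 2"
      by (simp add: sum.distrib sum_divide_distrib)
    also have "(\<Sum>k<n. (q (Suc k))\<^sup>2) \<le> (\<Sum>k<Suc n. (q k)\<^sup>2)"
      unfolding sum.lessThan_Suc_shift by simp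
    also have "\<dots> \<le> M" by (rule M)
    finally have "(\<Sum>k<n. a k) \<le> a 0 + (M / 2 + S / 2)" using S[of n] by simp
    moreover have "a 0 \<le> 1" using e_le[of 0 z] eps_le by (simp add: a_def rad_def)
    ultimately show ?thesis by linarith
  qed
  have "(\<Sum>k<Suc n. \<beta> z k / rad k) \<le> \<epsilon> + 10 * (\<Sum>k<n. a k) + (\<Sum>k<Suc n. a k)" for n
  proof (induction n)
    case 0
    then show ?case using a_nonneg[of 0] by (simp add: rad_def)
  next
    case (Suc n)
    have "\<beta> z (Suc n) / rad (Suc n) = 10 * a n + a (Suc n)"
      by (simp add: a_def rad_Suc add_divide_distrib del: DT_iter.simps)
    then show ?case using Suc by simp
  qed
  moreover have "\<epsilon> \<le> 1" using eps_le by simp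
  ultimately have "(\<Sum>k<Suc n. \<beta> z k / rad k) \<le> 1 + 10 * (\<Sum>k<n. a k) + (\<Sum>k<Suc n. a k)"
    by (meson add_right_mono order_trans)
  then have "(\<Sum>k<Suc n. \<beta> z k / rad k) \<le> 12 + 11 * (M / 2) + 11 * (S / 2)"
    using sum_a[of n] sum_a[of "Suc n"] by linarith
  moreover have "(\<Sum>k<n. \<beta> z k / rad k) \<le> (\<Sum>k<Suc n. \<beta> z k / rad k)"
    using beta_nonneg[of z n] rad_pos[of n] by simp
  moreover have "0 \<le> M" "0 \<le> S" using M[of 0] S[of 0] by auto
  ultimately show ?thesis by simp
qed

section \<open>Regularity of the David--Toro map\<close>

theorem theorem3p6:
  fixes d :: nat and C :: "nat \<Rightarrow> real"
  assumes "0 < d" and "d < CARD('n::finite)"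
  shows "\<exists>\<epsilon>0 > 0. \<forall>M > 0. \<forall>S. \<exists>L.
    \<forall>\<epsilon> (E :: (real ^ 'n) set) J x P \<Sigma>0 \<theta> \<psi> (\<eta> :: real \<Rightarrow> real).
      0 < \<epsilon> \<and> \<epsilon> \<le> \<epsilon>0 \<and>
      E \<subseteq> ball 0 1 \<and>
      one_sided_reifenberg_flat \<epsilon> d E \<and>
      coherent_collection \<epsilon> d E J x P \<Sigma>0 \<and>
      DT_partition C J x \<theta> \<psi> \<and>
      (\<forall>t > 0. \<eta> t > 0) \<and>
      summable (\<lambda>k. (\<eta> (rad (Suc k)))\<^sup>2) \<and>
      (\<Sum>k. (\<eta> (rad (Suc k)))\<^sup>2) \<le> S \<and>
      (\<forall>z\<in>\<Sigma>0.
         summable (\<lambda>k. (eps_num J x P k (DT_iter J P \<theta> \<psi> k z) / (rad k * \<eta> (rad k)))\<^sup>2) \<and>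
         (\<Sum>k. (eps_num J x P k (DT_iter J P \<theta> \<psi> k z) / (rad k * \<eta> (rad k)))\<^sup>2) \<le> M)
      \<longrightarrow>
      (let f = DT_map J P \<theta> \<psi>; \<Sigma> = f ` \<Sigma>0; g = inv_into \<Sigma>0 f in
         bij_betw f \<Sigma>0 \<Sigma> \<and>
         f differentiable_on \<Sigma>0 \<and>
         (\<forall>v \<in> directions \<Sigma>0. norm v = 1 \<longrightarrow>
            L-lipschitz_on \<Sigma>0 (\<lambda>z. dir_deriv \<Sigma>0 f z v)) \<and>
         g differentiable_on \<Sigma> \<and>
         L-lipschitz_on (unit_tangent_bundle \<Sigma>) (\<lambda>(p, v). dir_deriv \<Sigma> g p v) \<and>
         continuously_differentiable_on \<Sigma>0 f)"
proof -
  obtain N :: nat where N: "\<And>(c :: nat \<Rightarrow> real ^ 'n) I y r. 0 < r \<Longrightarrow>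
      (\<forall>i\<in>I. \<forall>j\<in>I. i \<noteq> j \<longrightarrow> r \<le> dist (c i) (c j)) \<Longrightarrow>
      (\<forall>i\<in>I. dist y (c i) \<le> 10 * r) \<Longrightarrow> finite I \<and> card I \<le> N"
    using separated_card_bound[where 'a = "real ^ 'n" and R = 10] by blast
  \<comment> \<open>\<open>A\<close> depends on the dimension and \<open>C\<close> only, hence so does \<open>\<epsilon>0\<close>.\<close>
  define A where "A = Max {1, real N, C 0, C 1, C 2}"
  have A: "1 \<le> A" "real N \<le> A" "C 0 \<le> A" "C 1 \<le> A" "C 2 \<le> A" by (auto simp: A_def)
  define \<epsilon>0 where "\<epsilon>0 = 1 / (10 ^ 5 * A ^ 4)"
  define L where "L M S = (let B = 12 + 6 * (M + S); \<Lambda> = Lipschitz_const A B; c = expansion_const A B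
      in max \<Lambda> ((1 + \<Lambda> / c\<^sup>2) / c))" for M S
  have "0 < \<epsilon>0" using A by (simp add: \<epsilon>0_def)
  moreover have "let f = DT_map J P \<theta> \<psi>; \<Sigma> = f ` \<Sigma>0; g = inv_into \<Sigma>0 f in
         bij_betw f \<Sigma>0 \<Sigma> \<and>
         f differentiable_on \<Sigma>0 \<and>
         (\<forall>v \<in> directions \<Sigma>0. norm v = 1 \<longrightarrow>
            (L M S)-lipschitz_on \<Sigma>0 (\<lambda>z. dir_deriv \<Sigma>0 f z v)) \<and>
         g differentiable_on \<Sigma> \<and>
         (L M S)-lipschitz_on (unit_tangent_bundle \<Sigma>) (\<lambda>(p, v). dir_deriv \<Sigma> g p v) \<and>
         continuously_differentiable_on \<Sigma>0 f"
    if \<epsilon>: "0 < \<epsilon>" "\<epsilon> \<le> \<epsilon>0" and E: "E \<subseteq> ball 0 1"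
      and coherent: "coherent_collection \<epsilon> d E J x P \<Sigma>0" and partition: "DT_partition C J x \<theta> \<psi>"
      and pos: "\<forall>t > 0. \<eta> t > 0"
      and eta: "summable (\<lambda>k. (\<eta> (rad (Suc k)))\<^sup>2)" "(\<Sum>k. (\<eta> (rad (Suc k)))\<^sup>2) \<le> S"
      and orbit: "\<forall>z\<in>\<Sigma>0.
         summable (\<lambda>k. (eps_num J x P k (DT_iter J P \<theta> \<psi> k z) / (rad k * \<eta> (rad k)))\<^sup>2) \<and>
         (\<Sum>k. (eps_num J x P k (DT_iter J P \<theta> \<psi> k z) / (rad k * \<eta> (rad k)))\<^sup>2) \<le> M"
    for \<epsilon> M S and E :: "(real ^ 'n) set" and J x P \<Sigma>0 \<theta> \<psi> and \<eta> :: "real \<Rightarrow> real"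
  proof -
    have sep: "\<forall>i\<in>J k. \<forall>j\<in>J k. i \<noteq> j \<longrightarrow> rad k \<le> dist (x k i) (x k j)" and in_E: "x k ` J k \<subseteq> E" for k
      using coherent by (auto simp: coherent_collection_def maximal_separated_family_def)
    interpret david_toro A \<epsilon> d C E J x P \<Sigma>0 \<theta> \<psi>
    proof
      show "10 ^ 5 * A ^ 4 * \<epsilon> \<le> 1"
        using \<epsilon>(2) A(1) by (simp add: \<epsilon>0_def pos_le_divide_eq mult_ac)
      show "finite (J k)" for k
      proof -
        \<comment> \<open>All of \<open>E\<close> lies within distance \<open>1 = (1 / rad k) * rad k\<close> of 0.\<close>
        obtain N' :: nat where "\<And>(c :: nat \<Rightarrow> real ^ 'n) I y r. 0 < r \<Longrightarrow>
            (\<forall>i\<in>I. \<forall>j\<in>I. i \<noteq> j \<longrightarrow> r \<le> dist (c i) (c j)) \<Longrightarrow>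
            (\<forall>i\<in>I. dist y (c i) \<le> (1 / rad k) * r) \<Longrightarrow> finite I \<and> card I \<le> N'"
          using separated_card_bound[where 'a = "real ^ 'n" and R = "1 / rad k"] by blast
        from this[where y = 0, OF rad_pos sep[of k]] show ?thesis
          using in_E[of k] E rad_pos[of k] by (force simp: less_imp_le)
      qed
      show "real (card {j \<in> J k. y \<in> ball (x k j) (10 * rad k)}) \<le> A" for k y
      proof -
        let ?I = "{j \<in> J k. y \<in> ball (x k j) (10 * rad k)}"
        have "finite ?I \<and> card ?I \<le> N"
          by (rule N[where c = "x k" and y = y, OF rad_pos[of k]]) (use sep[of k] in \<open>auto simp: dist_commute\<close>)
        then show ?thesis using A(2) by linarith
      qed
    qed (use A \<epsilon> coherent partition in auto)
    interpret david_toro_summable A \<epsilon> d C E J x P \<Sigma>0 \<theta> \<psi> "12 + 6 * (M + S)"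
      by unfold_locales (use sum_beta_bound pos eta orbit in blast)
    interpret C11: C11_parametrization \<Sigma>0 F DF "Lipschitz_const A (12 + 6 * (M + S))"
        "expansion_const A (12 + 6 * (M + S))"
      by (rule C11_F)
    show ?thesis
      unfolding Let_def
      using C11.inj C11.differentiable_on C11.Lipschitz_dir_deriv[of _ "L M S"]
        C11.differentiable_on_inverse C11.Lipschitz_dir_deriv_inverse[of "L M S"]
        C11.continuously_differentiable
      by (auto simp: L_def Let_def bij_betw_def)
  qed
  ultimately show ?thesis by blast
qed

end
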